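(* Let $n,m\in\mathbb{N}$, let $p(\cdot)\in\mathcal{P}(\mathbb{R}^n)\cap C^{\log}(\mathbb{R}^n)$ and let $W\in\mathcal{A}_{p(\cdot)}$ be a matrix weight $W:\mathbb{R}^n\to M_m(\mathbb{R})$. Let $\phi\in C_c^\infty(B(0,1))$ be a nonnegative, radially symmetric and decreasing function with $\int_{\mathbb{R}^n}\phi(x)\,dx=1$, and let $\phi_r(x)=r^{-n}\phi(x/r)$ for $r>0$. Suppose that $\mathcal{F}$ is a subset of $L^{p(\cdot)}(W)$. Then $\mathcal{F}$ is precompact in $L^{p(\cdot)}(W)$ if and only if the following three conditions hold: (i) $\mathcal{F}$ is bounded, i.e. $\sup_{\vec f\in\mathcal{F}}\|\vec f\|_{L^{p(\cdot)}(W)}<\infty$; (ii) $\mathcal{F}$ is equiapproximate, that is, $\lim_{r\to0^+}\sup_{\vec f\in\mathcal{F}}\|\vec f*\phi_r-\vec f\|_{L^{p(\cdot)}(W)}=0$; (iii) $\mathcal{F}$ uniformly vanishes at infinity, that is, $\lim_{R\to\infty}\sup_{\vec f\in\mathcal{F}}\|\vec f\chi_{B^c(0,R)}\|_{L^{p(\cdot)}(W)}=0$.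
   Context: For measurable $p(\cdot):\mathbb{R}^n\to(0,\infty)$ put $p^-=\operatorname{ess\,inf}p$, $p^+=\operatorname{ess\,sup}p$; $\mathcal{P}(\mathbb{R}^n)$ is the set of those $p(\cdot)$ with $p^->1$ and $p^+<\infty$, and $p'(\cdot)$ is the conjugate exponent, $1/p(x)+1/p'(x)=1$. $C^{\log}(\mathbb{R}^n)$ is the set of globally log-Hölder continuous functions: real-valued measurable $\alpha(\cdot)$ for which there are constants $C>0$ and $\alpha_\infty\in\mathbb{R}$ such that $|\alpha(x)-\alpha(y)|\le C/\log(e+1/|x-y|)$ whenever $|x-y|<1/2$, and $|\alpha(x)-\alpha_\infty|\le C/\log(e+|x|)$ for all $x\in\mathbb{R}^n$. For a scalar measurable $f$, $\|f\|_{L^{p(\cdot)}}=\inf\{\lambda>0:\int_{\mathbb{R}^n}(|f(x)|/\lambda)^{p(x)}\,dx\le1\}$ (infinite if no such $\lambda$ exists). $M_m(\mathbb{R})$ is the set of real $m\times m$ matrices, $|A|_{\mathrm{op}}=\sup_{|\vec z|=1}|A\vec z|$ with the Euclidean norm on $\mathbb{R}^m$. A matrix weight is a function $W:\mathbb{R}^n\to M_m(\mathbb{R})$ with locally integrable entries such that $W(x)$ is nonnegative definite for every $x$ and invertible for almost every $x$. $W\in\mathcal{A}_{p(\cdot)}$ means that $$[W]_{\mathcal{A}_{p(\cdot)}}:=\sup_Q|Q|^{-1}\Big\|\,\big\|\,|W(x)W^{-1}(\cdot)|_{\mathrm{op}}\chi_Q(\cdot)\big\|_{L^{p'(\cdot)}}\chi_Q(x)\Big\|_{L^{p(\cdot)}_x}<\infty,$$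 the supremum being over all cubes $Q\subset\mathbb{R}^n$. $L^{p(\cdot)}(W)$ is the space of measurable $\vec f:\mathbb{R}^n\to\mathbb{R}^m$ with $\|\vec f\|_{L^{p(\cdot)}(W)}:=\|\,|W\vec f|\,\|_{L^{p(\cdot)}}<\infty$ (functions equal a.e. are identified). The convolution $\vec f*\phi_r$ is taken componentwise. $B(0,R)$ is the ball of centre $0$ and radius $R$, $B^c(0,R)$ its complement; $\chi_S$ is the characteristic function of $S$; "decreasing" means decreasing as a function of $|x|$. *)

theory Defs
  imports "HOL-Analysis.Analysis" "HOL-Probability.Essential_Supremum"
begin

text \<open>Measurability and integrals on $R^n$ refer to Lebesgue measure.  Norms are taken in
  \<^typ>\<open>ennreal\<close>, so that they are defined, possibly infinite, for all functions.\<close>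

section \<open>Variable exponents\<close>

definition p_minus :: "(real ^ 'n \<Rightarrow> real) \<Rightarrow> ereal" where
  "p_minus p = Liminf (ae_filter lebesgue) (\<lambda>x. ereal (p x))"

definition p_plus :: "(real ^ 'n \<Rightarrow> real) \<Rightarrow> ereal" where
  "p_plus p = esssup lebesgue (\<lambda>x. ereal (p x))"

definition exponents :: "(real ^ 'n \<Rightarrow> real) set" where
  "exponents = {p. p \<in> borel_measurable lebesgue \<and> (\<forall>x. 0 < p x) \<and> 1 < p_minus p \<and> p_plus p < \<infinity>}"

text \<open>The solution of $1/p(x) + 1/p'(x) = 1$ where $p(x) > 1$, that is, almost everywhere
  for the exponents above.\<close>

definition conj_exponent :: "(real ^ 'n \<Rightarrow> real) \<Rightarrow> real ^ 'n \<Rightarrow> real" where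
  "conj_exponent p x = 1 / (1 - 1 / p x)"

text \<open>For \<open>x = y\<close> the first inequality is trivial, both here (where \<open>1 / 0 = 0\<close>) and with
  the usual reading $1/0 = \infty$.\<close>

definition log_Holder :: "(real ^ 'n \<Rightarrow> real) set" where
  "log_Holder = {\<alpha>. \<alpha> \<in> borel_measurable lebesgue \<and>
     (\<exists>C>0. \<exists>\<alpha>_inf.
        (\<forall>x y. norm (x - y) < 1 / 2 \<longrightarrow> \<bar>\<alpha> x - \<alpha> y\<bar> \<le> C / ln (exp 1 + 1 / norm (x - y))) \<and>
        (\<forall>x. \<bar>\<alpha> x - \<alpha>_inf\<bar> \<le> C / ln (exp 1 + norm x)))}"

text \<open>Powers of extended nonnegative numbers, for positive exponents.\<close>

definition epowr :: "ennreal \<Rightarrow> real \<Rightarrow> ennreal" where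
  "epowr a q = (if a = \<infinity> then \<infinity> else ennreal (enn2real a powr q))"

text \<open>The Luxemburg norm, taking as argument the absolute value of the function.  Infinite
  values are admitted because the inner norm in the matrix $A_{p(\cdot)}$ condition may be
  infinite; the infimum of the empty set is infinite.\<close>

definition lux_norm :: "(real ^ 'n \<Rightarrow> real) \<Rightarrow> (real ^ 'n \<Rightarrow> ennreal) \<Rightarrow> ennreal" where
  "lux_norm p f =
     Inf {ennreal t | t. 0 < t \<and> (\<integral>\<^sup>+x. epowr (f x / ennreal t) (p x) \<partial>lebesgue) \<le> 1}"

section \<open>Matrix weights\<close>

text \<open>Nonnegative definiteness is the condition $\langle W(x) z, z\rangle \ge 0$.  Symmetry is not
  imposed, so weights with symmetric values are a special case.\<close>

definition matrix_weight :: "(real ^ 'n \<Rightarrow> real ^ 'm ^ 'm) \<Rightarrow> bool" where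
  "matrix_weight W \<longleftrightarrow>
     (\<forall>i j. \<forall>K. compact K \<longrightarrow> (\<lambda>x. W x $ i $ j) absolutely_integrable_on K) \<and>
     (\<forall>x z. 0 \<le> (W x *v z) \<bullet> z) \<and>
     (AE x in lebesgue. invertible (W x))"

text \<open>Cubes have sides parallel to the coordinate axes.\<close>

definition cubes :: "(real ^ 'n) set set" where
  "cubes = {cbox a (\<chi> i. a $ i + l) | a l. 0 < l}"

definition Ap_const :: "(real ^ 'n \<Rightarrow> real) \<Rightarrow> (real ^ 'n \<Rightarrow> real ^ 'm ^ 'm) \<Rightarrow> ennreal" where
  "Ap_const p W = (SUP Q\<in>cubes.
     lux_norm p (\<lambda>x.
       lux_norm (conj_exponent p)
         (\<lambda>y. ennreal (onorm ((*v) (W x ** matrix_inv (W y)))) * indicator Q y)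
       * indicator Q x) / emeasure lebesgue Q)"

definition Ap :: "(real ^ 'n \<Rightarrow> real) \<Rightarrow> (real ^ 'n \<Rightarrow> real ^ 'm ^ 'm) set" where
  "Ap p = {W. Ap_const p W < \<infinity>}"

section \<open>Weighted spaces\<close>

definition wnorm ::
  "(real ^ 'n \<Rightarrow> real) \<Rightarrow> (real ^ 'n \<Rightarrow> real ^ 'm ^ 'm) \<Rightarrow> (real ^ 'n \<Rightarrow> real ^ 'm) \<Rightarrow> ennreal" where
  "wnorm p W f = lux_norm p (\<lambda>x. ennreal (norm (W x *v f x)))"

text \<open>Functions of finite norm, before identification of those that agree almost everywhere.\<close>

definition wLp ::
  "(real ^ 'n \<Rightarrow> real) \<Rightarrow> (real ^ 'n \<Rightarrow> real ^ 'm ^ 'm) \<Rightarrow> (real ^ 'n \<Rightarrow> real ^ 'm) set" where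
  "wLp p W = {f. f \<in> borel_measurable lebesgue \<and> wnorm p W f < \<infinity>}"

definition wLp_rel ::
  "(real ^ 'n \<Rightarrow> real) \<Rightarrow> (real ^ 'n \<Rightarrow> real ^ 'm ^ 'm) \<Rightarrow> (real ^ 'n \<Rightarrow> real ^ 'm) rel" where
  "wLp_rel p W = {(f, g). f \<in> wLp p W \<and> g \<in> wLp p W \<and> (AE x in lebesgue. f x = g x)}"

text \<open>The norm does not depend on the choice of representatives.\<close>

definition wLp_dist ::
  "(real ^ 'n \<Rightarrow> real) \<Rightarrow> (real ^ 'n \<Rightarrow> real ^ 'm ^ 'm) \<Rightarrow>
   (real ^ 'n \<Rightarrow> real ^ 'm) set \<Rightarrow> (real ^ 'n \<Rightarrow> real ^ 'm) set \<Rightarrow> real" where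
  "wLp_dist p W X Y = enn2real (wnorm p W (\<lambda>x. (SOME f. f \<in> X) x - (SOME g. g \<in> Y) x))"

definition wLp_topology ::
  "(real ^ 'n \<Rightarrow> real) \<Rightarrow> (real ^ 'n \<Rightarrow> real ^ 'm ^ 'm) \<Rightarrow> (real ^ 'n \<Rightarrow> real ^ 'm) set topology" where
  "wLp_topology p W = Metric_space.mtopology (wLp p W // wLp_rel p W) (wLp_dist p W)"

text \<open>The closure of the set of classes of members of \<open>F\<close> is compact.\<close>

definition wLp_precompact ::
  "(real ^ 'n \<Rightarrow> real) \<Rightarrow> (real ^ 'n \<Rightarrow> real ^ 'm ^ 'm) \<Rightarrow> (real ^ 'n \<Rightarrow> real ^ 'm) set \<Rightarrow> bool" where
  "wLp_precompact p W F \<longleftrightarrow>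
     compactin (wLp_topology p W) (wLp_topology p W closure_of (F // wLp_rel p W))"

section \<open>Mollifiers\<close>

fun Ck :: "nat \<Rightarrow> (real ^ 'n \<Rightarrow> real) \<Rightarrow> bool" where
  "Ck 0 f \<longleftrightarrow> continuous_on UNIV f"
| "Ck (Suc k) f \<longleftrightarrow>
     (\<forall>x. f differentiable (at x)) \<and> (\<forall>v. Ck k (\<lambda>x. frechet_derivative f (at x) v))"

definition Cc_infinity :: "(real ^ 'n) set \<Rightarrow> (real ^ 'n \<Rightarrow> real) set" where
  "Cc_infinity U = {f. (\<forall>k. Ck k f) \<and> compact (closure {x. f x \<noteq> 0}) \<and> closure {x. f x \<noteq> 0} \<subseteq> U}"

definition dilate :: "(real ^ 'n \<Rightarrow> real) \<Rightarrow> real \<Rightarrow> real ^ 'n \<Rightarrow> real" where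
  "dilate \<phi> r x = \<phi> (x /\<^sub>R r) / r ^ CARD('n)"

definition convolution ::
  "(real ^ 'n \<Rightarrow> real ^ 'm) \<Rightarrow> (real ^ 'n \<Rightarrow> real) \<Rightarrow> real ^ 'n \<Rightarrow> real ^ 'm" where
  "convolution f g x = (\<chi> i. LINT y|lebesgue. f (x - y) $ i * g y)"

end

theory Submission
  imports Defs "HOL-Complex_Analysis.Great_Picard"
begin

text \<open>
  Sufficiency: by (ii) and (iii), every \<open>f\<close> in the family is uniformly close to the truncation of
  \<open>f * \<phi>\<^sub>r\<close> to a ball.  The matrix condition makes \<open>|W|\<close> locally \<open>L\<^sup>p\<close> and \<open>|W\<^sup>-\<^sup>1|\<close> locally
  \<open>L\<^sup>p\<^sup>'\<close>, so by Hoelder's inequality these mollified functions are bounded and equicontinuous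
  on the ball; Arzela-Ascoli and completeness of the space conclude.

  Necessity: (i) and (iii) follow from a finite net.  For (ii) one also needs that
  \<open>f \<mapsto> f * \<phi>\<^sub>r\<close> is bounded uniformly in small \<open>r\<close>.  Divide \<open>R\<^sup>n\<close> into cells \<open>Q\<close> of side \<open>r\<close>.
  On \<open>Q\<close>, Hoelder's inequality bounds \<open>|W (f * \<phi>\<^sub>r)|\<close> by the norm of \<open>W f\<close> on the tripled cell times
  a function whose norm is controlled by the matrix condition.  It remains to sum over the cells:
  if \<open>u\<close> is dominated in norm by \<open>v\<close> cell by cell, then it is so globally, up to a constant.  With
  constant exponent this is finite overlap; in general, log-Hoelder continuity at scale \<open>r\<close> and at
  infinity lets one exchange \<open>t powr p x\<close> and \<open>t powr p y\<close> for \<open>x\<close> and \<open>y\<close> near the same cell as long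
  as \<open>t\<close> is not below the mass of an integrable polynomial weight on the cell, and the remaining
  cells contribute at most the total mass of that weight.
\<close>

text \<open>Translations need not be bounded on these spaces, so f * phi_r cannot be estimated as an
  average of translates of f. The matrix condition speaks of one cube at a time, and this dictates
  the cells: the kernel has height phi(0)/r^n, which cancels against the volume (3r)^n of a tripled
  cell, so the estimate per cell has no r left in it. What is then missing is additivity: with
  variable exponent only the modular, not a power of the norm, is a sum over disjoint pieces.
  Comparing norm and modular on a cell requires |p x - p y| |log t| to stay bounded. The local
  log-Hoelder condition pays for log(1/r) and the condition at infinity for log(e + |x|); hence t
  must be bounded below by powers of r and of 1/(e + |x|). A weight of polynomial decay has cell
  masses of this kind while its total mass stays finite. Since p is continuous, its essential bounds
  hold at every point. Estimates are made on representatives with norms in \<open>ennreal\<close>;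
  the quotient matters only where compactness becomes total boundedness.\<close>

abbreviation (input) "leb_borel \<equiv> borel_measurable lebesgue"

section \<open>The Luxemburg norm\<close>

lemma epowr_ennreal: "0 \<le> a \<Longrightarrow> epowr (ennreal a) q = ennreal (a powr q)"
  by (simp add: epowr_def)

lemma epowr_0 [simp]: "epowr 0 q = 0"
  by (simp add: epowr_def)

lemma epowr_top [simp]: "epowr top q = top"
  by (simp add: epowr_def)

lemma epowr_mono: "a \<le> b \<Longrightarrow> 0 \<le> q \<Longrightarrow> epowr a q \<le> epowr b q"
  by (cases a; cases b) (auto simp: epowr_ennreal top_unique intro!: ennreal_leI powr_mono2)

lemma epowr_cmult:
  assumes "0 \<le> c" "0 < q"
  shows "epowr (ennreal c * a) q = ennreal (c powr q) * epowr a q"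
proof (cases "c = 0")
  case False
  then have "0 < c" using assms by simp
  then show ?thesis using assms
    by (cases a) (auto simp: epowr_ennreal powr_mult ennreal_mult_top simp flip: ennreal_mult)
qed simp

text \<open>Convexity of the power is the source of the triangle inequality for the Luxemburg
  norm.\<close>

lemma epowr_convex:
  assumes "0 < u" "0 < v" "u + v = 1" "1 \<le> q"
  shows "epowr (ennreal u * a + ennreal v * b) q \<le> ennreal u * epowr a q + ennreal v * epowr b q"
proof -
  have real_case: "(u * x + v * y) powr q \<le> u * x powr q + v * y powr q"
    if "0 \<le> x" "0 \<le> y" for x y :: real
  proof (cases "x = 0 \<or> y = 0")
    case True
    \<comment> \<open>With a zero argument one term vanishes, and what remains is that a number in
      (0, 1] does not grow under a power of exponent at least 1.\<close>
    have *: "w powr q \<le> w" if "0 < w" "w \<le> 1" for w :: real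
      using powr_mono'[of 1 q w] assms that by simp
    have "(u * x) powr q \<le> u * x powr q" "(v * y) powr q \<le> v * y powr q"
      using that assms *[of u] *[of v] by (auto simp: powr_mult intro!: mult_right_mono)
    then show ?thesis using True by auto
  next
    case False
    have u: "u = 1 - v" using assms by simp
    show ?thesis
      unfolding u using False convex_onD[OF powr_convex[OF assms(4)], of v x y] assms that by auto
  qed
  show ?thesis
    using assms
    by (cases a; cases b)
      (auto simp: epowr_ennreal ennreal_mult_top simp flip: ennreal_mult ennreal_plus
            intro!: ennreal_leI real_case)
qed

lemma ennreal_divide_real: "0 < t \<Longrightarrow> a / ennreal t = ennreal (1 / t) * a"
  by (simp add: divide_ennreal_def inverse_ennreal mult.commute inverse_eq_divide)

lemma borel_measurable_epowr [measurable]: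
  assumes [measurable]: "f \<in> borel_measurable M" "q \<in> borel_measurable M"
  shows "(\<lambda>x. epowr (f x) (q x)) \<in> borel_measurable M"
  unfolding epowr_def by measurable

lemma tendsto_0_if_eventually_le_ennreal:
  fixes f :: "'a \<Rightarrow> ennreal"
  assumes "\<And>e. 0 < e \<Longrightarrow> eventually (\<lambda>x. f x \<le> ennreal e) F"
  shows "(f \<longlongrightarrow> 0) F"
proof (rule order_tendstoI)
  fix a :: ennreal assume "0 < a"
  then obtain b where b: "0 < b" "b < a" using dense by blast
  then obtain e where e: "b = ennreal e" "0 < e" by (cases b) auto
  show "eventually (\<lambda>x. f x < a) F"
    using assms[OF e(2)] by eventually_elim (use b e in \<open>auto intro: le_less_trans\<close>)
qed simp

definition modular :: "(real ^ 'n \<Rightarrow> real) \<Rightarrow> (real ^ 'n \<Rightarrow> ennreal) \<Rightarrow> ennreal" where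
  "modular q f = (\<integral>\<^sup>+x. epowr (f x) (q x) \<partial>lebesgue)"

lemma lux_norm_modular:
  "lux_norm q f = Inf {ennreal t | t. 0 < t \<and> modular q (\<lambda>x. f x / ennreal t) \<le> 1}"
  by (simp add: lux_norm_def modular_def)

lemma lux_norm_le:
  "0 < t \<Longrightarrow> modular q (\<lambda>x. f x / ennreal t) \<le> 1 \<Longrightarrow> lux_norm q f \<le> ennreal t"
  unfolding lux_norm_modular by (intro Inf_lower) auto

text \<open>The bounds are required at every point; for a log-Hoelder exponent this is no loss,
  since it is continuous. Both p and its conjugate are instances.\<close>

locale exponent_function =
  fixes q :: "real ^ 'n \<Rightarrow> real" and b :: real
  assumes q_measurable [measurable]: "q \<in> leb_borel"
    and one_le_q: "\<And>x. 1 \<le> q x" and q_le: "\<And>x. q x \<le> b"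
begin

lemma q_pos: "0 < q x"
  using one_le_q[of x] by linarith

lemma modular_mono_AE:
  "AE x in lebesgue. f x \<le> g x \<Longrightarrow> modular q f \<le> modular q g"
  unfolding modular_def
  by (rule nn_integral_mono_AE) (auto elim!: eventually_mono intro!: epowr_mono less_imp_le[OF q_pos])

lemma modular_mono: "(\<And>x. f x \<le> g x) \<Longrightarrow> modular q f \<le> modular q g"
  by (simp add: modular_mono_AE)

text \<open>The modular of f/t decreases in t, so every t strictly above the infimum is admissible.
  Keeping the inequality strict avoids any question of attainment.\<close>

lemma modular_le_1_if_lux_norm_less:
  assumes "lux_norm q f < ennreal t"
  shows "modular q (\<lambda>x. f x / ennreal t) \<le> 1"
proof -
  obtain s where s: "0 < s" "modular q (\<lambda>x. f x / ennreal s) \<le> 1" "ennreal s < ennreal t"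
    using assms unfolding lux_norm_modular Inf_less_iff by auto
  then have "s < t" by (simp add: ennreal_less_iff)
  then have "modular q (\<lambda>x. f x / ennreal t) \<le> modular q (\<lambda>x. f x / ennreal s)"
    using s by (intro modular_mono) (auto simp: ennreal_divide_real intro!: mult_right_mono ennreal_leI divide_left_mono)
  then show ?thesis using s by simp
qed

lemma modular_gt_1:
  assumes "ennreal t < lux_norm q f" "0 < t"
  shows "1 < modular q (\<lambda>x. f x / ennreal t)"
  using assms lux_norm_le[of t q f] by (meson not_le)

text \<open>The form with all t above a also covers a = 0, and again needs no attainment.\<close>

lemma lux_norm_le_iff:
  assumes "0 \<le> a"
  shows "lux_norm q f \<le> ennreal a \<longleftrightarrow> (\<forall>t>a. modular q (\<lambda>x. f x / ennreal t) \<le> 1)"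
proof
  assume "lux_norm q f \<le> ennreal a"
  then show "\<forall>t>a. modular q (\<lambda>x. f x / ennreal t) \<le> 1"
    using assms by (auto intro!: modular_le_1_if_lux_norm_less elim!: le_less_trans simp: ennreal_less_iff)
next
  assume *: "\<forall>t>a. modular q (\<lambda>x. f x / ennreal t) \<le> 1"
  show "lux_norm q f \<le> ennreal a"
  proof (rule ennreal_le_epsilon)
    fix e :: real assume "0 < e"
    then show "lux_norm q f \<le> ennreal a + ennreal e"
      using * assms lux_norm_le[of "a + e" q f] by (simp flip: ennreal_plus)
  qed
qed

lemma lux_norm_mono_AE:
  assumes "AE x in lebesgue. f x \<le> g x"
  shows "lux_norm q f \<le> lux_norm q g"
  unfolding lux_norm_modular
proof (rule Inf_superset_mono, safe)
  fix t :: real assume t: "0 < t" "modular q (\<lambda>x. g x / ennreal t) \<le> 1"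
  have "AE x in lebesgue. f x / ennreal t \<le> g x / ennreal t"
    using assms by eventually_elim (rule divide_right_mono_ennreal)
  then have "modular q (\<lambda>x. f x / ennreal t) \<le> 1"
    using t(2) by (rule order_trans[OF modular_mono_AE])
  with t show "\<exists>s. ennreal t = ennreal s \<and> 0 < s \<and> modular q (\<lambda>x. f x / ennreal s) \<le> 1"
    by blast
qed

lemma lux_norm_mono: "(\<And>x. f x \<le> g x) \<Longrightarrow> lux_norm q f \<le> lux_norm q g"
  by (simp add: lux_norm_mono_AE)

lemma lux_norm_cong_AE:
  assumes "AE x in lebesgue. f x = g x" shows "lux_norm q f = lux_norm q g"
proof (rule antisym; rule lux_norm_mono_AE)
  show "AE x in lebesgue. f x \<le> g x" "AE x in lebesgue. g x \<le> f x"
    using assms by auto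
qed

lemma lux_norm_0 [simp]: "lux_norm q (\<lambda>x. 0) = 0"
proof -
  have "lux_norm q (\<lambda>x. 0) \<le> ennreal 0"
    by (subst lux_norm_le_iff) (auto simp: modular_def)
  then show ?thesis by simp
qed

lemma lux_norm_cmult_le:
  assumes "0 < c" shows "lux_norm q (\<lambda>x. ennreal c * f x) \<le> ennreal c * lux_norm q f"
proof (cases "lux_norm q f")
  case (real a)
  have "lux_norm q (\<lambda>x. ennreal c * f x) \<le> ennreal (c * a)"
  proof (subst lux_norm_le_iff, use real assms in simp, intro allI impI)
    fix t assume t: "c * a < t"
    then have pos: "0 < t" "0 < t / c" "a < t / c"
      using assms real by (auto simp: field_simps mult_nonneg_nonneg le_less_trans[of 0 "c*a"])
    then have "modular q (\<lambda>x. f x / ennreal (t / c)) \<le> 1"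
      using real by (intro modular_le_1_if_lux_norm_less) (auto simp: ennreal_less_iff)
    also have "(\<lambda>x. f x / ennreal (t / c)) = (\<lambda>x. ennreal c * f x / ennreal t)"
      using pos assms by (auto simp: ennreal_divide_real mult.assoc[symmetric] simp flip: ennreal_mult)
    finally show "modular q (\<lambda>x. ennreal c * f x / ennreal t) \<le> 1" .
  qed
  then show ?thesis using real assms by (simp add: ennreal_mult)
qed (use assms in \<open>auto simp: ennreal_mult_top\<close>)

lemma lux_norm_cmult:
  assumes "0 < c" shows "lux_norm q (\<lambda>x. ennreal c * f x) = ennreal c * lux_norm q f"
proof (rule antisym)
  show "lux_norm q (\<lambda>x. ennreal c * f x) \<le> ennreal c * lux_norm q f"
    using assms by (rule lux_norm_cmult_le)
  have "lux_norm q f = lux_norm q (\<lambda>x. ennreal (1 / c) * (ennreal c * f x))"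
    using assms by (simp add: mult.assoc[symmetric] flip: ennreal_mult)
  also have "\<dots> \<le> ennreal (1 / c) * lux_norm q (\<lambda>x. ennreal c * f x)"
    using assms by (intro lux_norm_cmult_le) simp
  finally have "ennreal c * lux_norm q f \<le> ennreal c * (ennreal (1 / c) * lux_norm q (\<lambda>x. ennreal c * f x))"
    by (rule mult_left_mono) simp
  then show "ennreal c * lux_norm q f \<le> lux_norm q (\<lambda>x. ennreal c * f x)"
    using assms by (simp add: mult.assoc[symmetric] flip: ennreal_mult)
qed

text \<open>For s1 and s2 slightly above the two norms, (f + g)/(s1 + s2) is a convex combination of
  f/s1 and g/s2, and the modular is convex.\<close>

lemma lux_norm_triangle:
  assumes [measurable]: "f \<in> leb_borel" "g \<in> leb_borel"
  shows "lux_norm q (\<lambda>x. f x + g x) \<le> lux_norm q f + lux_norm q g"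
proof (cases "lux_norm q f"; cases "lux_norm q g")
  fix a b assume a: "0 \<le> a" "lux_norm q f = ennreal a" and b: "0 \<le> b" "lux_norm q g = ennreal b"
  have "lux_norm q (\<lambda>x. f x + g x) \<le> ennreal (a + b)"
  proof (subst lux_norm_le_iff, use a b in simp, intro allI impI)
    fix t assume "a + b < t"
    \<comment> \<open>The slack between t and a + b is split evenly, so that both norms are exceeded
      strictly.\<close>
    define d where "d = (t - a - b) / 2"
    define s1 s2 where "s1 = a + d" and "s2 = b + d"
    have s: "a < s1" "b < s2" "0 < s1" "0 < s2" "t = s1 + s2" "0 < t"
      using a(1) b(1) \<open>a + b < t\<close> by (auto simp: s1_def s2_def d_def field_simps)
    have "modular q (\<lambda>x. (f x + g x) / ennreal t) \<le>
      (\<integral>\<^sup>+x. ennreal (s1 / t) * epowr (f x / ennreal s1) (q x)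
          + ennreal (s2 / t) * epowr (g x / ennreal s2) (q x) \<partial>lebesgue)"
      unfolding modular_def
    proof (rule nn_integral_mono)
      fix x
      have "(f x + g x) / ennreal t = ennreal (s1 / t) * (f x / ennreal s1) + ennreal (s2 / t) * (g x / ennreal s2)"
        using s(3,4,6) by (simp add: ennreal_divide_real mult.assoc[symmetric] distrib_left flip: ennreal_mult)
      then show "epowr ((f x + g x) / ennreal t) (q x) \<le> ennreal (s1 / t) * epowr (f x / ennreal s1) (q x)
          + ennreal (s2 / t) * epowr (g x / ennreal s2) (q x)"
        using s one_le_q by (auto intro!: epowr_convex simp: add_divide_distrib[symmetric])
    qed
    also have "\<dots> = ennreal (s1 / t) * modular q (\<lambda>x. f x / ennreal s1) + ennreal (s2 / t) * modular q (\<lambda>x. g x / ennreal s2)"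
      unfolding modular_def by (simp add: nn_integral_add nn_integral_cmult)
    also have "\<dots> \<le> ennreal (s1 / t) * 1 + ennreal (s2 / t) * 1"
      using a b s by (intro add_mono mult_left_mono modular_le_1_if_lux_norm_less) (auto simp: ennreal_less_iff)
    also have "\<dots> = 1"
      using s by (simp flip: ennreal_plus add: add_divide_distrib[symmetric])
    finally show "modular q (\<lambda>x. (f x + g x) / ennreal t) \<le> 1" .
  qed
  then show ?thesis using a b by simp
qed auto

text \<open>As the exponent is at least 1, dividing by L gains at least a factor L. A modular bound
  L therefore costs no more than a factor L in norm.\<close>

lemma modular_divide_le:
  assumes "1 \<le> L" "f \<in> leb_borel"
  shows "modular q (\<lambda>x. f x / ennreal L) \<le> modular q f / ennreal L"
proof -
  have [measurable]: "f \<in> leb_borel" by fact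
  have "modular q (\<lambda>x. f x / ennreal L) \<le> (\<integral>\<^sup>+x. ennreal (1 / L) * epowr (f x) (q x) \<partial>lebesgue)"
    unfolding modular_def
  proof (rule nn_integral_mono)
    fix x
    have "(1 / L) powr (q x) \<le> 1 / L"
      using powr_mono'[of 1 "q x" "1 / L"] assms one_le_q by simp
    then show "epowr (f x / ennreal L) (q x) \<le> ennreal (1 / L) * epowr (f x) (q x)"
      using assms q_pos[of x]
      by (auto simp: ennreal_divide_real epowr_cmult intro!: mult_right_mono ennreal_leI)
  qed
  also have "\<dots> = modular q f / ennreal L"
    using assms unfolding modular_def by (simp add: ennreal_divide_real nn_integral_cmult)
  finally show ?thesis .
qed

lemma lux_norm_le_if_modular_le:
  assumes "modular q (\<lambda>x. f x / ennreal c) \<le> ennreal L" "1 \<le> L" "0 < c"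
    and [measurable]: "f \<in> leb_borel"
  shows "lux_norm q f \<le> ennreal (c * L)"
proof (rule lux_norm_le)
  have "ennreal (1 / (c * L)) = ennreal (1 / L) * ennreal (1 / c)"
    using assms by (simp add: mult.commute flip: ennreal_mult)
  then have "(\<lambda>x. f x / ennreal (c * L)) = (\<lambda>x. f x / ennreal c / ennreal L)"
    using assms by (simp add: ennreal_divide_real mult.assoc)
  then have "modular q (\<lambda>x. f x / ennreal (c * L)) \<le> modular q (\<lambda>x. f x / ennreal c) / ennreal L"
    using modular_divide_le[of L "\<lambda>x. f x / ennreal c"] assms by simp
  also have "\<dots> \<le> ennreal L / ennreal L"
    using assms by (intro divide_right_mono_ennreal)
  also have "\<dots> = 1" using assms by (simp add: divide_ennreal)
  finally show "modular q (\<lambda>x. f x / ennreal (c * L)) \<le> 1" .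
qed (use assms in auto)

text \<open>A vanishing norm bounds the modular of f/(cs) by 1 for every s > 0. Where f is at least
  c, the integrand is at least 1/s once s is at most 1, so this set has measure at most s, hence
  zero.\<close>

lemma AE_0_if_lux_norm_0:
  assumes "lux_norm q f = 0" and [measurable]: "f \<in> leb_borel"
  shows "AE x in lebesgue. f x = 0"
proof -
  have "AE x in lebesgue. \<not> ennreal c \<le> f x" if c: "0 < c" for c
  proof -
    let ?S = "{x. ennreal (c) \<le> f x}"
    have "{x \<in> space lebesgue. ennreal (c) \<le> f x} \<in> sets lebesgue" by measurable
    then have [measurable]: "?S \<in> sets lebesgue" by simp
    have "emeasure lebesgue ?S \<le> ennreal s" if "0 < s" "s \<le> 1" for s
    proof -
      have "ennreal (1 / s) * indicator ?S x \<le> epowr (f x / ennreal (c * s)) (q x)" for x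
      proof (cases "x \<in> ?S")
        case True
        have "ennreal (1 / s) \<le> ennreal ((1 / s) powr q x)"
          using powr_mono[of 1 "q x" "1 / s"] that one_le_q[of x] by (intro ennreal_leI) simp
        also have "\<dots> = epowr (ennreal c / ennreal (c * s)) (q x)"
          using that c by (simp add: divide_ennreal epowr_ennreal)
        also have "\<dots> \<le> epowr (f x / ennreal (c * s)) (q x)"
          using True q_pos[of x] by (intro epowr_mono divide_right_mono_ennreal) auto
        finally show ?thesis using True by simp
      qed simp
      then have "(\<integral>\<^sup>+x. ennreal (1 / s) * indicator ?S x \<partial>lebesgue) \<le> modular q (\<lambda>x. f x / ennreal (c * s))"
        unfolding modular_def by (intro nn_integral_mono)
      also have "\<dots> \<le> 1"
        using that c assms by (intro modular_le_1_if_lux_norm_less) simp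
      finally have "ennreal (1 / s) * emeasure lebesgue ?S \<le> 1"
        by (simp add: nn_integral_cmult_indicator)
      then have "ennreal s * (ennreal (1 / s) * emeasure lebesgue ?S) \<le> ennreal s * 1"
        by (intro mult_left_mono) auto
      then show ?thesis
        using that by (simp add: mult.assoc[symmetric] flip: ennreal_mult)
    qed
    then have *: "emeasure lebesgue ?S \<le> ennreal (min s 1)" if "0 < s" for s
      using that by auto
    have "emeasure lebesgue ?S \<le> 0"
    proof (rule ennreal_le_epsilon)
      fix e :: real assume "0 < e"
      then have "emeasure lebesgue ?S \<le> ennreal (min e 1)" by (rule *)
      also have "\<dots> \<le> ennreal e" by (intro ennreal_leI) simp
      finally show "emeasure lebesgue ?S \<le> 0 + ennreal e" by simp
    qed
    then have "emeasure lebesgue ?S = 0" by (simp only: le_zero_eq)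
    then have "?S \<in> null_sets lebesgue"
      by (intro null_setsI) measurable
    from AE_not_in[OF this] show ?thesis by simp
  qed
  then have "AE x in lebesgue. \<forall>n. \<not> ennreal (1 / Suc n) \<le> f x"
    by (simp add: AE_all_countable del: of_nat_Suc)
  then show ?thesis
  proof eventually_elim
    case (elim x)
    show "f x = 0"
    proof (rule ccontr)
      assume "f x \<noteq> 0"
      then have "0 < f x" by (simp add: zero_less_iff_neq_zero)
      then obtain w where w: "0 < w" "w < f x" using dense by blast
      then obtain r where r: "0 < r" "ennreal r < f x" by (cases w) auto
      obtain n where "inverse (real (Suc n)) < r" using reals_Archimedean[OF r(1)] by auto
      then have "ennreal (1 / Suc n) \<le> ennreal r" by (intro ennreal_leI) (simp add: field_simps)
      with r elim show False by (meson less_imp_le order_trans)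
    qed
  qed
qed

text \<open>This is where the upper bound of the exponent enters: undoing a normalization by t costs
  at most t^b, for t at least 1.\<close>

lemma modular_finite_if_lux_norm_finite:
  assumes "lux_norm q f < \<infinity>" and [measurable]: "f \<in> leb_borel"
  shows "modular q f < \<infinity>"
proof -
  obtain a where a: "0 \<le> a" "lux_norm q f = ennreal a"
    using assms by (cases "lux_norm q f") auto
  define t where "t = a + 1"
  have t: "1 \<le> t" "a < t" using a by (auto simp: t_def)
  have m: "modular q (\<lambda>x. f x / ennreal t) \<le> 1"
    using a t by (intro modular_le_1_if_lux_norm_less) (simp add: ennreal_less_iff)
  have "modular q f \<le> (\<integral>\<^sup>+x. ennreal (t powr b) * epowr (f x / ennreal t) (q x) \<partial>lebesgue)"
    unfolding modular_def
  proof (rule nn_integral_mono)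
    fix x
    have "epowr (f x) (q x) = epowr (ennreal t * (f x / ennreal t)) (q x)"
      using t by (simp add: ennreal_divide_real mult.assoc[symmetric] flip: ennreal_mult)
    also have "\<dots> = ennreal (t powr q x) * epowr (f x / ennreal t) (q x)"
      using t q_pos by (intro epowr_cmult) auto
    also have "\<dots> \<le> ennreal (t powr b) * epowr (f x / ennreal t) (q x)"
      using t q_le by (intro mult_right_mono ennreal_leI powr_mono) auto
    finally show "epowr (f x) (q x) \<le> ennreal (t powr b) * epowr (f x / ennreal t) (q x)" .
  qed
  also have "\<dots> = ennreal (t powr b) * modular q (\<lambda>x. f x / ennreal t)"
    unfolding modular_def by (simp add: nn_integral_cmult)
  also have "\<dots> \<le> ennreal (t powr b) * 1"
    using m by (intro mult_left_mono) auto
  finally show ?thesis by (auto intro: le_less_trans)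
qed

text \<open>Dominated convergence is applied to the modulars of u_i/e for each fixed e. Their
  majorant is integrable for every e because the exponent is bounded, and a modular below 1 bounds
  the norm by e.\<close>

lemma lux_norm_dominated:
  fixes u :: "nat \<Rightarrow> real ^ 'n \<Rightarrow> real"
  assumes [measurable]: "\<And>i. u i \<in> leb_borel" "g \<in> leb_borel"
    and nonneg: "\<And>i x. 0 \<le> u i x"
    and bound: "\<And>i. AE x in lebesgue. ennreal (u i x) \<le> g x"
    and fin: "lux_norm q g < \<infinity>"
    and lim: "AE x in lebesgue. (\<lambda>i. u i x) \<longlonglongrightarrow> 0"
  shows "(\<lambda>i. lux_norm q (\<lambda>x. ennreal (u i x))) \<longlonglongrightarrow> 0"
proof (rule tendsto_0_if_eventually_le_ennreal)
  fix e :: real assume e: "0 < e"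
  have "(\<lambda>i. \<integral>\<^sup>+x. epowr (ennreal (u i x) / ennreal e) (q x) \<partial>lebesgue) \<longlonglongrightarrow> (\<integral>\<^sup>+x. 0 \<partial>(lebesgue :: (real ^ 'n) measure))"
  proof (rule nn_integral_dominated_convergence)
    show "AE x in lebesgue. epowr (ennreal (u i x) / ennreal e) (q x) \<le> epowr (g x / ennreal e) (q x)" for i
      using bound[of i] by eventually_elim (auto intro!: epowr_mono divide_right_mono_ennreal less_imp_le[OF q_pos])
    have "(\<lambda>x. g x / ennreal e) = (\<lambda>x. ennreal (1 / e) * g x)"
      using e by (simp add: ennreal_divide_real)
    then have "lux_norm q (\<lambda>x. g x / ennreal e) = ennreal (1 / e) * lux_norm q g"
      using e by (simp add: lux_norm_cmult)
    then have "lux_norm q (\<lambda>x. g x / ennreal e) < \<infinity>"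
      using fin by (simp add: ennreal_mult_less_top)
    then show "(\<integral>\<^sup>+x. epowr (g x / ennreal e) (q x) \<partial>lebesgue) < \<infinity>"
      using modular_finite_if_lux_norm_finite[of "\<lambda>x. g x / ennreal e"] by (simp add: modular_def)
    show "AE x in lebesgue. (\<lambda>i. epowr (ennreal (u i x) / ennreal e) (q x)) \<longlonglongrightarrow> 0"
      using lim
    proof eventually_elim
      case (elim x)
      have "(\<lambda>i. u i x / e) \<longlonglongrightarrow> 0 / e" using elim e by (intro tendsto_divide) auto
      then have "(\<lambda>i. (u i x / e) powr q x) \<longlonglongrightarrow> 0 powr q x"
        using q_pos[of x] nonneg e by (intro tendsto_powr') (auto intro!: always_eventually)
      then have "(\<lambda>i. ennreal ((u i x / e) powr q x)) \<longlonglongrightarrow> ennreal 0"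
        using q_pos[of x] by (intro tendsto_ennrealI) simp
      then show ?case using e nonneg by (simp add: divide_ennreal epowr_ennreal)
    qed
  qed auto
  then have "eventually (\<lambda>i. modular q (\<lambda>x. ennreal (u i x) / ennreal e) < 1) sequentially"
    unfolding modular_def by (intro order_tendstoD(2)) auto
  then show "eventually (\<lambda>i. lux_norm q (\<lambda>x. ennreal (u i x)) \<le> ennreal e) sequentially"
    by eventually_elim (intro lux_norm_le e less_imp_le)
qed

end

section \<open>Hoelder's inequality for variable exponents\<close>

text \<open>Young's inequality for f/s and g/t, with the factors 1/p and 1/q simply dropped. Each of
  the two modulars is then at most 1, which gives the constant 2.\<close>

lemma nn_integral_mult_le_lux_norm_real:
  assumes p: "exponent_function p b" and q: "exponent_function q c"
    and conj: "\<And>x. 1 < p x" "\<And>x. 1 / p x + 1 / q x = 1"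
    and [measurable]: "f \<in> leb_borel" "g \<in> leb_borel"
    and f: "lux_norm p f < ennreal s" "0 < s" and g: "lux_norm q g < ennreal t" "0 < t"
  shows "(\<integral>\<^sup>+x. f x * g x \<partial>lebesgue) \<le> 2 * ennreal s * ennreal t"
proof -
  interpret p: exponent_function p b by (rule p)
  interpret q: exponent_function q c by (rule q)
  have qgt: "1 < q x" for x
    using conj(1)[of x] conj(2)[of x] q.one_le_q[of x] by (cases "q x = 1") auto
  have young: "ennreal a * ennreal b' \<le> epowr (ennreal a) (p x) + epowr (ennreal b') (q x)"
    if "0 \<le> a" "0 \<le> b'" for a b' x
  proof -
    have "a * b' \<le> a powr p x / p x + b' powr q x / q x"
      using that conj[of x] qgt[of x] by (intro Youngs_inequality) auto
    also have "\<dots> \<le> a powr p x / 1 + b' powr q x / 1"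
      using conj(1)[of x] qgt[of x] by (intro add_mono divide_left_mono) auto
    finally show ?thesis
      using that by (simp add: epowr_ennreal flip: ennreal_mult ennreal_plus)
  qed
  have young': "a * b' \<le> epowr a (p x) + epowr b' (q x)" for a b' x
    using young[of _ _ x] by (cases a; cases b') auto
  have "(\<integral>\<^sup>+x. f x * g x \<partial>lebesgue) = (\<integral>\<^sup>+x. ennreal (s * t) * ((f x / ennreal s) * (g x / ennreal t)) \<partial>lebesgue)"
  proof (rule nn_integral_cong)
    fix x
    have "ennreal (s * t) * ((f x / ennreal s) * (g x / ennreal t)) 
      = (ennreal s * ennreal (1/s)) * (ennreal t * ennreal (1/t)) * (f x * g x)"
      using f g by (simp add: ennreal_divide_real ennreal_mult mult_ac)
    also have "\<dots> = f x * g x" using f g by (simp flip: ennreal_mult)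
    finally show "f x * g x = ennreal (s * t) * ((f x / ennreal s) * (g x / ennreal t))" by simp
  qed
  also have "\<dots> = ennreal (s * t) * (\<integral>\<^sup>+x. (f x / ennreal s) * (g x / ennreal t) \<partial>lebesgue)"
    by (simp add: nn_integral_cmult)
  also have "(\<integral>\<^sup>+x. (f x / ennreal s) * (g x / ennreal t) \<partial>lebesgue)
    \<le> (\<integral>\<^sup>+x. epowr (f x / ennreal s) (p x) + epowr (g x / ennreal t) (q x) \<partial>lebesgue)"
    by (intro nn_integral_mono young')
  also have "\<dots> = modular p (\<lambda>x. f x / ennreal s) + modular q (\<lambda>x. g x / ennreal t)"
    by (simp add: modular_def nn_integral_add)
  also have "\<dots> \<le> 1 + 1"
    using f g by (intro add_mono p.modular_le_1_if_lux_norm_less q.modular_le_1_if_lux_norm_less)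
  finally have "(\<integral>\<^sup>+x. f x * g x \<partial>lebesgue) \<le> ennreal (s * t) * (1 + 1)"
    by (simp add: mult_left_mono)
  then show ?thesis using f g by (simp add: ennreal_mult mult_ac)
qed

lemma nn_integral_mult_le_lux_norm:
  assumes p: "exponent_function p b" and q: "exponent_function q c"
    and conj: "\<And>x. 1 < p x" "\<And>x. 1 / p x + 1 / q x = 1"
    and [measurable]: "f \<in> leb_borel" "g \<in> leb_borel"
  shows "(\<integral>\<^sup>+x. f x * g x \<partial>lebesgue) \<le> 2 * lux_norm p f * lux_norm q g"
proof -
  interpret p: exponent_function p b by (rule p)
  interpret q: exponent_function q c by (rule q)
  \<comment> \<open>If one norm is zero, the product vanishes almost everywhere even when the other
    norm is infinite, in agreement with 0 times infinity being 0 in \<open>ennreal\<close>.\<close>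
  consider "lux_norm p f = 0 \<or> lux_norm q g = 0" | "lux_norm p f = top" "lux_norm q g \<noteq> 0"
    | "lux_norm q g = top" "lux_norm p f \<noteq> 0"
    | "lux_norm p f < top" "lux_norm q g < top" "lux_norm p f \<noteq> 0" "lux_norm q g \<noteq> 0"
    unfolding less_top[symmetric] by blast
  then show ?thesis
  proof cases
    case 1
    then have "AE x in lebesgue. f x * g x = 0"
      using p.AE_0_if_lux_norm_0[of f] q.AE_0_if_lux_norm_0[of g] by auto
    then have "(\<integral>\<^sup>+x. f x * g x \<partial>lebesgue) = 0"
      by (subst nn_integral_0_iff_AE) auto
    then show ?thesis by simp
  next
    case 4
    then obtain u v where uv: "lux_norm p f = ennreal u" "lux_norm q g = ennreal v" "0 < u" "0 < v"
      by (cases "lux_norm p f"; cases "lux_norm q g") (auto simp: less_le)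
    \<comment> \<open>Both norms are inflated by the same factor l > 1 to make the inequalities
      strict; then l decreases to 1.\<close>
    have "(\<integral>\<^sup>+x. f x * g x \<partial>lebesgue) \<le> ennreal (2 * (u * l) * (v * l))" if "1 < l" for l
    proof -
      have "ennreal u < ennreal (u * l)" "ennreal v < ennreal (v * l)"
        using uv that by (auto simp: ennreal_less_iff)
      then have "(\<integral>\<^sup>+x. f x * g x \<partial>lebesgue) \<le> 2 * ennreal (u * l) * ennreal (v * l)"
        using uv that by (intro nn_integral_mult_le_lux_norm_real[OF p q conj assms(5,6)]) auto
      then show ?thesis using uv that by (simp add: ennreal_mult)
    qed
    moreover have "((\<lambda>l. ennreal (2 * (u * l) * (v * l))) \<longlongrightarrow> ennreal (2 * (u * 1) * (v * 1))) (at_right 1)"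
      by (intro tendsto_ennrealI tendsto_intros)
    ultimately have "(\<integral>\<^sup>+x. f x * g x \<partial>lebesgue) \<le> ennreal (2 * (u * 1) * (v * 1))"
      by (intro tendsto_lowerbound) (auto simp: eventually_at_right_less eventually_at_filter)
    then show ?thesis using uv by (simp add: ennreal_mult mult_ac)
  qed (auto simp: ennreal_mult_top ennreal_top_mult mult.assoc)
qed

section \<open>Measurability of matrix-valued functions\<close>

lemma borel_measurable_vec_nth [measurable (raw)]:
  fixes f :: "'a \<Rightarrow> 'b::euclidean_space ^ 'n"
  assumes "f \<in> borel_measurable M"
  shows "(\<lambda>x. f x $ i) \<in> borel_measurable M"
  using borel_measurable_continuous_on[OF _ assms, of "\<lambda>v. v $ i"]
  by (simp add: continuous_on_component)

lemma borel_measurable_vecI: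
  fixes f :: "'a \<Rightarrow> 'b::euclidean_space ^ 'n"
  assumes "\<And>i. (\<lambda>x. f x $ i) \<in> borel_measurable M"
  shows "f \<in> borel_measurable M"
proof (rule iffD2[OF borel_measurable_euclidean_space], rule ballI)
  fix e :: "'b ^ 'n" assume "e \<in> Basis"
  then obtain j u where e: "e = axis j u" unfolding Basis_vec_def by blast
  show "(\<lambda>x. f x \<bullet> e) \<in> borel_measurable M"
    unfolding e inner_axis by (rule borel_measurable_inner[OF assms borel_measurable_const])
qed

lemma borel_measurable_vec_lambda [measurable (raw)]:
  fixes f :: "'n::finite \<Rightarrow> 'a \<Rightarrow> 'b::euclidean_space"
  assumes "\<And>i. f i \<in> borel_measurable M"
  shows "(\<lambda>x. \<chi> i. f i x) \<in> borel_measurable M"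
  using assms by (intro borel_measurable_vecI) simp

lemma borel_measurable_matrix_vector_mult [measurable (raw)]:
  fixes A :: "'a \<Rightarrow> real ^ 'm ^ 'k"
  assumes [measurable]: "A \<in> borel_measurable M" "f \<in> borel_measurable M"
  shows "(\<lambda>x. A x *v f x) \<in> borel_measurable M"
  unfolding matrix_vector_mult_def by measurable

lemma borel_measurable_matrix_matrix_mult [measurable (raw)]:
  fixes A :: "'a \<Rightarrow> real ^ 'm ^ 'k" and B :: "'a \<Rightarrow> real ^ 'l ^ 'm"
  assumes [measurable]: "A \<in> borel_measurable M" "B \<in> borel_measurable M"
  shows "(\<lambda>x. A x ** B x) \<in> borel_measurable M"
  unfolding matrix_matrix_mult_def by measurable

lemma borel_measurable_det [measurable (raw)]:
  fixes A :: "'a \<Rightarrow> real ^ 'm ^ 'm"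
  assumes [measurable]: "A \<in> borel_measurable M"
  shows "(\<lambda>x. det (A x)) \<in> borel_measurable M"
  unfolding det_def by measurable

text \<open>The operator norm is Lipschitz in the Euclidean matrix norm, the crude constant being
  the number of entries. Continuity is what transfers measurability from a matrix function to its
  operator norm.\<close>

lemma continuous_on_onorm_matrix:
  "continuous_on UNIV (\<lambda>A :: real ^ 'm ^ 'k. onorm ((*v) A))"
proof (rule continuous_onI)
  let ?K = "real CARD('k) * real CARD('m)"
  fix A :: "real ^ 'm ^ 'k" and e :: real assume "0 < e"
  have le: "onorm ((*v) A) \<le> onorm ((*v) B) + ?K * norm (A - B)" for A B :: "real ^ 'm ^ 'k"
  proof -
    have "onorm ((*v) A) = onorm (\<lambda>z. B *v z + (A - B) *v z)"
      by (simp add: matrix_vector_mult_diff_rdistrib)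
    also have "\<dots> \<le> onorm ((*v) B) + onorm ((*v) (A - B))"
      by (intro onorm_triangle) auto
    also have "onorm ((*v) (A - B)) \<le> ?K * norm (A - B)"
    proof (rule onorm_le_matrix_component)
      fix i j
      show "\<bar>(A - B) $ i $ j\<bar> \<le> norm (A - B)"
        using component_le_norm_cart[of "(A - B) $ i" j] Finite_Cartesian_Product.norm_nth_le[of "A - B" i] by linarith
    qed
    finally show ?thesis by simp
  qed
  show "\<exists>d>0. \<forall>B\<in>UNIV. dist B A < d \<longrightarrow> dist (onorm ((*v) B)) (onorm ((*v) A)) \<le> e"
  proof (intro exI conjI ballI impI)
    show "0 < e / ?K" using \<open>0 < e\<close> by simp
    fix B assume "dist B A < e / ?K"
    then have "?K * norm (B - A) < e"
      by (simp add: dist_norm pos_less_divide_eq mult.commute)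
    then show "dist (onorm ((*v) B)) (onorm ((*v) A)) \<le> e"
      using le[of A B] le[of B A] by (simp add: dist_real_def norm_minus_commute)
  qed
qed

lemma borel_measurable_onorm_matrix [measurable (raw)]:
  fixes A :: "'a \<Rightarrow> real ^ 'm ^ 'k"
  assumes "A \<in> borel_measurable M"
  shows "(\<lambda>x. onorm ((*v) (A x))) \<in> borel_measurable M"
  using borel_measurable_continuous_on[OF continuous_on_onorm_matrix assms] .

text \<open>Completeness of Lebesgue measure makes every subset of a null set measurable. This is
  used for the inverse of a weight, for which a formula is available only where the matrix is
  invertible.\<close>

lemma borel_measurable_lebesgue_cong_AE:
  fixes f g :: "'a::euclidean_space \<Rightarrow> 'b::topological_space"
  assumes f: "f \<in> leb_borel" and eq: "AE x in lebesgue. f x = g x"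
  shows "g \<in> leb_borel"
proof (rule measurableI)
  fix A :: "'b set" assume A: "A \<in> sets borel"
  obtain N where N: "N \<in> null_sets lebesgue" "{x. f x \<noteq> g x} \<subseteq> N"
    using eq by (auto simp: eventually_ae_filter)
  have "g -` A \<inter> N \<in> null_sets lebesgue"
    using N(1) by (metis Int_lower2 negligible_iff_null_sets negligible_subset)
  moreover have "f -` A \<in> sets lebesgue"
    using measurable_sets[OF f A] by simp
  ultimately have "(f -` A - N) \<union> (g -` A \<inter> N) \<in> sets lebesgue"
    using N(1) by (intro sets.Un sets.Diff) (auto dest: null_setsD2)
  also have "(f -` A - N) \<union> (g -` A \<inter> N) = g -` A"
  proof -
    have "f x = g x" if "x \<notin> N" for x using N(2) that by auto
    then show ?thesis by auto
  qed
  finally show "g -` A \<inter> space lebesgue \<in> sets lebesgue" by simp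
qed simp

section \<open>Matrix inverses and operator norms\<close>

lemma
  fixes A :: "real ^ 'm ^ 'm"
  assumes "invertible A"
  shows matrix_mul_matrix_inv: "A ** matrix_inv A = mat 1"
    and matrix_inv_mul_matrix: "matrix_inv A ** A = mat 1"
  using someI_ex[OF assms[unfolded invertible_def]] by (auto simp: matrix_inv_def)

text \<open>Cramer's rule presents the entries of the inverse as quotients of polynomials in the
  entries, from which measurability can be read off.\<close>

lemma matrix_inv_eq_cramer:
  fixes A :: "real ^ 'm ^ 'm"
  assumes "invertible A"
  shows "matrix_inv A = (\<chi> k j. det (\<chi> i l. if l = k then axis j 1 $ i else A $ i $ l) / det A)"
proof -
  have "matrix_inv A *v axis j 1 = (\<chi> k. det (\<chi> i l. if l = k then axis j 1 $ i else A $ i $ l) / det A)" for j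
  proof (subst cramer[symmetric])
    show "det A \<noteq> 0" using assms by (simp add: invertible_det_nz)
    show "A *v (matrix_inv A *v axis j 1) = axis j 1"
      by (simp add: matrix_vector_mul_assoc matrix_mul_matrix_inv[OF assms])
  qed
  then have "(matrix_inv A *v axis j 1) $ k = det (\<chi> i l. if l = k then axis j 1 $ i else A $ i $ l) / det A" for j k
    by simp
  then show ?thesis
    by (simp add: vec_eq_iff matrix_vector_mult_basis column_def)
qed

lemma borel_measurable_matrix_inv:
  fixes A :: "'a::euclidean_space \<Rightarrow> real ^ 'm ^ 'm"
  assumes [measurable]: "A \<in> leb_borel"
    and inv: "AE x in lebesgue. invertible (A x)"
  shows "(\<lambda>x. matrix_inv (A x)) \<in> leb_borel"
proof (rule borel_measurable_lebesgue_cong_AE)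
  show "(\<lambda>x. \<chi> k j. det (\<chi> i l. if l = k then axis j 1 $ i else A x $ i $ l) / det (A x))
    \<in> leb_borel"
    by measurable
  show "AE x in lebesgue. (\<chi> k j. det (\<chi> i l. if l = k then axis j 1 $ i else A x $ i $ l) / det (A x))
    = matrix_inv (A x)"
    using inv by eventually_elim (simp add: matrix_inv_eq_cramer)
qed

lemma onorm_matrix_mult_le:
  fixes A :: "real ^ 'm ^ 'k" and B :: "real ^ 'l ^ 'm"
  shows "onorm ((*v) (A ** B)) \<le> onorm ((*v) A) * onorm ((*v) B)"
proof -
  have "(*v) (A ** B) = (*v) A \<circ> (*v) B"
    by (auto simp: matrix_vector_mul_assoc)
  then show ?thesis
    using onorm_compose[OF matrix_vector_mul_bounded_linear[of A] matrix_vector_mul_bounded_linear[of B]] by simp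
qed

lemma norm_matrix_vector_le: "norm (A *v z) \<le> onorm ((*v) A) * norm z" for A :: "real ^ 'm ^ 'k"
  by (rule onorm) simp

lemma onorm_matrix_nonneg [simp]: "0 \<le> onorm ((*v) A)" for A :: "real ^ 'm ^ 'k"
  by (rule onorm_pos_le) simp

lemma onorm_invertible_pos:
  fixes A :: "real ^ 'm ^ 'm"
  assumes "invertible A" shows "0 < onorm ((*v) A)"
proof -
  have "\<not> (\<forall>x. A *v x = 0)"
  proof
    assume 0: "\<forall>x. A *v x = 0"
    have "matrix_inv A *v (A *v axis undefined 1) = axis undefined 1"
      by (simp add: matrix_vector_mul_assoc matrix_inv_mul_matrix[OF assms])
    with 0 show False by simp
  qed
  then show ?thesis by (subst onorm_pos_lt) auto
qed

section \<open>Consequences of the matrix Muckenhoupt condition\<close>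

lemma cubesE:
  assumes "Q \<in> cubes"
  obtains "Q \<in> sets lebesgue" "0 < emeasure lebesgue Q" "emeasure lebesgue Q < \<infinity>"
proof -
  obtain a l where Q: "Q = cbox a (\<chi> i. a $ i + l)" "0 < l"
    using assms by (auto simp: cubes_def)
  have "box a (\<chi> i. a $ i + l) \<noteq> {}"
    using Q by (auto simp: box_eq_empty Basis_vec_def inner_axis)
  then have "0 < emeasure lebesgue (box a (\<chi> i. a $ i + l))"
    by (metis open_box lmeasurable_box emeasure_eq_measure2 measure_nonneg negligible_iff_measure
        open_not_negligible ennreal_less_zero_iff less_le)
  also have "\<dots> \<le> emeasure lebesgue Q"
    unfolding Q by (intro emeasure_mono box_subset_cbox) auto
  finally show ?thesis
    using that emeasure_bounded_finite[of Q] by (auto simp: Q emeasure_bounded_finite)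
qed

locale Ap_weight =
  fixes p :: "real ^ 'n \<Rightarrow> real" and W :: "real ^ 'n \<Rightarrow> real ^ 'm ^ 'm" and a b :: real
  assumes p_measurable [measurable]: "p \<in> leb_borel"
    and one_less_a: "1 < a" and a_le_p: "\<And>x. a \<le> p x" and p_le_b: "\<And>x. p x \<le> b"
    and W_measurable [measurable]: "W \<in> leb_borel"
    and W_invertible: "AE x in lebesgue. invertible (W x)"
    and Ap_finite: "Ap_const p W < \<infinity>"
begin

abbreviation "p' \<equiv> conj_exponent p"

lemma one_less_p: "1 < p x"
  using one_less_a a_le_p[of x] by linarith

lemma conj_exponent_sum: "1 / p x + 1 / p' x = 1"
  using one_less_p[of x] by (simp add: conj_exponent_def)

sublocale p: exponent_function p b
  using one_less_p p_le_b by unfold_locales (auto intro: less_imp_le)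

text \<open>The uniform gap \<open>1 < a\<close> is what keeps the conjugate exponent
  bounded.\<close>

sublocale p': exponent_function p' "1 / (1 - 1 / a)"
proof
  show "p' \<in> leb_borel"
    unfolding conj_exponent_def by measurable
  fix x
  have "0 < 1 - 1 / a" "1 - 1 / a \<le> 1 - 1 / p x" "1 - 1 / p x \<le> 1"
    using one_less_a a_le_p[of x] by (auto intro!: divide_left_mono)
  then show "1 \<le> p' x" "p' x \<le> 1 / (1 - 1 / a)"
    unfolding conj_exponent_def by (auto intro!: divide_left_mono mult_pos_pos)
qed

lemmas Holder = nn_integral_mult_le_lux_norm[OF p.exponent_function_axioms p'.exponent_function_axioms
  one_less_p conj_exponent_sum]

lemma matrix_inv_W_measurable [measurable]: "(\<lambda>x. matrix_inv (W x)) \<in> leb_borel"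
  by (rule borel_measurable_matrix_inv) (use W_invertible in auto)

text \<open>The inner norm of the matrix condition as a function of the outer variable. Everything
  applied to it holds without measurability in x, so none has to be proved.\<close>

definition h :: "(real ^ 'n) set \<Rightarrow> real ^ 'n \<Rightarrow> ennreal" where
  "h Q x = lux_norm p' (\<lambda>y. ennreal (onorm ((*v) (W x ** matrix_inv (W y)))) * indicator Q y)"

lemma lux_norm_h_le:
  assumes "Q \<in> cubes"
  shows "lux_norm p (\<lambda>x. h Q x * indicator Q x) \<le> Ap_const p W * emeasure lebesgue Q"
proof -
  have "lux_norm p (\<lambda>x. h Q x * indicator Q x) / emeasure lebesgue Q \<le> Ap_const p W"
    unfolding Ap_const_def h_def using assms by (rule SUP_upper)
  then have "lux_norm p (\<lambda>x. h Q x * indicator Q x) / emeasure lebesgue Q * emeasure lebesgue Q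
    \<le> Ap_const p W * emeasure lebesgue Q"
    by (rule mult_right_mono) simp
  moreover have "lux_norm p (\<lambda>x. h Q x * indicator Q x) / emeasure lebesgue Q * emeasure lebesgue Q
      = lux_norm p (\<lambda>x. h Q x * indicator Q x)"
    using assms by (elim cubesE) (simp add: ennreal_divide_times)
  ultimately show ?thesis by simp
qed

lemma lux_norm_h_finite:
  assumes "Q \<in> cubes" shows "lux_norm p (\<lambda>x. h Q x * indicator Q x) < \<infinity>"
  using le_less_trans[OF lux_norm_h_le[OF assms]] assms Ap_finite
  by (elim cubesE) (simp add: ennreal_mult_less_top)

text \<open>At some x in Q the matrix is invertible and \<open>h Q x\<close> is finite, since
  otherwise the outer modular would be infinite on a set of positive measure. With this x fixed,
  W^-1(y) = W(x)^-1 W(x) W^-1(y) compares the two integrands.\<close>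

lemma lux_norm_matrix_inv_W_finite:
  assumes "Q \<in> cubes"
  shows "lux_norm p' (\<lambda>y. ennreal (onorm ((*v) (matrix_inv (W y)))) * indicator Q y) < \<infinity>"
proof -
  have Q: "Q \<in> sets lebesgue" "0 < emeasure lebesgue Q" "emeasure lebesgue Q < \<infinity>"
    using assms by (auto elim: cubesE)
  have "\<exists>x\<in>Q. invertible (W x) \<and> h Q x < \<infinity>"
  proof (rule ccontr)
    assume no: "\<not> ?thesis"
    obtain t where t: "0 \<le> t" "lux_norm p (\<lambda>x. h Q x * indicator Q x) = ennreal t"
      using lux_norm_h_finite[OF assms] by (cases "lux_norm p (\<lambda>x. h Q x * indicator Q x)") auto
    then have m: "modular p (\<lambda>x. h Q x * indicator Q x / ennreal (t + 1)) \<le> 1"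
      by (intro p.modular_le_1_if_lux_norm_less) (simp add: ennreal_less_iff)
    have "(\<integral>\<^sup>+x. top * indicator Q x \<partial>lebesgue) \<le> modular p (\<lambda>x. h Q x * indicator Q x / ennreal (t + 1))"
      unfolding modular_def
    proof (rule nn_integral_mono_AE, use W_invertible in eventually_elim)
      fix x assume "invertible (W x)"
      then show "top * indicator Q x \<le> epowr (h Q x * indicator Q x / ennreal (t + 1)) (p x)"
        using no t by (cases "x \<in> Q") (auto simp: less_top[symmetric] ennreal_top_divide)
    qed
    moreover have "(\<integral>\<^sup>+x. top * indicator Q x \<partial>lebesgue) = top * emeasure lebesgue Q"
      using Q(1) by (rule nn_integral_cmult_indicator)
    moreover have "top * emeasure lebesgue Q = top"
      using Q(2) by (simp only: ennreal_top_mult) auto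
    ultimately have "top \<le> (1 :: ennreal)"
      using m by (metis order_trans)
    then show False by (simp add: top_unique)
  qed
  then obtain x where x: "invertible (W x)" "h Q x < \<infinity>" by blast
  \<comment> \<open>The added 1 makes the factor positive, as homogeneity of the norm
    requires.\<close>
  define c where "c = onorm ((*v) (matrix_inv (W x))) + 1"
  have c: "0 < c" unfolding c_def by (intro add_nonneg_pos) auto
  have "lux_norm p' (\<lambda>y. ennreal (onorm ((*v) (matrix_inv (W y)))) * indicator Q y)
    \<le> lux_norm p' (\<lambda>y. ennreal c * (ennreal (onorm ((*v) (W x ** matrix_inv (W y)))) * indicator Q y))"
  proof (rule p'.lux_norm_mono)
    fix y
    have "matrix_inv (W y) = matrix_inv (W x) ** (W x ** matrix_inv (W y))"
      by (simp add: matrix_mul_assoc matrix_inv_mul_matrix[OF x(1)])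
    then have "onorm ((*v) (matrix_inv (W y)))
        \<le> onorm ((*v) (matrix_inv (W x))) * onorm ((*v) (W x ** matrix_inv (W y)))"
      by (metis onorm_matrix_mult_le)
    also have "\<dots> \<le> c * onorm ((*v) (W x ** matrix_inv (W y)))"
      unfolding c_def by (intro mult_right_mono) auto
    finally show "ennreal (onorm ((*v) (matrix_inv (W y)))) * indicator Q y
        \<le> ennreal c * (ennreal (onorm ((*v) (W x ** matrix_inv (W y)))) * indicator Q y)"
      using c by (auto split: split_indicator simp flip: ennreal_mult intro: ennreal_leI)
  qed
  also have "\<dots> = ennreal c * h Q x"
    unfolding h_def using c by (rule p'.lux_norm_cmult)
  also have "\<dots> < \<infinity>"
    using x by (simp add: ennreal_mult_less_top)
  finally show ?thesis .
qed

text \<open>From W(x) = W(x) W^-1(y) W(y) one gets |W(x) W^-1(y)| at least |W(x)|/|W(y)|. So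
  \<open>h Q x\<close> dominates |W(x)| times the conjugate norm of 1/|W| on Q, a number that is not
  zero.\<close>

lemma lux_norm_W_finite:
  assumes "Q \<in> cubes"
  shows "lux_norm p (\<lambda>x. ennreal (onorm ((*v) (W x))) * indicator Q x) < \<infinity>"
proof -
  have Q [measurable]: "Q \<in> sets lebesgue" and Qpos: "0 < emeasure lebesgue Q"
    using assms by (auto elim: cubesE)
  define g where "g y = ennreal (1 / onorm ((*v) (W y))) * indicator Q y" for y
  have [measurable]: "g \<in> leb_borel" unfolding g_def by measurable
  have "lux_norm p' g \<noteq> 0"
  proof
    assume "lux_norm p' g = 0"
    then have "AE y in lebesgue. g y = 0"
      by (rule p'.AE_0_if_lux_norm_0) simp
    with W_invertible have "AE y in lebesgue. y \<notin> Q"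
      by eventually_elim (auto simp: g_def ennreal_eq_0_iff dest: onorm_invertible_pos split: split_indicator_asm)
    then have "Q \<in> null_sets lebesgue"
      using AE_iff_null_sets[OF Q] by blast
    then have "emeasure lebesgue Q = 0" by (rule null_setsD1)
    with Qpos show False by (metis less_irrefl)
  qed
  \<comment> \<open>A positive real below the norm of g is taken instead of the norm, which has not
    been shown finite.\<close>
  then obtain c where c: "0 < c" "ennreal c \<le> lux_norm p' g"
  proof (cases "lux_norm p' g")
    case (real r)
    then show ?thesis using that[of r] \<open>lux_norm p' g \<noteq> 0\<close> by (auto simp: less_le)
  next
    case top
    then show ?thesis using that[of 1] by simp
  qed
  have "lux_norm p (\<lambda>x. ennreal c * (ennreal (onorm ((*v) (W x))) * indicator Q x))
    \<le> lux_norm p (\<lambda>x. h Q x * indicator Q x)"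
  proof (rule p.lux_norm_mono)
    fix x
    have "ennreal c * ennreal (onorm ((*v) (W x))) \<le> h Q x"
    proof (cases "onorm ((*v) (W x)) = 0")
      case False
      then have pos: "0 < onorm ((*v) (W x))" by (simp add: less_le)
      have "ennreal c * ennreal (onorm ((*v) (W x))) \<le> ennreal (onorm ((*v) (W x))) * lux_norm p' g"
        unfolding mult.commute[of "ennreal c"] using c(2) by (intro mult_left_mono) auto
      also have "\<dots> = lux_norm p' (\<lambda>y. ennreal (onorm ((*v) (W x))) * g y)"
        using pos by (simp add: p'.lux_norm_cmult)
      also have "\<dots> \<le> h Q x"
        unfolding h_def
      proof (rule p'.lux_norm_mono_AE, use W_invertible in eventually_elim)
        fix y assume y: "invertible (W y)"
        have "W x = (W x ** matrix_inv (W y)) ** W y"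
          by (simp add: matrix_inv_mul_matrix[OF y] flip: matrix_mul_assoc)
        then have "onorm ((*v) (W x)) \<le> onorm ((*v) (W x ** matrix_inv (W y))) * onorm ((*v) (W y))"
          by (metis onorm_matrix_mult_le)
        then have "onorm ((*v) (W x)) * (1 / onorm ((*v) (W y))) \<le> onorm ((*v) (W x ** matrix_inv (W y)))"
          using onorm_invertible_pos[OF y] by (simp add: field_simps)
        then show "ennreal (onorm ((*v) (W x))) * g y
          \<le> ennreal (onorm ((*v) (W x ** matrix_inv (W y)))) * indicator Q y"
          by (auto simp: g_def split: split_indicator simp flip: ennreal_mult intro: ennreal_leI)
      qed
      finally show ?thesis .
    qed simp
    then show "ennreal c * (ennreal (onorm ((*v) (W x))) * indicator Q x) \<le> h Q x * indicator Q x"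
      by (simp split: split_indicator)
  qed
  then have "ennreal c * lux_norm p (\<lambda>x. ennreal (onorm ((*v) (W x))) * indicator Q x) < \<infinity>"
    using c lux_norm_h_finite[OF assms] by (simp add: p.lux_norm_cmult)
  then show ?thesis
    using c by (auto simp: ennreal_mult_less_top ennreal_mult_top less_top[symmetric])
qed

text \<open>Hoelder's inequality in y with x frozen, after inserting W^-1(y) W(y) between W(x) and
  f(y).\<close>

lemma nn_integral_norm_W_le:
  assumes [measurable]: "f \<in> leb_borel" and Q: "Q \<in> cubes"
  shows "(\<integral>\<^sup>+y. ennreal (norm (W x *v f y)) * indicator Q y \<partial>lebesgue)
    \<le> 2 * lux_norm p (\<lambda>y. ennreal (norm (W y *v f y)) * indicator Q y) * h Q x"
proof -
  have [measurable]: "Q \<in> sets lebesgue" using Q by (rule cubesE)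
  have "(\<integral>\<^sup>+y. ennreal (norm (W x *v f y)) * indicator Q y \<partial>lebesgue)
    \<le> (\<integral>\<^sup>+y. (ennreal (norm (W y *v f y)) * indicator Q y)
      * (ennreal (onorm ((*v) (W x ** matrix_inv (W y)))) * indicator Q y) \<partial>lebesgue)"
  proof (rule nn_integral_mono_AE, use W_invertible in eventually_elim)
    fix y assume y: "invertible (W y)"
    have "W x *v f y = (W x ** matrix_inv (W y)) *v (W y *v f y)"
      by (simp add: matrix_vector_mul_assoc matrix_inv_mul_matrix[OF y] flip: matrix_mul_assoc)
    then have "norm (W x *v f y) \<le> norm (W y *v f y) * onorm ((*v) (W x ** matrix_inv (W y)))"
      by (metis norm_matrix_vector_le mult.commute)
    then show "ennreal (norm (W x *v f y)) * indicator Q y \<le> (ennreal (norm (W y *v f y)) * indicator Q y)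
      * (ennreal (onorm ((*v) (W x ** matrix_inv (W y)))) * indicator Q y)"
      by (auto split: split_indicator simp flip: ennreal_mult intro: ennreal_leI)
  qed
  also have "\<dots> \<le> 2 * lux_norm p (\<lambda>y. ennreal (norm (W y *v f y)) * indicator Q y) * h Q x"
    unfolding h_def by (rule Holder) auto
  finally show ?thesis .
qed

text \<open>The same argument with the identity in place of W(x); it makes members of the weighted
  space locally integrable.\<close>

lemma nn_integral_norm_le:
  assumes [measurable]: "f \<in> leb_borel" and Q: "Q \<in> cubes"
  shows "(\<integral>\<^sup>+y. ennreal (norm (f y)) * indicator Q y \<partial>lebesgue)
    \<le> 2 * wnorm p W f * lux_norm p' (\<lambda>y. ennreal (onorm ((*v) (matrix_inv (W y)))) * indicator Q y)"
proof -
  have [measurable]: "Q \<in> sets lebesgue" using Q by (rule cubesE)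
  have "(\<integral>\<^sup>+y. ennreal (norm (f y)) * indicator Q y \<partial>lebesgue)
    \<le> (\<integral>\<^sup>+y. ennreal (norm (W y *v f y))
      * (ennreal (onorm ((*v) (matrix_inv (W y)))) * indicator Q y) \<partial>lebesgue)"
  proof (rule nn_integral_mono_AE, use W_invertible in eventually_elim)
    fix y assume y: "invertible (W y)"
    have "f y = matrix_inv (W y) *v (W y *v f y)"
      by (simp add: matrix_vector_mul_assoc matrix_inv_mul_matrix[OF y])
    then have "norm (f y) \<le> norm (W y *v f y) * onorm ((*v) (matrix_inv (W y)))"
      by (metis norm_matrix_vector_le mult.commute)
    then show "ennreal (norm (f y)) * indicator Q y \<le> ennreal (norm (W y *v f y))
      * (ennreal (onorm ((*v) (matrix_inv (W y)))) * indicator Q y)"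
      by (auto split: split_indicator simp flip: ennreal_mult intro: ennreal_leI)
  qed
  also have "\<dots> \<le> 2 * wnorm p W f * lux_norm p' (\<lambda>y. ennreal (onorm ((*v) (matrix_inv (W y)))) * indicator Q y)"
    unfolding wnorm_def by (rule Holder) auto
  finally show ?thesis .
qed

end

section \<open>Completeness of the weighted space\<close>

context exponent_function
begin

text \<open>Fatou's lemma applies to the modulars at each scale t above c; letting t vary then gives
  lower semicontinuity of the norm.\<close>

lemma lux_norm_Fatou:
  fixes u :: "nat \<Rightarrow> real ^ 'n \<Rightarrow> real"
  assumes [measurable]: "\<And>i. u i \<in> leb_borel"
    and nonneg: "\<And>i x. 0 \<le> u i x"
    and lim: "AE x in lebesgue. (\<lambda>i. u i x) \<longlonglongrightarrow> v x"
    and le: "\<And>i. lux_norm q (\<lambda>x. ennreal (u i x)) \<le> ennreal c" and "0 \<le> c"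
  shows "lux_norm q (\<lambda>x. ennreal (v x)) \<le> ennreal c"
proof (subst lux_norm_le_iff[OF \<open>0 \<le> c\<close>], intro allI impI)
  fix t assume t: "c < t"
  then have "0 < t" using \<open>0 \<le> c\<close> by simp
  have mod_le: "modular q (\<lambda>x. ennreal (u i x) / ennreal t) \<le> 1" for i
    using le[of i] t \<open>0 \<le> c\<close>
    by (intro modular_le_1_if_lux_norm_less) (auto elim!: le_less_trans simp: ennreal_less_iff)
  have "modular q (\<lambda>x. ennreal (v x) / ennreal t)
    \<le> (\<integral>\<^sup>+x. liminf (\<lambda>i. epowr (ennreal (u i x) / ennreal t) (q x)) \<partial>lebesgue)"
    unfolding modular_def
  proof (rule nn_integral_mono_AE, use lim in eventually_elim)
    fix x assume lim: "(\<lambda>i. u i x) \<longlonglongrightarrow> v x"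
    have "0 \<le> v x" using lim nonneg by (intro tendsto_lowerbound[OF lim]) auto
    have "(\<lambda>i. (u i x / t) powr q x) \<longlonglongrightarrow> (v x / t) powr q x"
      using lim nonneg q_pos[of x] \<open>0 < t\<close> by (intro tendsto_powr' tendsto_intros) (auto intro!: always_eventually)
    then have "(\<lambda>i. ennreal ((u i x / t) powr q x)) \<longlonglongrightarrow> ennreal ((v x / t) powr q x)"
      by (rule tendsto_ennrealI)
    then have "(\<lambda>i. epowr (ennreal (u i x) / ennreal t) (q x)) \<longlonglongrightarrow> epowr (ennreal (v x) / ennreal t) (q x)"
      using nonneg \<open>0 \<le> v x\<close> \<open>0 < t\<close> by (simp add: divide_ennreal epowr_ennreal)
    from lim_imp_Liminf[OF sequentially_bot this]
    show "epowr (ennreal (v x) / ennreal t) (q x) \<le> liminf (\<lambda>i. epowr (ennreal (u i x) / ennreal t) (q x))"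
      by simp
  qed
  also have "\<dots> \<le> liminf (\<lambda>i. modular q (\<lambda>x. ennreal (u i x) / ennreal t))"
    unfolding modular_def by (rule nn_integral_liminf) measurable
  also have "\<dots> \<le> liminf (\<lambda>i. 1)"
    by (intro Liminf_mono always_eventually allI mod_le)
  finally show "modular q (\<lambda>x. ennreal (v x) / ennreal t) \<le> 1"
    by (simp add: Liminf_const)
qed

lemma lux_norm_sum:
  assumes "finite I" and meas: "\<And>i. i \<in> I \<Longrightarrow> f i \<in> leb_borel"
  shows "lux_norm q (\<lambda>x. \<Sum>i\<in>I. f i x) \<le> (\<Sum>i\<in>I. lux_norm q (f i))"
  using assms
proof (induction I rule: finite_induct)
  case (insert i I)
  have "lux_norm q (\<lambda>x. f i x + (\<Sum>i\<in>I. f i x)) \<le> lux_norm q (f i) + lux_norm q (\<lambda>x. \<Sum>i\<in>I. f i x)"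
    using insert.prems by (intro lux_norm_triangle borel_measurable_sum) auto
  also have "\<dots> \<le> lux_norm q (f i) + (\<Sum>i\<in>I. lux_norm q (f i))"
    using insert by (intro add_left_mono) auto
  finally show ?case using insert by simp
qed simp

text \<open>Since w is at most 1 + w^q, a normalized function is integrable over sets of finite
  measure. This converts norm bounds into almost everywhere statements.\<close>

lemma nn_integral_indicator_le_if_lux_norm_less:
  assumes "lux_norm q f < ennreal t" "0 < t" and [measurable]: "f \<in> leb_borel" "S \<in> sets lebesgue"
  shows "(\<integral>\<^sup>+x. f x * indicator S x \<partial>lebesgue) \<le> ennreal t * (emeasure lebesgue S + 1)"
proof -
  have le: "w \<le> 1 + epowr w (q x)" for w x
  proof (cases w)
    case (real r)
    have "r \<le> 1 + r powr q x"
    proof (cases "r \<le> 1")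
      case False
      then show ?thesis using powr_mono[of 1 "q x" r] one_le_q[of x] by simp
    qed (simp add: add_increasing2)
    then show ?thesis using real by (simp add: epowr_ennreal ennreal_leI flip: ennreal_1 ennreal_plus)
  qed simp
  have "(\<integral>\<^sup>+x. f x * indicator S x \<partial>lebesgue)
    \<le> (\<integral>\<^sup>+x. ennreal t * (indicator S x + epowr (f x / ennreal t) (q x)) \<partial>lebesgue)"
  proof (rule nn_integral_mono)
    fix x
    have "f x = ennreal t * (f x / ennreal t)"
      using \<open>0 < t\<close> by (simp add: ennreal_divide_real mult.assoc[symmetric] flip: ennreal_mult)
    also have "\<dots> \<le> ennreal t * (1 + epowr (f x / ennreal t) (q x))"
      by (intro mult_left_mono le) simp
    finally show "f x * indicator S x \<le> ennreal t * (indicator S x + epowr (f x / ennreal t) (q x))"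
      by (simp split: split_indicator)
  qed
  also have "\<dots> = ennreal t * (emeasure lebesgue S + modular q (\<lambda>x. f x / ennreal t))"
    by (simp add: nn_integral_cmult nn_integral_add modular_def)
  also have "\<dots> \<le> ennreal t * (emeasure lebesgue S + 1)"
    using assms by (intro mult_left_mono add_left_mono modular_le_1_if_lux_norm_less) auto
  finally show ?thesis .
qed

text \<open>The partial sums have uniformly bounded norm, hence uniformly bounded integrals over
  each ball; monotone convergence then bounds the integral of the full sum over the ball.\<close>

lemma AE_suminf_finite:
  fixes u :: "nat \<Rightarrow> real ^ 'n \<Rightarrow> ennreal"
  assumes [measurable]: "\<And>i. u i \<in> leb_borel"
    and le: "(\<Sum>i. lux_norm q (u i)) < \<infinity>"
  shows "AE x in lebesgue. (\<Sum>i. u i x) < \<infinity>"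
proof -
  obtain c where c: "0 \<le> c" "(\<Sum>i. lux_norm q (u i)) = ennreal c"
    using le by (cases "\<Sum>i. lux_norm q (u i)") auto
  have "AE x in lebesgue. (\<Sum>i. u i x) * indicator (ball 0 (real k)) x \<noteq> \<infinity>" for k
  proof (rule nn_integral_PInf_AE)
    let ?S = "ball 0 (real k) :: (real ^ 'n) set"
    have [measurable]: "?S \<in> sets lebesgue" using fmeasurableD[OF lmeasurable_ball] by blast
    let ?B = "ennreal (c + 1) * (emeasure lebesgue ?S + 1)"
    have "(\<integral>\<^sup>+x. (\<Sum>i<n. u i x) * indicator ?S x \<partial>lebesgue) \<le> ?B" for n
    proof (rule nn_integral_indicator_le_if_lux_norm_less)
      have "lux_norm q (\<lambda>x. \<Sum>i<n. u i x) \<le> (\<Sum>i<n. lux_norm q (u i))"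
        by (rule lux_norm_sum) auto
      also have "\<dots> \<le> ennreal c"
        unfolding c(2)[symmetric] by (rule sum_le_suminf) auto
      also have "\<dots> < ennreal (c + 1)"
        using c(1) by (simp add: ennreal_less_iff)
      finally show "lux_norm q (\<lambda>x. \<Sum>i<n. u i x) < ennreal (c + 1)" .
    qed (use c in auto)
    then have "(SUP n. \<integral>\<^sup>+x. (\<Sum>i<n. u i x) * indicator ?S x \<partial>lebesgue) \<le> ?B"
      by (rule SUP_least)
    also have "(SUP n. \<integral>\<^sup>+x. (\<Sum>i<n. u i x) * indicator ?S x \<partial>lebesgue)
      = (\<integral>\<^sup>+x. (SUP n. (\<Sum>i<n. u i x) * indicator ?S x) \<partial>lebesgue)"
      by (rule nn_integral_monotone_convergence_SUP[symmetric])
        (auto simp: incseq_def le_fun_def intro!: mult_right_mono sum_mono2)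
    also have "\<dots> = (\<integral>\<^sup>+x. (\<Sum>i. u i x) * indicator ?S x \<partial>lebesgue)"
      by (intro nn_integral_cong) (auto simp: suminf_eq_SUP split: split_indicator)
    finally have "(\<integral>\<^sup>+x. (\<Sum>i. u i x) * indicator ?S x \<partial>lebesgue) \<le> ?B" .
    also have "?B < \<infinity>"
      using emeasure_bounded_finite[OF bounded_ball, of "0 :: real ^ 'n" "real k"]
      by (simp add: ennreal_mult_less_top)
    finally show "(\<integral>\<^sup>+x. (\<Sum>i. u i x) * indicator ?S x \<partial>lebesgue) \<noteq> \<infinity>" by simp
    show "(\<lambda>x. (\<Sum>i. u i x) * indicator ?S x) \<in> leb_borel"
      by measurable
  qed
  then have "AE x in lebesgue. \<forall>k. (\<Sum>i. u i x) * indicator (ball 0 (real k)) x \<noteq> \<infinity>"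
    by (simp add: AE_all_countable)
  then show ?thesis
  proof eventually_elim
    case (elim x)
    obtain k where "norm x < real k" using reals_Archimedean2 by blast
    with elim[rule_format, of k] show ?case by (simp add: less_top)
  qed
qed

end

lemma convergent_if_suminf_norm_diff_finite:
  fixes v :: "nat \<Rightarrow> 'a::banach"
  assumes "(\<Sum>k. ennreal (norm (v (Suc k) - v k))) < \<infinity>"
  shows "convergent v"
proof -
  have "summable (\<lambda>k. norm (v (Suc k) - v k))"
    using assms by (intro summable_suminf_not_top) auto
  then have "summable (\<lambda>k. v (Suc k) - v k)"
    by (rule summable_norm_cancel)
  then have "convergent (\<lambda>n. \<Sum>k<n. v (Suc k) - v k)"
    by (simp add: summable_iff_convergent)
  then have "convergent (\<lambda>n. (v n - v 0) + v 0)"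
    unfolding sum_lessThan_telescope by (intro convergent_add convergent_const)
  then show ?thesis by simp
qed

context Ap_weight
begin

abbreviation (input) "wn \<equiv> wnorm p W"
abbreviation (input) "wdist f g \<equiv> wn (\<lambda>x. f x - g x)"
abbreviation (input) "wtail R f \<equiv> wn (\<lambda>x. indicator (- ball 0 R) x *\<^sub>R f x)"

lemma wnorm_cong_AE: "AE x in lebesgue. f x = g x \<Longrightarrow> wn f = wn g"
  unfolding wnorm_def by (rule p.lux_norm_cong_AE) auto

lemma wnorm_mono:
  "(\<And>x. norm (W x *v f x) \<le> norm (W x *v g x)) \<Longrightarrow> wn f \<le> wn g"
  unfolding wnorm_def by (intro p.lux_norm_mono ennreal_leI)

lemma wnorm_triangle:
  assumes [measurable]: "f \<in> leb_borel" "g \<in> leb_borel"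
  shows "wn (\<lambda>x. f x + g x) \<le> wn f + wn g"
proof -
  have "wn (\<lambda>x. f x + g x) \<le> lux_norm p (\<lambda>x. ennreal (norm (W x *v f x)) + ennreal (norm (W x *v g x)))"
    unfolding wnorm_def
    by (intro p.lux_norm_mono)
      (auto simp: matrix_vector_right_distrib norm_triangle_ineq intro!: ennreal_leI simp flip: ennreal_plus)
  also have "\<dots> \<le> wn f + wn g"
    unfolding wnorm_def by (rule p.lux_norm_triangle) measurable
  finally show ?thesis .
qed

lemma wnorm_minus_commute: "wdist f g = wdist g f"
  unfolding wnorm_def by (simp add: matrix_vector_mult_diff_distrib norm_minus_commute)

lemma wnorm_diff_triangle:
  assumes [measurable]: "f \<in> leb_borel" "g \<in> leb_borel" "k \<in> leb_borel"
  shows "wdist f g \<le> wdist f k + wdist k g"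
  using wnorm_triangle[of "\<lambda>x. f x - k x" "\<lambda>x. k x - g x"] by simp

lemma wnorm_le_diff_add:
  assumes [measurable]: "f \<in> leb_borel" "g \<in> leb_borel"
  shows "wn f \<le> wdist f g + wn g"
  using wnorm_triangle[of "\<lambda>x. f x - g x" g] by simp

lemma wnorm_0 [simp]: "wn (\<lambda>x. 0) = 0"
  by (simp add: wnorm_def)

lemma wnorm_diff_le:
  assumes [measurable]: "f \<in> leb_borel" "g \<in> leb_borel"
  shows "wdist f g \<le> wn f + wn g"
  using wnorm_diff_triangle[of f g "\<lambda>x. 0"] wnorm_minus_commute[of "\<lambda>x. 0" g] by simp

lemma wLpD:
  assumes "f \<in> wLp p W"
  shows "f \<in> leb_borel" "wn f < \<infinity>"
  using assms by (auto simp: wLp_def)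

lemma wLp_diff: "f \<in> wLp p W \<Longrightarrow> g \<in> wLp p W \<Longrightarrow> (\<lambda>x. f x - g x) \<in> wLp p W"
  using wnorm_diff_le[of f g] by (auto simp: wLp_def elim!: le_less_trans)

lemma wnorm_diff_finite: "f \<in> wLp p W \<Longrightarrow> g \<in> wLp p W \<Longrightarrow> wdist f g < \<infinity>"
  using wLp_diff wLpD by blast

lemma wnorm_eq_0_iff:
  assumes [measurable]: "f \<in> leb_borel"
  shows "wn f = 0 \<longleftrightarrow> (AE x in lebesgue. f x = 0)"
proof
  assume "wn f = 0"
  then have "AE x in lebesgue. ennreal (norm (W x *v f x)) = 0"
    unfolding wnorm_def by (rule p.AE_0_if_lux_norm_0) measurable
  with W_invertible show "AE x in lebesgue. f x = 0"
  proof eventually_elim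
    case (elim x)
    then have "matrix_inv (W x) *v (W x *v f x) = 0" by (simp add: ennreal_eq_0_iff)
    then show ?case using elim by (simp add: matrix_vector_mul_assoc matrix_inv_mul_matrix)
  qed
next
  assume "AE x in lebesgue. f x = 0"
  then show "wn f = 0" using wnorm_cong_AE[of f "\<lambda>x. 0"] by simp
qed

text \<open>The Riesz-Fischer argument: along a fast subsequence W f converges almost everywhere,
  applying W^-1 pointwise gives a limit of f itself, and Fatou upgrades this to convergence in
  norm.\<close>

theorem wLp_complete:
  assumes f: "\<And>i. f i \<in> wLp p W"
    and Cauchy: "\<And>e :: real. 0 < e \<Longrightarrow> \<exists>N. \<forall>m\<ge>N. \<forall>n\<ge>N. wn (\<lambda>x. f m x - f n x) < ennreal e"
  shows "\<exists>g\<in>wLp p W. (\<lambda>n. wn (\<lambda>x. f n x - g x)) \<longlonglongrightarrow> 0"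
proof -
  have f_meas [measurable]: "f i \<in> leb_borel" for i
    using f[of i] by (rule wLpD)
  have "\<exists>N. \<forall>k. (\<forall>m\<ge>N k. \<forall>n\<ge>N k. wn (\<lambda>x. f m x - f n x) < ennreal ((1/2) ^ k)) "
    by (intro choice allI Cauchy) simp
  then obtain N where N: "\<And>k m n. N k \<le> m \<Longrightarrow> N k \<le> n \<Longrightarrow> wn (\<lambda>x. f m x - f n x) < ennreal ((1/2) ^ k)"
    by blast
  define r where "r k = (\<Sum>i\<le>k. N i)" for k
  have r_mono: "r k \<le> r j" if "k \<le> j" for k j
    unfolding r_def using that by (intro sum_mono2) auto
  have N_le_r: "N k \<le> r k" for k
    unfolding r_def by (rule member_le_sum) auto
  have r: "N k \<le> r j" if "k \<le> j" for k j
    using N_le_r[of k] r_mono[OF that] by linarith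
  define u where "u k x = norm (W x *v (f (r (Suc k)) x - f (r k) x))" for k x
  have u_meas [measurable]: "u k \<in> leb_borel" for k
    unfolding u_def by measurable
  have "(\<Sum>k. lux_norm p (\<lambda>x. ennreal (u k x))) \<le> (\<Sum>k. ennreal ((1/2) ^ k))"
  proof (rule suminf_le)
    fix k
    show "lux_norm p (\<lambda>x. ennreal (u k x)) \<le> ennreal ((1/2) ^ k)"
      using N[of k "r (Suc k)" "r k"] r[of k k] r[of k "Suc k"]
      unfolding u_def wnorm_def by (auto intro: less_imp_le)
  qed auto
  also have "\<dots> = ennreal (\<Sum>k. (1/2) ^ k)"
    by (intro suminf_ennreal2) auto
  finally have "(\<Sum>k. lux_norm p (\<lambda>x. ennreal (u k x))) < \<infinity>"
    by (rule le_less_trans) simp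
  then have "AE x in lebesgue. (\<Sum>k. ennreal (u k x)) < \<infinity>"
    by (intro p.AE_suminf_finite) measurable
  with W_invertible have conv: "AE x in lebesgue. convergent (\<lambda>k. f (r k) x)"
  proof eventually_elim
    case (elim x)
    then have "convergent (\<lambda>k. W x *v f (r k) x)"
      by (intro convergent_if_suminf_norm_diff_finite)
        (simp add: u_def matrix_vector_mult_diff_distrib)
    then obtain L where "(\<lambda>k. W x *v f (r k) x) \<longlonglongrightarrow> L"
      unfolding convergent_def by blast
    from bounded_linear.tendsto[OF matrix_vector_mul_bounded_linear this, of "matrix_inv (W x)"]
    have "convergent (\<lambda>k. matrix_inv (W x) *v (W x *v f (r k) x))"
      by (rule convergentI)
    then show ?case
      using elim by (simp add: matrix_vector_mul_assoc matrix_inv_mul_matrix)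
  qed
  define g where "g x = lim (\<lambda>k. f (r k) x)" for x
  have g_meas [measurable]: "g \<in> leb_borel"
    unfolding g_def by (rule borel_measurable_lim_metric) measurable
  have lim: "AE x in lebesgue. (\<lambda>k. f (r k) x) \<longlonglongrightarrow> g x"
    using conv by eventually_elim (simp add: g_def convergent_LIMSEQ_iff)
  \<comment> \<open>Fatou is applied in the second index with n fixed; the shift by k keeps all
    indices beyond \<open>N k\<close>.\<close>
  have le: "wn (\<lambda>x. f n x - g x) \<le> ennreal ((1/2) ^ k)" if "N k \<le> n" for n k
    unfolding wnorm_def
  proof (rule p.lux_norm_Fatou)
    show "AE x in lebesgue. (\<lambda>j. norm (W x *v (f n x - f (r (j + k)) x))) \<longlonglongrightarrow> norm (W x *v (f n x - g x))"
      using lim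
    proof eventually_elim
      case (elim x)
      then have "(\<lambda>j. f n x - f (r (j + k)) x) \<longlonglongrightarrow> f n x - g x"
        by (intro tendsto_diff tendsto_const LIMSEQ_ignore_initial_segment)
      then show ?case
        by (intro tendsto_norm bounded_linear.tendsto[OF matrix_vector_mul_bounded_linear])
    qed
    show "lux_norm p (\<lambda>x. ennreal (norm (W x *v (f n x - f (r (j + k)) x)))) \<le> ennreal ((1/2) ^ k)" for j
      using N[of k n "r (j + k)"] that r[of k "j + k"] by (auto simp: wnorm_def intro: less_imp_le)
  qed auto
  have "wn g \<le> wn (\<lambda>x. g x - f (N 0) x) + wn (f (N 0))"
    by (rule wnorm_le_diff_add) measurable
  also have "\<dots> < \<infinity>"
    using le[of 0 "N 0"] wLpD(2)[OF f[of "N 0"]] wnorm_minus_commute[of g "f (N 0)"]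
    by (auto simp: less_top intro: le_less_trans)
  finally have "g \<in> wLp p W" by (simp add: wLp_def)
  moreover have "(\<lambda>n. wn (\<lambda>x. f n x - g x)) \<longlonglongrightarrow> 0"
  proof (rule tendsto_0_if_eventually_le_ennreal)
    fix e :: real assume "0 < e"
    then obtain k where k: "(1/2) ^ k < e"
      using real_arch_pow_inv[of e "1/2"] by auto
    show "\<forall>\<^sub>F n in sequentially. wn (\<lambda>x. f n x - g x) \<le> ennreal e"
      using eventually_ge_at_top[of "N k"]
    proof eventually_elim
      case (elim n)
      show ?case by (rule order_trans[OF le[OF elim] ennreal_leI]) (use k in simp)
    qed
  qed
  ultimately show ?thesis by blast
qed

section \<open>The quotient metric space and total boundedness\<close>

abbreviation (input) cls :: "(real ^ 'n \<Rightarrow> real ^ 'm) \<Rightarrow> (real ^ 'n \<Rightarrow> real ^ 'm) set" where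
  "cls f \<equiv> wLp_rel p W `` {f}"

lemma some_in_cls:
  assumes "f \<in> wLp p W"
  shows "(SOME g. g \<in> cls f) \<in> wLp p W" "AE x in lebesgue. f x = (SOME g. g \<in> cls f) x"
proof -
  have "f \<in> cls f" using assms by (auto simp: wLp_rel_def)
  then have "(SOME g. g \<in> cls f) \<in> cls f" by (rule someI[where P = "\<lambda>g. g \<in> cls f"])
  then show "(SOME g. g \<in> cls f) \<in> wLp p W" "AE x in lebesgue. f x = (SOME g. g \<in> cls f) x"
    by (auto simp: wLp_rel_def)
qed

lemma wLp_dist_cls:
  assumes "f \<in> wLp p W" "g \<in> wLp p W"
  shows "wLp_dist p W (cls f) (cls g) = enn2real (wdist f g)"
proof -
  have "AE x in lebesgue. (SOME h. h \<in> cls f) x - (SOME h. h \<in> cls g) x = f x - g x"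
    using some_in_cls(2)[OF assms(1)] some_in_cls(2)[OF assms(2)] by eventually_elim simp
  then show ?thesis
    unfolding wLp_dist_def by (intro arg_cong[of _ _ enn2real] wnorm_cong_AE)
qed

lemma wLp_dist_less_iff:
  assumes "f \<in> wLp p W" "g \<in> wLp p W" "0 < e"
  shows "wLp_dist p W (cls f) (cls g) < e \<longleftrightarrow> wdist f g < ennreal e"
  using wnorm_diff_finite[OF assms(1,2)]
  by (cases "wdist f g") (auto simp: wLp_dist_cls assms ennreal_less_iff)

lemma in_quotient_cls: "f \<in> wLp p W \<Longrightarrow> cls f \<in> wLp p W // wLp_rel p W"
  by (rule quotientI)

lemma cls_eq_iff:
  assumes "f \<in> wLp p W" "g \<in> wLp p W"
  shows "cls f = cls g \<longleftrightarrow> (AE x in lebesgue. f x = g x)"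
proof
  assume "cls f = cls g"
  moreover have "g \<in> cls g" using assms by (auto simp: wLp_rel_def)
  ultimately have "g \<in> cls f" by simp
  then show "AE x in lebesgue. f x = g x" by (auto simp: wLp_rel_def)
next
  assume eq: "AE x in lebesgue. f x = g x"
  have "(AE x in lebesgue. f x = h x) \<longleftrightarrow> (AE x in lebesgue. g x = h x)" for h
    using eq by (auto elim: eventually_elim2)
  then show "cls f = cls g" using assms by (auto simp: wLp_rel_def)
qed

text \<open>Definiteness of the distance comes from the almost everywhere invertibility of W, since
  a zero norm only says that W f vanishes almost everywhere.\<close>

sublocale metric: Metric_space "wLp p W // wLp_rel p W" "wLp_dist p W"
proof
  show "0 \<le> wLp_dist p W X Y" for X Y by (simp add: wLp_dist_def)
  show "wLp_dist p W X Y = wLp_dist p W Y X" for X Y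
    unfolding wLp_dist_def by (subst wnorm_minus_commute) simp
  show "wLp_dist p W X Y = 0 \<longleftrightarrow> X = Y" if X: "X \<in> wLp p W // wLp_rel p W" and Y: "Y \<in> wLp p W // wLp_rel p W" for X Y
  proof -
    obtain f g where fg: "f \<in> wLp p W" "g \<in> wLp p W" "X = cls f" "Y = cls g"
      using X Y by (auto elim!: quotientE)
    have [measurable]: "f \<in> leb_borel" "g \<in> leb_borel"
      using fg by (auto dest: wLpD)
    have "wLp_dist p W X Y = 0 \<longleftrightarrow> wdist f g = 0"
      using wnorm_diff_finite[of f g] fg by (auto simp: wLp_dist_cls enn2real_eq_0_iff)
    also have "\<dots> \<longleftrightarrow> X = Y"
      using fg by (simp add: wnorm_eq_0_iff cls_eq_iff)
    finally show ?thesis .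
  qed
  show "wLp_dist p W X Z \<le> wLp_dist p W X Y + wLp_dist p W Y Z"
    if X: "X \<in> wLp p W // wLp_rel p W" and Y: "Y \<in> wLp p W // wLp_rel p W"
      and Z: "Z \<in> wLp p W // wLp_rel p W" for X Y Z
  proof -
    obtain f g h where fg: "f \<in> wLp p W" "g \<in> wLp p W" "h \<in> wLp p W" "X = cls f" "Y = cls g" "Z = cls h"
      using X Y Z by (auto elim!: quotientE)
    have "wdist f h \<le> wdist f g + wdist g h"
      using fg by (intro wnorm_diff_triangle) (auto dest: wLpD)
    then have "enn2real (wdist f h)
        \<le> enn2real (wdist f g + wdist g h)"
      using wnorm_diff_finite fg by (intro enn2real_mono) auto
    then show ?thesis
      using fg wnorm_diff_finite[of f g] wnorm_diff_finite[of g h]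
      by (simp add: wLp_dist_cls enn2real_plus)
  qed
qed

lemma mcomplete: "metric.mcomplete"
  unfolding metric.mcomplete_def
proof (intro allI impI)
  fix \<sigma> assume C: "metric.MCauchy \<sigma>"
  then have "\<forall>n. \<exists>f. f \<in> wLp p W \<and> \<sigma> n = cls f"
    by (auto simp: metric.MCauchy_def elim!: quotientE) (metis quotientE rangeI subsetD)
  then obtain f where f: "\<And>n. f n \<in> wLp p W" "\<And>n. \<sigma> n = cls (f n)"
    by metis
  have "\<exists>g\<in>wLp p W. (\<lambda>n. wn (\<lambda>x. f n x - g x)) \<longlonglongrightarrow> 0"
  proof (rule wLp_complete)
    fix e :: real assume e: "0 < e"
    obtain N where "\<forall>m n. N \<le> m \<longrightarrow> N \<le> n \<longrightarrow> wLp_dist p W (\<sigma> m) (\<sigma> n) < e"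
      using C e unfolding metric.MCauchy_def by blast
    then show "\<exists>N. \<forall>m\<ge>N. \<forall>n\<ge>N. wn (\<lambda>x. f m x - f n x) < ennreal e"
      using f e by (auto simp: wLp_dist_less_iff)
  qed (rule f)
  then obtain g where g: "g \<in> wLp p W" "(\<lambda>n. wn (\<lambda>x. f n x - g x)) \<longlonglongrightarrow> 0"
    by blast
  have "limitin metric.mtopology \<sigma> (cls g) sequentially"
    unfolding metric.limit_metric_sequentially
  proof (intro conjI allI impI)
    show "cls g \<in> wLp p W // wLp_rel p W" using g(1) by (rule in_quotient_cls)
    fix e :: real assume e: "0 < e"
    have "\<forall>\<^sub>F n in sequentially. wn (\<lambda>x. f n x - g x) < ennreal e"
      using g(2) e by (intro order_tendstoD) auto
    then show "\<exists>N. \<forall>n\<ge>N. \<sigma> n \<in> wLp p W // wLp_rel p W \<and> wLp_dist p W (\<sigma> n) (cls g) < e"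
      using f g(1) e by (auto simp: eventually_sequentially wLp_dist_less_iff in_quotient_cls)
  qed
  then show "\<exists>x. limitin metric.mtopology \<sigma> x sequentially" ..
qed

text \<open>In a complete space, compactness of the closure amounts to total boundedness of the set.
  The centres of the balls lie in the set itself, so finite nets can be lifted to representatives in
  F.\<close>

lemma wLp_precompact_iff_totally_bounded:
  assumes F: "F \<subseteq> wLp p W"
  shows "wLp_precompact p W F \<longleftrightarrow>
    (\<forall>e>0. \<exists>K. finite K \<and> K \<subseteq> F \<and> (\<forall>f\<in>F. \<exists>k\<in>K. wdist f k < ennreal e))"
proof -
  have quot: "A // wLp_rel p W = cls ` A" for A by (auto simp: quotient_def)
  have sub: "F // wLp_rel p W \<subseteq> wLp p W // wLp_rel p W"
    unfolding quot using F by blast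
  have "wLp_precompact p W F \<longleftrightarrow> metric.mtotally_bounded (F // wLp_rel p W)"
    unfolding wLp_precompact_def wLp_topology_def
    using metric.mtotally_bounded_eq_compact_closure_of[OF mcomplete] sub by blast
  also have "\<dots> \<longleftrightarrow> (\<forall>e>0. \<exists>K. finite K \<and> K \<subseteq> F \<and> (\<forall>f\<in>F. \<exists>k\<in>K. wdist f k < ennreal e))"
    unfolding metric.mtotally_bounded_def
  proof (intro all_cong)
    fix e :: real assume e: "0 < e"
    have ball: "cls f \<in> metric.mball (cls k) e \<longleftrightarrow> wdist f k < ennreal e"
      if "f \<in> F" "k \<in> F" for f k
    proof -
      have "f \<in> wLp p W" "k \<in> wLp p W" using that F by auto
      then show ?thesis
        using e by (simp add: in_quotient_cls wLp_dist_less_iff wnorm_minus_commute[of k f])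
    qed
    show "(\<exists>K. finite K \<and> K \<subseteq> F // wLp_rel p W \<and> F // wLp_rel p W \<subseteq> (\<Union>x\<in>K. metric.mball x e)) \<longleftrightarrow>
      (\<exists>K. finite K \<and> K \<subseteq> F \<and> (\<forall>f\<in>F. \<exists>k\<in>K. wdist f k < ennreal e))" (is "?L \<longleftrightarrow> ?R")
    proof
      assume ?L
      then obtain K where K: "finite K" "K \<subseteq> cls ` F" "cls ` F \<subseteq> (\<Union>x\<in>K. metric.mball x e)"
        unfolding quot by blast
      then obtain K' where K': "K' \<subseteq> F" "finite K'" "K = cls ` K'"
        by (meson finite_subset_image)
      have "\<exists>k\<in>K'. wdist f k < ennreal e" if "f \<in> F" for f
      proof -
        have "cls f \<in> (\<Union>x\<in>K. metric.mball x e)" using K(3) that by blast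
        then obtain k where "k \<in> K'" "cls f \<in> metric.mball (cls k) e" unfolding K'(3) by blast
        then show ?thesis using ball[OF that, of k] K'(1) by blast
      qed
      then show ?R using K' by blast
    next
      assume ?R
      then obtain K where K: "finite K" "K \<subseteq> F" "\<And>f. f \<in> F \<Longrightarrow> \<exists>k\<in>K. wdist f k < ennreal e"
        by blast
      have "cls ` F \<subseteq> (\<Union>x\<in>cls ` K. metric.mball x e)"
      proof (rule image_subsetI)
        fix f assume f: "f \<in> F"
        obtain k where k: "k \<in> K" "wdist f k < ennreal e"
          using K(3)[OF f] by blast
        then have "cls f \<in> metric.mball (cls k) e"
          using ball[OF f, of k] K(2) by (simp add: subset_iff)
        with k(1) show "cls f \<in> (\<Union>x\<in>cls ` K. metric.mball x e)" by blast
      qed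
      then show ?L unfolding quot using K(1,2) by (intro exI[of _ "cls ` K"] conjI finite_imageI image_mono)
    qed
  qed
  finally show ?thesis .
qed

end

lemma ennreal_add_strict_right_mono: "a < b \<Longrightarrow> c < top \<Longrightarrow> a + c < b + c" for a b c :: ennreal
  using ennreal_add_left_cancel_less[of c a b] by (simp add: add.commute)

section \<open>Convolution\<close>

lemma
  fixes x :: "'a::euclidean_space" and c :: real
  assumes "c \<noteq> 0"
  shows lebesgue_affine: "lebesgue = density (distr lebesgue lebesgue (\<lambda>y. x + c *\<^sub>R y)) (\<lambda>_. ennreal (\<bar>c\<bar> ^ DIM('a)))"
    and measurable_lebesgue_affine: "(\<lambda>y. x + c *\<^sub>R y) \<in> lebesgue \<rightarrow>\<^sub>M lebesgue"
proof -
  have eq: "(\<Sum>j\<in>Basis. (c * (y \<bullet> j)) *\<^sub>R j) = c *\<^sub>R y" for y :: 'a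
    by (simp add: scaleR_sum_right[symmetric] euclidean_representation flip: scaleR_scaleR)
  show "lebesgue = density (distr lebesgue lebesgue (\<lambda>y. x + c *\<^sub>R y)) (\<lambda>_. ennreal (\<bar>c\<bar> ^ DIM('a)))"
    using lebesgue_affine_euclidean[of "\<lambda>_. c" x] assms unfolding eq by simp
  show "(\<lambda>y. x + c *\<^sub>R y) \<in> lebesgue \<rightarrow>\<^sub>M lebesgue"
    using lebesgue_affine_measurable[of "\<lambda>_. c" x] assms unfolding eq by simp
qed

text \<open>Negative factors are included on purpose: c = -1 reflects the variable in a convolution,
  and c = -1/r normalizes a reflected dilation.\<close>

lemma integral_lebesgue_affine:
  fixes F :: "'a::euclidean_space \<Rightarrow> 'b::{banach, second_countable_topology}"
  assumes F [measurable]: "F \<in> leb_borel" and "c \<noteq> 0"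
  shows "(LINT y|lebesgue. F y) = \<bar>c\<bar> ^ DIM('a) *\<^sub>R (LINT y|lebesgue. F (x + c *\<^sub>R y))"
proof -
  let ?T = "\<lambda>y. x + c *\<^sub>R y"
  have T [measurable]: "?T \<in> lebesgue \<rightarrow>\<^sub>M lebesgue"
    using assms(2) by (rule measurable_lebesgue_affine)
  have "(LINT y|lebesgue. F y) = (LINT y|density (distr lebesgue lebesgue ?T) (\<lambda>_. ennreal (\<bar>c\<bar> ^ DIM('a))). F y)"
    by (subst lebesgue_affine[OF assms(2), of x]) (rule refl)
  also have "\<dots> = (LINT y|distr lebesgue lebesgue ?T. \<bar>c\<bar> ^ DIM('a) *\<^sub>R F y)"
    by (rule integral_density) auto
  also have "\<dots> = \<bar>c\<bar> ^ DIM('a) *\<^sub>R (LINT y|lebesgue. F (?T y))"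
    by (subst integral_distr) auto
  finally show ?thesis .
qed

lemma uniformly_continuous_on_compact_support:
  fixes f :: "'a::euclidean_space \<Rightarrow> 'b::real_normed_vector"
  assumes cont: "continuous_on UNIV f" and supp: "\<And>x. R \<le> norm x \<Longrightarrow> f x = 0"
  shows "uniformly_continuous_on UNIV f"
  unfolding uniformly_continuous_on_def
proof (intro allI impI)
  fix e :: real assume "0 < e"
  \<comment> \<open>The radius exceeds R by 1 and distances are kept below 1: if one point has norm
    below R, both lie in this compact ball.\<close>
  have "uniformly_continuous_on (cball 0 (R + 1)) f"
    using cont by (intro compact_uniformly_continuous) (auto intro: continuous_on_subset)
  then obtain d where d: "0 < d" "\<And>x y. norm x \<le> R + 1 \<Longrightarrow> norm y \<le> R + 1 \<Longrightarrow> dist y x < d \<Longrightarrow> dist (f y) (f x) < e"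
    using \<open>0 < e\<close> unfolding uniformly_continuous_on_def by (metis mem_cball_0)
  show "\<exists>d>0. \<forall>x\<in>UNIV. \<forall>y\<in>UNIV. dist y x < d \<longrightarrow> dist (f y) (f x) < e"
  proof (intro exI[of _ "min d 1"] conjI ballI impI)
    fix x y :: 'a assume xy: "dist y x < min d 1"
    have near: "norm x \<le> norm y + dist y x" "norm y \<le> norm x + dist y x"
      using norm_triangle_sub[of x y] norm_triangle_sub[of y x] by (auto simp: dist_norm norm_minus_commute)
    show "dist (f y) (f x) < e"
    proof (cases "R \<le> norm x \<and> R \<le> norm y")
      case True
      then show ?thesis using supp \<open>0 < e\<close> by simp
    next
      case False
      then show ?thesis using d(2)[of x y] near xy by auto
    qed
  qed (use d in simp)
qed

abbreviation (input) L1_on :: "(real ^ 'n) set \<Rightarrow> (real ^ 'n \<Rightarrow> real ^ 'm) \<Rightarrow> ennreal" where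
  "L1_on S f \<equiv> (\<integral>\<^sup>+y. ennreal (norm (f y)) * indicator S y \<partial>lebesgue)"

text \<open>The componentwise integral defining the convolution takes the default value 0 on a
  nonintegrable integrand. Local integrability excludes this against any bounded kernel of compact
  support.\<close>

definition loc_integrable :: "(real ^ 'n \<Rightarrow> real ^ 'm) \<Rightarrow> bool" where
  "loc_integrable f \<longleftrightarrow> f \<in> leb_borel \<and>
     (\<forall>R. L1_on (cball 0 R) f < \<infinity>)"

lemma loc_integrableD:
  assumes "loc_integrable f"
  shows "f \<in> leb_borel"
    and "L1_on (cball 0 R) f < \<infinity>"
  using assms by (auto simp: loc_integrable_def)

lemma borel_measurable_continuous_lebesgue:
  fixes f :: "'a::euclidean_space \<Rightarrow> 'b::topological_space"
  assumes "continuous_on UNIV f"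
  shows "f \<in> leb_borel"
  using borel_measurable_continuous_onI[OF assms] by (simp add: measurable_completion)

lemma cball_sets_lebesgue [measurable]: "cball x R \<in> sets lebesgue" for x :: "'a::euclidean_space"
  using fmeasurableD[OF lmeasurable_cball] by blast

lemma ball_sets_lebesgue [measurable]: "ball x R \<in> sets lebesgue" for x :: "'a::euclidean_space"
  using fmeasurableD[OF lmeasurable_ball] by blast

text \<open>Only height and support are recorded, because all size estimates use nothing else; B
  will be of order r^(-n). The mass enters only when approximation is discussed.\<close>

locale kernel =
  fixes \<psi> :: "real ^ 'n \<Rightarrow> real" and r B :: real
  assumes continuous: "continuous_on UNIV \<psi>"
    and support: "\<And>x. r \<le> norm x \<Longrightarrow> \<psi> x = 0"
    and nonneg: "\<And>x. 0 \<le> \<psi> x"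
    and le_B: "\<And>x. \<psi> x \<le> B"
begin

lemma B_nonneg: "0 \<le> B"
  using nonneg[of 0] le_B[of 0] by linarith

lemma shift_measurable [measurable]: "(\<lambda>y. \<psi> (x - y)) \<in> leb_borel"
  by (intro borel_measurable_continuous_lebesgue continuous_on_compose2[OF continuous] continuous_intros) auto

lemma shift_integrand_le:
  assumes "norm x \<le> R"
  shows "ennreal (norm (\<psi> (x - y) *\<^sub>R z)) \<le> ennreal B * (ennreal (norm z) * indicator (cball 0 (R + r)) y)"
proof (cases "y \<in> cball 0 (R + r)")
  case True
  then show ?thesis
    using nonneg le_B B_nonneg by (auto intro!: ennreal_leI mult_right_mono simp flip: ennreal_mult)
next
  case False
  then have "r \<le> norm (x - y)"
    using norm_triangle_sub[of y x] assms by (simp add: norm_minus_commute)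
  then show ?thesis by (simp add: support)
qed

lemma shift_integrable:
  fixes f :: "real ^ 'n \<Rightarrow> real ^ 'm"
  assumes f: "loc_integrable f"
  shows "integrable lebesgue (\<lambda>y. \<psi> (x - y) *\<^sub>R f y)"
proof (rule integrableI_bounded)
  have [measurable]: "f \<in> leb_borel" using f by (rule loc_integrableD)
  show "(\<lambda>y. \<psi> (x - y) *\<^sub>R f y) \<in> leb_borel" by measurable
  have "(\<integral>\<^sup>+y. norm (\<psi> (x - y) *\<^sub>R f y) \<partial>lebesgue)
    \<le> (\<integral>\<^sup>+y. ennreal B * (ennreal (norm (f y)) * indicator (cball 0 (norm x + r)) y) \<partial>lebesgue)"
    by (intro nn_integral_mono shift_integrand_le) simp
  also have "\<dots> < \<infinity>"
    using loc_integrableD(2)[OF f, of "norm x + r"] by (subst nn_integral_cmult) (auto simp: ennreal_mult_less_top)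
  finally show "(\<integral>\<^sup>+y. norm (\<psi> (x - y) *\<^sub>R f y) \<partial>lebesgue) < \<infinity>" .
qed

text \<open>The reflection puts the translation on the continuous factor and gathers the components
  into one vector-valued integral, to which norms and matrices can be applied.\<close>

lemma convolution_eq:
  fixes f :: "real ^ 'n \<Rightarrow> real ^ 'm"
  assumes f: "loc_integrable f"
  shows "convolution f \<psi> x = (LINT y|lebesgue. \<psi> (x - y) *\<^sub>R f y)"
proof -
  have [measurable]: "f \<in> leb_borel" using f by (rule loc_integrableD)
  have "(LINT y|lebesgue. f (x - y) $ i * \<psi> y) = (LINT y|lebesgue. \<psi> (x - y) *\<^sub>R f y) $ i" for i
  proof -
    have "(LINT y|lebesgue. f (x - y) $ i * \<psi> y)
      = (LINT y|lebesgue. (\<lambda>z. \<psi> (x - z) * f z $ i) (x + (-1) *\<^sub>R y))"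
      by (simp add: mult.commute)
    also have "\<dots> = (LINT z|lebesgue. \<psi> (x - z) * f z $ i)"
      using integral_lebesgue_affine[of "\<lambda>z. \<psi> (x - z) * f z $ i" "-1" x] by simp
    also have "\<dots> = (LINT y|lebesgue. (\<psi> (x - y) *\<^sub>R f y) $ i)" by simp
    also have "\<dots> = (LINT y|lebesgue. \<psi> (x - y) *\<^sub>R f y) $ i"
      by (rule integral_bounded_linear[OF bounded_linear_vec_nth shift_integrable[OF f]])
    finally show ?thesis .
  qed
  then show ?thesis by (simp add: convolution_def vec_eq_iff)
qed

lemma convolution_diff:
  assumes "loc_integrable f" "loc_integrable g" "loc_integrable (\<lambda>x. f x - g x)"
  shows "convolution (\<lambda>x. f x - g x) \<psi> x = convolution f \<psi> x - convolution g \<psi> x"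
  using assms by (simp add: convolution_eq scaleR_diff_right shift_integrable)

lemma norm_convolution_le:
  assumes f: "loc_integrable f" and "norm x \<le> R"
  shows "ennreal (norm (convolution f \<psi> x))
    \<le> ennreal B * L1_on (cball 0 (R + r)) f"
proof -
  have [measurable]: "f \<in> leb_borel" using f by (rule loc_integrableD)
  have "ennreal (norm (convolution f \<psi> x)) \<le> (\<integral>\<^sup>+y. norm (\<psi> (x - y) *\<^sub>R f y) \<partial>lebesgue)"
    unfolding convolution_eq[OF f] by (rule integral_norm_bound_ennreal[OF shift_integrable[OF f]])
  also have "\<dots> \<le> (\<integral>\<^sup>+y. ennreal B * (ennreal (norm (f y)) * indicator (cball 0 (R + r)) y) \<partial>lebesgue)"
    using assms(2) by (intro nn_integral_mono shift_integrand_le)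
  also have "\<dots> = ennreal B * L1_on (cball 0 (R + r)) f"
    by (rule nn_integral_cmult) measurable
  finally show ?thesis .
qed

text \<open>A constant matrix passes through the integral. It is used with A = W(x) at the very
  point x, so that the weight is frozen while y varies.\<close>

lemma matrix_convolution_le:
  fixes A :: "real ^ 'm ^ 'k"
  assumes f: "loc_integrable f"
  shows "ennreal (norm (A *v convolution f \<psi> x)) \<le> (\<integral>\<^sup>+y. ennreal (\<psi> (x - y)) * ennreal (norm (A *v f y)) \<partial>lebesgue)"
proof -
  note int = shift_integrable[OF f, of x]
  have lin: "bounded_linear ((*v) A)" by simp
  have "A *v convolution f \<psi> x = (LINT y|lebesgue. A *v (\<psi> (x - y) *\<^sub>R f y))"
    unfolding convolution_eq[OF f] by (rule integral_bounded_linear[OF lin int, symmetric])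
  then have "ennreal (norm (A *v convolution f \<psi> x)) \<le> (\<integral>\<^sup>+y. norm (A *v (\<psi> (x - y) *\<^sub>R f y)) \<partial>lebesgue)"
    using integral_norm_bound_ennreal[OF integrable_bounded_linear[OF lin int]] by simp
  also have "\<dots> = (\<integral>\<^sup>+y. ennreal (\<psi> (x - y)) * ennreal (norm (A *v f y)) \<partial>lebesgue)"
    using nonneg by (intro nn_integral_cong) (simp add: matrix_vector_mult_scaleR abs_of_nonneg flip: ennreal_mult)
  finally show ?thesis .
qed

text \<open>The number d comes from uniform continuity of the kernel alone, and f contributes only
  through its local L^1 norm. This is what makes a bounded family equicontinuous.\<close>

lemma convolution_equicontinuous:
  assumes "0 < e"
  obtains d where "0 < d" "\<And>(f :: real ^ 'n \<Rightarrow> real ^ 'm) x y. loc_integrable f \<Longrightarrow> norm x \<le> R \<Longrightarrow> norm y \<le> R \<Longrightarrow> norm (x - y) < d \<Longrightarrow>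
    ennreal (norm (convolution f \<psi> x - convolution f \<psi> y))
      \<le> ennreal e * L1_on (cball 0 (R + r)) f"
proof -
  have "uniformly_continuous_on UNIV \<psi>"
    by (rule uniformly_continuous_on_compact_support[OF continuous support])
  then obtain d where d: "0 < d" "\<And>u v. dist v u < d \<Longrightarrow> dist (\<psi> v) (\<psi> u) < e"
    using assms unfolding uniformly_continuous_on_def by (metis UNIV_I)
  have "ennreal (norm (convolution f \<psi> x - convolution f \<psi> y))
      \<le> ennreal e * L1_on (cball 0 (R + r)) f"
    if f: "loc_integrable f" and xy: "norm x \<le> R" "norm y \<le> R" "norm (x - y) < d"
    for f :: "real ^ 'n \<Rightarrow> real ^ 'm" and x y
  proof -
    have [measurable]: "f \<in> leb_borel" using f by (rule loc_integrableD)
    have "convolution f \<psi> x - convolution f \<psi> y = (LINT z|lebesgue. \<psi> (x - z) *\<^sub>R f z - \<psi> (y - z) *\<^sub>R f z)"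
      unfolding convolution_eq[OF f]
      by (rule Bochner_Integration.integral_diff[OF shift_integrable[OF f] shift_integrable[OF f], symmetric])
    then have "ennreal (norm (convolution f \<psi> x - convolution f \<psi> y))
      \<le> (\<integral>\<^sup>+z. norm (\<psi> (x - z) *\<^sub>R f z - \<psi> (y - z) *\<^sub>R f z) \<partial>lebesgue)"
      using integral_norm_bound_ennreal[OF Bochner_Integration.integrable_diff[OF shift_integrable[OF f, of x] shift_integrable[OF f, of y]]]
      by simp
    also have "\<dots> \<le> (\<integral>\<^sup>+z. ennreal e * (ennreal (norm (f z)) * indicator (cball 0 (R + r)) z) \<partial>lebesgue)"
    proof (rule nn_integral_mono)
      fix z
      show "ennreal (norm (\<psi> (x - z) *\<^sub>R f z - \<psi> (y - z) *\<^sub>R f z))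
        \<le> ennreal e * (ennreal (norm (f z)) * indicator (cball 0 (R + r)) z)"
      proof (cases "z \<in> cball 0 (R + r)")
        case True
        have "dist (x - z) (y - z) < d" using xy by (simp add: dist_norm)
        then have "\<bar>\<psi> (x - z) - \<psi> (y - z)\<bar> \<le> e"
          using d(2) by (fastforce simp: dist_real_def)
        then have "norm ((\<psi> (x - z) - \<psi> (y - z)) *\<^sub>R f z) \<le> e * norm (f z)"
          by (simp add: mult_right_mono)
        then show ?thesis
          using True assms by (auto simp: scaleR_diff_left intro!: ennreal_leI simp flip: ennreal_mult)
      next
        case False
        then have "r \<le> norm (x - z)" "r \<le> norm (y - z)"
          using norm_triangle_sub[of z x] norm_triangle_sub[of z y] xy by (auto simp: norm_minus_commute)
        then show ?thesis by (simp add: support)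
      qed
    qed
    also have "\<dots> = ennreal e * L1_on (cball 0 (R + r)) f"
      by (rule nn_integral_cmult) measurable
    finally show ?thesis .
  qed
  with d(1) show ?thesis by (rule that)
qed

lemma continuous_convolution:
  fixes f :: "real ^ 'n \<Rightarrow> real ^ 'm"
  assumes f: "loc_integrable f"
  shows "continuous_on UNIV (convolution f \<psi>)"
proof (rule continuous_onI)
  fix x :: "real ^ 'n" and e :: real assume e: "0 < e"
  let ?R = "norm x + 1"
  obtain I where I: "0 \<le> I" "L1_on (cball 0 (?R + r)) f = ennreal I"
    using loc_integrableD(2)[OF f, of "?R + r"]
    by (cases "L1_on (cball 0 (?R + r)) f") auto
  have "0 < e / (I + 1)" using e I by simp
  then obtain d where d: "0 < d" "\<And>(f :: real ^ 'n \<Rightarrow> real ^ 'm) x y. loc_integrable f \<Longrightarrow> norm x \<le> ?R \<Longrightarrow> norm y \<le> ?R \<Longrightarrow> norm (x - y) < d \<Longrightarrow>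
    ennreal (norm (convolution f \<psi> x - convolution f \<psi> y))
      \<le> ennreal (e / (I + 1)) * L1_on (cball 0 (?R + r)) f"
    by (rule convolution_equicontinuous) blast
  show "\<exists>d>0. \<forall>y\<in>UNIV. dist y x < d \<longrightarrow> dist (convolution f \<psi> y) (convolution f \<psi> x) \<le> e"
  proof (intro exI[of _ "min d 1"] conjI ballI impI)
    fix y assume y: "dist y x < min d 1"
    then have "norm y \<le> ?R" "norm (y - x) < d"
      using norm_triangle_sub[of y x] by (auto simp: dist_norm)
    then have "ennreal (norm (convolution f \<psi> y - convolution f \<psi> x)) \<le> ennreal (e / (I + 1)) * ennreal I"
      using d(2)[OF f, of y x] I(2) by simp
    also have "\<dots> = ennreal (e / (I + 1) * I)"
      using e I by (intro ennreal_mult[symmetric]) auto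
    finally have "norm (convolution f \<psi> y - convolution f \<psi> x) \<le> e / (I + 1) * I"
      using e I by (simp add: ennreal_le_iff)
    also have "\<dots> \<le> e" using e I by (simp add: field_simps)
    finally show "dist (convolution f \<psi> y) (convolution f \<psi> x) \<le> e" by (simp add: dist_norm)
  qed (use d in simp)
qed

lemma convolution_measurable:
  "loc_integrable f \<Longrightarrow> convolution f \<psi> \<in> leb_borel"
  by (rule borel_measurable_continuous_lebesgue[OF continuous_convolution])

end

section \<open>Local bounds and the sufficiency of the three conditions\<close>

context Ap_weight
begin

text \<open>Using \<open>\<bar>R\<bar> + 1\<close> keeps the side positive for every real R, so no
  sign condition has to be carried along.\<close>

definition cube0 :: "real \<Rightarrow> (real ^ 'n) set" where
  "cube0 R = cbox (\<chi> i. - (\<bar>R\<bar> + 1)) (\<chi> i. \<bar>R\<bar> + 1)"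

lemma cube0_in_cubes: "cube0 R \<in> cubes"
  unfolding cubes_def cube0_def
  by (intro CollectI exI[of _ "\<chi> i. - (\<bar>R\<bar> + 1)"] exI[of _ "2 * (\<bar>R\<bar> + 1)"] conjI)
    (auto simp: vec_eq_iff intro!: arg_cong2[of _ _ _ _ cbox])

lemma cball_subset_cube0: "cball 0 R \<subseteq> cube0 R"
proof
  fix x :: "real ^ 'n" assume "x \<in> cball 0 R"
  then have "\<bar>x $ i\<bar> \<le> R" for i using component_le_norm_cart[of x i] by simp
  then have "- (\<bar>R\<bar> + 1) \<le> x $ i \<and> x $ i \<le> \<bar>R\<bar> + 1" for i
    by (smt (verit))
  then show "x \<in> cube0 R" by (auto simp: cube0_def mem_box_cart)
qed

text \<open>This is the embedding into local L^1. The constant is twice the local norm of W^-1, from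
  Hoelder's inequality, plus 1 for positivity.\<close>

lemma W_inv_bound:
  obtains K where "0 < K" "\<And>f. f \<in> leb_borel \<Longrightarrow>
    L1_on (cball 0 R) f \<le> ennreal K * wn f"
proof -
  define L where "L = lux_norm p' (\<lambda>y. ennreal (onorm ((*v) (matrix_inv (W y)))) * indicator (cube0 R) y)"
  have "L < \<infinity>" unfolding L_def by (rule lux_norm_matrix_inv_W_finite[OF cube0_in_cubes])
  then obtain l where l: "0 \<le> l" "L = ennreal l" by (cases L) auto
  have "L1_on (cball 0 R) f \<le> ennreal (2 * l + 1) * wn f"
    if f: "f \<in> leb_borel" for f :: "real ^ 'n \<Rightarrow> real ^ 'm"
  proof -
    have "L1_on (cball 0 R) f
      \<le> L1_on (cube0 R) f"
      using cball_subset_cube0[of R] by (intro nn_integral_mono) (auto split: split_indicator)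
    also have "\<dots> \<le> 2 * wn f * L"
      unfolding L_def by (rule nn_integral_norm_le[OF f cube0_in_cubes])
    also have "\<dots> = ennreal (2 * l) * wn f"
      using l by (simp add: ennreal_mult mult_ac)
    also have "\<dots> \<le> ennreal (2 * l + 1) * wn f"
      by (intro mult_right_mono ennreal_leI) auto
    finally show ?thesis .
  qed
  with l show ?thesis by (intro that[of "2 * l + 1"]) auto
qed

text \<open>The counterpart for W: on a fixed ball, uniform smallness of a function implies
  smallness in the weighted norm.\<close>

lemma W_bound:
  obtains L where "0 < L" "\<And>f c. 0 < c \<Longrightarrow> (\<And>x. norm (f x) \<le> c * indicator (cball 0 R) x) \<Longrightarrow>
    wn f \<le> ennreal (c * L)"
proof -
  let ?g = "\<lambda>x. ennreal (onorm ((*v) (W x))) * indicator (cube0 R) x"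
  have "lux_norm p ?g < \<infinity>" by (rule lux_norm_W_finite[OF cube0_in_cubes])
  then obtain l where l: "0 \<le> l" "lux_norm p ?g = ennreal l" by (cases "lux_norm p ?g") auto
  have "wn f \<le> ennreal (c * (l + 1))"
    if c: "0 < c" and f: "\<And>x. norm (f x) \<le> c * indicator (cball 0 R) x" for f :: "real ^ 'n \<Rightarrow> real ^ 'm" and c
  proof -
    have "wn f \<le> lux_norm p (\<lambda>x. ennreal c * ?g x)"
      unfolding wnorm_def
    proof (rule p.lux_norm_mono)
      fix x
      show "ennreal (norm (W x *v f x)) \<le> ennreal c * ?g x"
      proof (cases "x \<in> cball 0 R")
        case True
        then have "norm (W x *v f x) \<le> onorm ((*v) (W x)) * c"
          using f[of x] norm_matrix_vector_le[of "W x" "f x"]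
          by (auto elim!: order_trans intro!: mult_left_mono)
        then show ?thesis using True c cball_subset_cube0[of R]
          by (auto simp: subset_iff mult.commute intro!: ennreal_leI simp flip: ennreal_mult)
      next
        case False
        then show ?thesis using f[of x] by simp
      qed
    qed
    also have "\<dots> = ennreal (c * l)"
      using c l by (simp add: p.lux_norm_cmult ennreal_mult)
    also have "\<dots> \<le> ennreal (c * (l + 1))"
      using c by (intro ennreal_leI) simp
    finally show ?thesis .
  qed
  with l show ?thesis by (intro that[of "l + 1"]) auto
qed

lemma wLp_loc_integrable:
  assumes "f \<in> wLp p W" shows "loc_integrable f"
  unfolding loc_integrable_def
proof (intro conjI allI)
  show f: "f \<in> leb_borel" using assms by (rule wLpD)
  fix R
  obtain K where K: "0 < K" "\<And>f. f \<in> leb_borel \<Longrightarrow>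
    L1_on (cball 0 R) f \<le> ennreal K * wn f"
    by (rule W_inv_bound[of R]) blast
  show "L1_on (cball 0 R) f < \<infinity>"
    using K(2)[OF f] wLpD(2)[OF assms] by (auto simp: ennreal_mult_less_top intro: le_less_trans)
qed

text \<open>Without a finite net there is an infinite e-separated sequence. Its mollifications have
  a subsequence converging uniformly on the ball, and two late members turn out to be too close. The
  distance is split into three parts of e/3; each outer one is e/6 for the tail plus e/6 for the
  mollification.\<close>

lemma totally_bounded_if_approximable:
  assumes F: "F \<subseteq> wLp p W" and bdd: "(SUP f\<in>F. wn f) < \<infinity>" and e: "0 < e"
    and "kernel \<psi> r B" and R: "0 < R"
    and approx: "\<And>f. f \<in> F \<Longrightarrow> wdist (convolution f \<psi>) f \<le> ennreal (e / 6)"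
    and vanish: "\<And>f. f \<in> F \<Longrightarrow> wtail R f < ennreal (e / 6)"
  shows "\<exists>K. finite K \<and> K \<subseteq> F \<and> (\<forall>f\<in>F. \<exists>k\<in>K. wdist f k < ennreal e)"
proof (rule ccontr)
  interpret kernel \<psi> r B by fact
  assume none: "\<not> ?thesis"
  \<comment> \<open>The sequence is built recursively: the finitely many earlier terms are not a
    net, so some member of F is far from all of them.\<close>
  have "\<exists>\<sigma>. \<forall>n::nat. \<sigma> n \<in> F \<and> (\<forall>m<n. \<not> wdist (\<sigma> n) (\<sigma> m) < ennreal e)"
  proof (rule dependent_wellorder_choice)
    fix n :: nat and \<sigma> assume *: "\<And>y. y < n \<Longrightarrow> \<sigma> y \<in> F \<and> (\<forall>m<y. \<not> wdist (\<sigma> y) (\<sigma> m) < ennreal e)"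
    then have sub: "\<sigma> ` {..<n} \<subseteq> F" by auto
    have "\<not> (finite K \<and> K \<subseteq> F \<and> (\<forall>f\<in>F. \<exists>k\<in>K. wdist f k < ennreal e))" for K
      using none by (rule contrapos_nn) (rule exI)
    from this[of "\<sigma> ` {..<n}"] sub
    obtain f where "f \<in> F" "\<forall>k\<in>\<sigma> ` {..<n}. \<not> wdist f k < ennreal e"
      by (simp only: finite_imageI finite_lessThan simp_thms) fast
    then show "\<exists>f. f \<in> F \<and> (\<forall>m<n. \<not> wdist f (\<sigma> m) < ennreal e)"
      by (intro exI[of _ f]) auto
  qed auto
  then obtain \<sigma> where *: "\<forall>n::nat. \<sigma> n \<in> F \<and> (\<forall>m<n. \<not> wdist (\<sigma> n) (\<sigma> m) < ennreal e)" ..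
  have \<sigma>: "\<sigma> n \<in> F" for n using * by simp
  have sep: "\<not> wdist (\<sigma> n) (\<sigma> m) < ennreal e" if "m < n" for m n
    using * that by simp
  obtain C where C: "0 \<le> C" "(SUP f\<in>F. wn f) = ennreal C"
    using bdd by (cases "SUP f\<in>F. wn f") auto
  have F_loc: "loc_integrable f" and F_le: "wn f \<le> ennreal C" if "f \<in> F" for f
    using that F C(2) SUP_upper[OF that, of "wn"] wLp_loc_integrable by auto
  obtain K where K: "0 < K" "\<And>f. f \<in> leb_borel \<Longrightarrow>
    L1_on (cball 0 (R + r)) f \<le> ennreal K * wn f"
    by (rule W_inv_bound[of "R + r"]) blast
  have int_le: "L1_on (cball 0 (R + r)) f \<le> ennreal (K * C)"
    if "f \<in> F" for f
    using K(2)[OF loc_integrableD(1)[OF F_loc[OF that]]] mult_left_mono[OF F_le[OF that], of "ennreal K"] K(1) C(1)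
    by (auto simp: ennreal_mult intro: order_trans)
  obtain g k where k: "strict_mono (k :: nat \<Rightarrow> nat)"
    and g: "\<And>e. 0 < e \<Longrightarrow> \<exists>N. \<forall>n x. n \<ge> N \<and> x \<in> cball 0 R \<longrightarrow> norm (convolution (\<sigma> (k n)) \<psi> x - g x) < e"
  proof (rule Arzela_Ascoli[of "cball 0 R" "\<lambda>n. convolution (\<sigma> n) \<psi>" "B * (K * C)"])
    fix n and x :: "real ^ 'n" assume "x \<in> cball 0 R"
    then have "ennreal (norm (convolution (\<sigma> n) \<psi> x)) \<le> ennreal B * ennreal (K * C)"
      using norm_convolution_le[OF F_loc[OF \<sigma>[of n]], of x R] mult_left_mono[OF int_le[OF \<sigma>[of n]], of "ennreal B"]
      by (auto intro: order_trans)
    also have "\<dots> = ennreal (B * (K * C))"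
      using B_nonneg K(1) C(1) by (simp add: ennreal_mult)
    finally show "norm (convolution (\<sigma> n) \<psi> x) \<le> B * (K * C)"
      using B_nonneg K(1) C(1) by (simp add: ennreal_le_iff)
  next
    fix x :: "real ^ 'n" and e' :: real assume x: "x \<in> cball 0 R" and e': "0 < e'"
    have pos: "0 < e' / (K * C + 1)" using e' K(1) C(1) by (intro divide_pos_pos add_nonneg_pos) auto
    obtain d where d: "0 < d" "\<And>(f :: real ^ 'n \<Rightarrow> real ^ 'm) x y. loc_integrable f \<Longrightarrow> norm x \<le> R \<Longrightarrow> norm y \<le> R \<Longrightarrow> norm (x - y) < d \<Longrightarrow>
      ennreal (norm (convolution f \<psi> x - convolution f \<psi> y))
        \<le> ennreal (e' / (K * C + 1)) * L1_on (cball 0 (R + r)) f"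
      by (rule convolution_equicontinuous[OF pos]) blast
    show "\<exists>d>0. \<forall>n y. y \<in> cball 0 R \<and> norm (x - y) < d
      \<longrightarrow> norm (convolution (\<sigma> n) \<psi> x - convolution (\<sigma> n) \<psi> y) < e'"
    proof (intro exI[of _ d] conjI allI impI)
      fix n y assume y: "y \<in> cball 0 R \<and> norm (x - y) < d"
      have "ennreal (norm (convolution (\<sigma> n) \<psi> x - convolution (\<sigma> n) \<psi> y))
        \<le> ennreal (e' / (K * C + 1)) * L1_on (cball 0 (R + r)) (\<sigma> n)"
        using x y by (intro d(2) F_loc \<sigma>) auto
      also have "\<dots> \<le> ennreal (e' / (K * C + 1)) * ennreal (K * C)"
        by (intro mult_left_mono int_le \<sigma>) simp
      also have "\<dots> = ennreal (e' / (K * C + 1) * (K * C))"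
        using pos K(1) C(1) by (intro ennreal_mult[symmetric]) auto
      finally have "norm (convolution (\<sigma> n) \<psi> x - convolution (\<sigma> n) \<psi> y) \<le> e' / (K * C + 1) * (K * C)"
        using e' K(1) C(1) by (subst (asm) ennreal_le_iff) auto
      also have "\<dots> < e' / (K * C + 1) * (K * C + 1)"
        using pos by (intro mult_strict_left_mono) auto
      also have "\<dots> = e'"
        using pos by (cases "K * C + 1 = 0") auto
      finally show "norm (convolution (\<sigma> n) \<psi> x - convolution (\<sigma> n) \<psi> y) < e'" .
    qed (rule d)
  qed auto
  obtain L where L: "0 < L" "\<And>f c. 0 < c \<Longrightarrow> (\<And>x. norm (f x) \<le> c * indicator (cball 0 R) x) \<Longrightarrow>
    wn f \<le> ennreal (c * L)"
    by (rule W_bound[of R]) blast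
  \<comment> \<open>Two functions within \<delta> of a common limit differ by at most 2\<delta>,
    which costs 2\<delta>L = e/3 in the weighted norm.\<close>
  define \<delta> where "\<delta> = e / (6 * L)"
  have \<delta>: "0 < \<delta>" "2 * \<delta> * L = e / 3" using e L(1) by (auto simp: \<delta>_def)
  obtain N where N: "\<And>n x. n \<ge> N \<Longrightarrow> x \<in> cball 0 R \<Longrightarrow> norm (convolution (\<sigma> (k n)) \<psi> x - g x) < \<delta>"
    using g[OF \<delta>(1)] by blast
  define f1 f2 where "f1 = \<sigma> (k (Suc N))" and "f2 = \<sigma> (k N)"
  have f12: "f1 \<in> F" "f2 \<in> F" using \<sigma> by (auto simp: f1_def f2_def)
  \<comment> \<open>The mollification is cut to the open ball, the exact complement of the region
    where the tail of f is measured. Uniform convergence is available on the closed ball, which is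
    compact.\<close>
  define T where "T f x = indicator (ball 0 R) x *\<^sub>R convolution f \<psi> x" for f :: "real ^ 'n \<Rightarrow> real ^ 'm" and x
  have conv_meas [measurable]: "convolution f \<psi> \<in> leb_borel" if "f \<in> F" for f
    using F_loc[OF that] by (rule convolution_measurable)
  have T_meas [measurable]: "T f \<in> leb_borel" if "f \<in> F" for f
    unfolding T_def using that by measurable
  have F_meas: "f \<in> leb_borel" if "f \<in> F" for f
    using loc_integrableD(1)[OF F_loc[OF that]] .
  have T_approx: "wdist f (T f) < ennreal (e / 3)" if f: "f \<in> F" for f
  proof -
    have [measurable]: "f \<in> leb_borel" "convolution f \<psi> \<in> leb_borel"
      using f by (auto intro: F_meas conv_meas)
    have "(\<lambda>x. f x - T f x) = (\<lambda>x. indicator (- ball 0 R) x *\<^sub>R f x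
        + indicator (ball 0 R) x *\<^sub>R (f x - convolution f \<psi> x))"
      by (auto simp: T_def fun_eq_iff split: split_indicator)
    then have "wdist f (T f) \<le> wtail R f
        + wn (\<lambda>x. indicator (ball 0 R) x *\<^sub>R (f x - convolution f \<psi> x))"
      by (simp only:) (rule wnorm_triangle; measurable)
    also have "wn (\<lambda>x. indicator (ball 0 R) x *\<^sub>R (f x - convolution f \<psi> x))
        \<le> wdist f (convolution f \<psi>)"
      by (rule wnorm_mono) (simp split: split_indicator)
    also have "\<dots> \<le> ennreal (e / 6)"
      using approx[OF f] by (subst wnorm_minus_commute)
    finally have "wdist f (T f) \<le> wtail R f + ennreal (e / 6)"
      by (simp add: add_left_mono)
    \<comment> \<open>The strictness needed for the final contradiction is supplied by the tail
      bound.\<close>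
    also have "\<dots> < ennreal (e / 6) + ennreal (e / 6)"
      using vanish[OF f] by (intro ennreal_add_strict_right_mono) auto
    also have "\<dots> = ennreal (e / 3)" using e by (simp flip: ennreal_plus)
    finally show ?thesis .
  qed
  have "wdist (T f1) (T f2) \<le> ennreal (2 * \<delta> * L)"
  proof (rule L(2))
    show "norm (T f1 x - T f2 x) \<le> 2 * \<delta> * indicator (cball 0 R) x" for x
    proof (cases "x \<in> ball 0 R")
      case True
      then have "norm (convolution f1 \<psi> x - g x) < \<delta>" "norm (convolution f2 \<psi> x - g x) < \<delta>"
        using N[of "Suc N" x] N[of N x] by (auto simp: f1_def f2_def)
      then show ?thesis
        using True norm_triangle_ineq4[of "convolution f1 \<psi> x - g x" "convolution f2 \<psi> x - g x"]
        by (simp add: T_def)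
    qed (use \<delta> in \<open>auto simp: T_def\<close>)
  qed (use \<delta> in simp)
  then have mid: "wdist (T f1) (T f2) \<le> ennreal (e / 3)" using \<delta> by simp
  have "wdist f1 f2 \<le> wdist f1 (T f1) + wdist (T f1) f2"
    using f12 by (intro wnorm_diff_triangle F_meas T_meas)
  also have "wdist (T f1) f2 \<le> wdist (T f1) (T f2) + wdist (T f2) f2"
    using f12 by (intro wnorm_diff_triangle F_meas T_meas)
  also have "\<dots> \<le> ennreal (e / 3) + ennreal (e / 3)"
    using mid T_approx[OF f12(2)] wnorm_minus_commute[of "T f2" f2] by (intro add_mono) auto
  finally have "wdist f1 f2 \<le> wdist f1 (T f1) + (ennreal (e / 3) + ennreal (e / 3))"
    by (simp add: add_left_mono)
  also have "\<dots> < ennreal (e / 3) + (ennreal (e / 3) + ennreal (e / 3))"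
    using T_approx[OF f12(1)] by (intro ennreal_add_strict_right_mono) auto
  also have "\<dots> = ennreal e" using e by (simp flip: ennreal_plus)
  finally show False
    using sep[of "k N" "k (Suc N)"] k by (auto simp: f1_def f2_def strict_mono_Suc_iff)
qed

end

section \<open>Localization to cubes of equal size\<close>

text \<open>Half-open cells tile the space without overlap; the tripled ones below are closed
  because they have to belong to \<open>cubes\<close>.\<close>

definition cell :: "real \<Rightarrow> int ^ 'n \<Rightarrow> (real ^ 'n) set" where
  "cell r k = {x. \<forall>i. r * of_int (k $ i) \<le> x $ i \<and> x $ i < r * (of_int (k $ i) + 1)}"

definition big_cell :: "real \<Rightarrow> int ^ 'n \<Rightarrow> (real ^ 'n) set" where
  "big_cell r k = cbox (\<chi> i. r * (of_int (k $ i) - 1)) (\<chi> i. r * (of_int (k $ i) + 2))"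

lemma mem_cell_iff:
  assumes "0 < r" shows "x \<in> cell r k \<longleftrightarrow> k = (\<chi> i. \<lfloor>x $ i / r\<rfloor>)"
proof -
  have "(r * of_int m \<le> z \<and> z < r * (of_int m + 1)) \<longleftrightarrow> m = \<lfloor>z / r\<rfloor>" for m z
    using assms by (auto simp: eq_commute[of m] floor_eq_iff field_simps)
  then show ?thesis by (simp add: cell_def vec_eq_iff)
qed

lemma cell_sets [measurable]: "cell r k \<in> sets lebesgue"
proof -
  have [measurable]: "(\<lambda>x :: real ^ 'a. x) \<in> leb_borel"
    by (intro borel_measurable_continuous_lebesgue continuous_intros)
  have "{x \<in> space lebesgue. \<forall>i. r * of_int (k $ i) \<le> x $ i \<and> x $ i < r * (of_int (k $ i) + 1)} \<in> sets lebesgue"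
    by measurable
  then show ?thesis by (simp add: cell_def)
qed

lemma big_cell_sets [measurable]: "big_cell r k \<in> sets lebesgue"
  by (simp add: big_cell_def)

lemma big_cell_in_cubes: "0 < r \<Longrightarrow> big_cell r k \<in> cubes"
  unfolding cubes_def big_cell_def
  by (intro CollectI exI[of _ "\<chi> i. r * (of_int (k $ i) - 1)"] exI[of _ "3 * r"] conjI arg_cong2[of _ _ _ _ cbox])
    (auto simp: vec_eq_iff algebra_simps)

lemma prod_Basis_cart_const: "(\<Prod>j\<in>(Basis :: (real ^ 'n) set). (\<chi> i. c) \<bullet> j) = c ^ CARD('n)"
proof -
  have "(\<Prod>j\<in>Basis. (\<chi> i. c) \<bullet> (j :: real ^ 'n)) = (\<Prod>j\<in>(Basis :: (real ^ 'n) set). c)"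
    by (intro prod.cong) (auto simp: Basis_vec_def inner_axis)
  then show ?thesis by simp
qed

lemma emeasure_big_cell:
  fixes k :: "int ^ 'n"
  assumes "0 < r" shows "emeasure lebesgue (big_cell r k) = ennreal ((3 * r) ^ CARD('n))"
proof -
  have eq: "(\<chi> i. r * (of_int (k $ i) + 2)) - (\<chi> i. r * (of_int (k $ i) - 1)) = (\<chi> i. 3 * r)"
    by (simp add: vec_eq_iff algebra_simps)
  have "emeasure lborel (big_cell r k) = ennreal (\<Prod>j\<in>Basis. ((\<chi> i. r * (of_int (k $ i) + 2)) - (\<chi> i. r * (of_int (k $ i) - 1))) \<bullet> j)"
    unfolding big_cell_def using assms by (intro emeasure_lborel_cbox) (auto simp: Basis_vec_def inner_axis algebra_simps)
  then show ?thesis unfolding eq prod_Basis_cart_const by (simp add: big_cell_def)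
qed

lemma emeasure_cell_ge:
  fixes k :: "int ^ 'n"
  assumes "0 < r" shows "ennreal (r ^ CARD('n)) \<le> emeasure lebesgue (cell r k)"
proof -
  let ?B = "box (\<chi> i. r * of_int (k $ i)) (\<chi> i. r * (of_int (k $ i) + 1))"
  have eq: "(\<chi> i. r * (of_int (k $ i) + 1)) - (\<chi> i. r * of_int (k $ i)) = (\<chi> i. r)"
    by (simp add: vec_eq_iff algebra_simps)
  have "emeasure lborel ?B = ennreal (\<Prod>j\<in>Basis. ((\<chi> i. r * (of_int (k $ i) + 1)) - (\<chi> i. r * of_int (k $ i))) \<bullet> j)"
    using assms by (intro emeasure_lborel_box) (auto simp: Basis_vec_def inner_axis)
  then have "ennreal (r ^ CARD('n)) = emeasure lebesgue ?B"
    unfolding eq prod_Basis_cart_const by simp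
  also have "\<dots> \<le> emeasure lebesgue (cell r k)"
    by (intro emeasure_mono cell_sets) (auto simp: cell_def mem_box_cart less_imp_le)
  finally show ?thesis .
qed

text \<open>Each coordinate differs by at most 2r, and the sum of coordinates bounds the norm. This
  is the origin of the condition 4nr < 1 further on: it keeps such distances below 1/2, where the
  local log-Hoelder condition applies.\<close>

lemma norm_diff_cell_le:
  fixes x :: "real ^ 'n"
  assumes "x \<in> cell r k" "y \<in> big_cell r k" "0 < r"
  shows "norm (x - y) \<le> 2 * real CARD('n) * r"
proof -
  have "\<bar>x $ i - y $ i\<bar> \<le> 2 * r" for i
  proof -
    have "r * of_int (k $ i) \<le> x $ i" "x $ i < r * (of_int (k $ i) + 1)"
      "r * (of_int (k $ i) - 1) \<le> y $ i" "y $ i \<le> r * (of_int (k $ i) + 2)"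
      using assms by (auto simp: cell_def big_cell_def mem_box_cart)
    then show ?thesis using assms(3) unfolding abs_le_iff by (simp add: algebra_simps)
  qed
  then have "(\<Sum>i\<in>UNIV. \<bar>(x - y) $ i\<bar>) \<le> (\<Sum>i\<in>(UNIV :: 'n set). 2 * r)"
    by (intro sum_mono) simp
  then show ?thesis using norm_le_l1_cart[of "x - y"] by simp
qed

text \<open>A kernel supported in the ball of radius r therefore sees only the tripled cell when its
  centre lies in the cell.\<close>

lemma mem_big_cell_if_near:
  assumes "x \<in> cell r k" "norm (x - y) < r"
  shows "y \<in> big_cell r k"
proof -
  have "r * (of_int (k $ i) - 1) \<le> y $ i \<and> y $ i \<le> r * (of_int (k $ i) + 2)" for i
  proof -
    have "r * of_int (k $ i) \<le> x $ i" "x $ i < r * (of_int (k $ i) + 1)"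
      using assms by (auto simp: cell_def)
    moreover have "\<bar>x $ i - y $ i\<bar> < r"
      using component_le_norm_cart[of "x - y" i] assms(2) by simp
    ultimately show ?thesis by (simp add: algebra_simps abs_less_iff)
  qed
  then show ?thesis by (simp add: big_cell_def mem_box_cart)
qed

lemma cell_subset_big_cell: "0 < r \<Longrightarrow> cell r k \<subseteq> big_cell r k"
  using mem_big_cell_if_near[of _ r k] by fastforce

text \<open>Sums over cells are written as integrals for counting measure, so that they can be
  interchanged with Lebesgue integrals. Every point has exactly one cell, indexed by the floors of
  its rescaled coordinates.\<close>

lemma nn_integral_cells:
  fixes f :: "real ^ 'n \<Rightarrow> ennreal"
  assumes [measurable]: "f \<in> leb_borel" and "0 < r"
  shows "(\<integral>\<^sup>+k. (\<integral>\<^sup>+x. f x * indicator (cell r k) x \<partial>lebesgue) \<partial>count_space UNIV) = (\<integral>\<^sup>+x. f x \<partial>lebesgue)"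
proof -
  have "(\<integral>\<^sup>+k. (\<integral>\<^sup>+x. f x * indicator (cell r k) x \<partial>lebesgue) \<partial>count_space UNIV)
    = (\<integral>\<^sup>+x. (\<integral>\<^sup>+k. f x * indicator (cell r k) x \<partial>count_space UNIV) \<partial>lebesgue)"
    by (rule nn_integral_count_space_nn_integral[symmetric]) auto
  also have "\<dots> = (\<integral>\<^sup>+x. f x \<partial>lebesgue)"
  proof (rule nn_integral_cong)
    fix x :: "real ^ 'n"
    have "(\<integral>\<^sup>+k. f x * indicator (cell r k) x \<partial>count_space UNIV)
      = (\<integral>\<^sup>+k. f x * indicator {\<chi> i. \<lfloor>x $ i / r\<rfloor>} k \<partial>count_space UNIV)"
      using assms(2) by (intro nn_integral_cong) (auto simp: mem_cell_iff split: split_indicator)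
    also have "\<dots> = f x" by (simp add: nn_integral_cmult_indicator)
    finally show "(\<integral>\<^sup>+k. f x * indicator (cell r k) x \<partial>count_space UNIV) = f x" .
  qed
  finally show ?thesis .
qed

lemma finite_card_vec_box:
  fixes S :: "'n::finite \<Rightarrow> 'a set"
  assumes "\<And>i. finite (S i)"
  shows "finite {k :: 'a ^ 'n. \<forall>i. k $ i \<in> S i}" "card {k :: 'a ^ 'n. \<forall>i. k $ i \<in> S i} = (\<Prod>i\<in>UNIV. card (S i))"
proof -
  let ?K = "{k :: 'a ^ 'n. \<forall>i. k $ i \<in> S i}"
  have "bij_betw vec_nth ?K (PiE UNIV S)"
    unfolding bij_betw_def
  proof
    show "inj_on vec_nth ?K" by (auto simp: inj_on_def vec_eq_iff)
    show "vec_nth ` ?K = PiE UNIV S"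
    proof safe
      fix f assume "f \<in> PiE UNIV S"
      then show "f \<in> vec_nth ` ?K"
        by (intro image_eqI[of _ _ "\<chi> i. f i"]) (auto simp: fun_eq_iff)
    qed auto
  qed
  moreover have "finite (PiE UNIV S)" using assms by (intro finite_PiE) auto
  ultimately show "finite ?K" "card ?K = (\<Prod>i\<in>UNIV. card (S i))"
    using assms by (auto simp: bij_betw_finite bij_betw_same_card card_PiE)
qed

lemma nn_integral_big_cells_le:
  fixes f :: "real ^ 'n \<Rightarrow> ennreal"
  assumes [measurable]: "f \<in> leb_borel" and r: "0 < r"
  shows "(\<integral>\<^sup>+k. (\<integral>\<^sup>+x. f x * indicator (big_cell r k) x \<partial>lebesgue) \<partial>count_space UNIV)
    \<le> 4 ^ CARD('n) * (\<integral>\<^sup>+x. f x \<partial>lebesgue)"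
proof -
  have "(\<integral>\<^sup>+k. (\<integral>\<^sup>+x. f x * indicator (big_cell r k) x \<partial>lebesgue) \<partial>count_space UNIV)
    = (\<integral>\<^sup>+x. (\<integral>\<^sup>+k. f x * indicator (big_cell r k) x \<partial>count_space UNIV) \<partial>lebesgue)"
    by (rule nn_integral_count_space_nn_integral[symmetric]) auto
  also have "\<dots> \<le> (\<integral>\<^sup>+x. 4 ^ CARD('n) * f x \<partial>lebesgue)"
  proof (rule nn_integral_mono)
    fix x :: "real ^ 'n"
    \<comment> \<open>Four values per coordinate are allowed rather than three: the tripled cells
      are closed, and the extra value occurs when x_i/r is an integer.\<close>
    let ?K = "{k :: int ^ 'n. \<forall>i. k $ i \<in> {\<lfloor>x $ i / r\<rfloor> - 2 .. \<lfloor>x $ i / r\<rfloor> + 1}}"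
    have fin: "finite ?K" by (rule finite_card_vec_box) simp
    have card: "card ?K = 4 ^ CARD('n)" by (subst finite_card_vec_box) simp_all
    have sub: "k \<in> ?K" if "x \<in> big_cell r k" for k
    proof -
      have "k $ i \<in> {\<lfloor>x $ i / r\<rfloor> - 2 .. \<lfloor>x $ i / r\<rfloor> + 1}" for i
      proof -
        have "r * (of_int (k $ i) - 1) \<le> x $ i" "x $ i \<le> r * (of_int (k $ i) + 2)"
          using that by (auto simp: big_cell_def mem_box_cart)
        then have "of_int (k $ i) - 1 \<le> x $ i / r" "x $ i / r \<le> of_int (k $ i) + 2"
          using r by (auto simp: field_simps)
        then have "k $ i - 1 \<le> \<lfloor>x $ i / r\<rfloor>" "\<lfloor>x $ i / r\<rfloor> \<le> k $ i + 2"
          by linarith+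
        then show ?thesis by simp
      qed
      then show ?thesis by simp
    qed
    have "(\<integral>\<^sup>+k. f x * indicator (big_cell r k) x \<partial>count_space UNIV) \<le> (\<integral>\<^sup>+k. f x * indicator ?K k \<partial>count_space UNIV)"
      using sub by (intro nn_integral_mono) (auto split: split_indicator)
    also have "\<dots> = f x * emeasure (count_space UNIV) ?K"
      by (intro nn_integral_cmult_indicator) simp
    also have "\<dots> = 4 ^ CARD('n) * f x"
      using fin card by (simp add: emeasure_count_space_finite mult.commute)
    finally show "(\<integral>\<^sup>+k. f x * indicator (big_cell r k) x \<partial>count_space UNIV) \<le> 4 ^ CARD('n) * f x" .
  qed
  also have "\<dots> = 4 ^ CARD('n) * (\<integral>\<^sup>+x. f x \<partial>lebesgue)"
    by (rule nn_integral_cmult) measurable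
  finally show ?thesis .
qed

section \<open>An integrable polynomial weight and log-Hoelder exponents\<close>

lemma ennreal_le_suminf: "f j \<le> (\<Sum>j. f j)" for f :: "nat \<Rightarrow> ennreal"
  using sum_le_suminf[of f "{j}"] by simp

text \<open>The decay must be fast enough for integrability, yet slow enough that the logarithm of
  the mass of a cell is controlled by log(1/r) and log(e + |x|). The base e + |x| is the one in the
  condition at infinity.\<close>

definition tail_weight :: "real ^ 'n \<Rightarrow> real" where
  "tail_weight x = 1 / (exp 1 + norm x) ^ (CARD('n) + 2)"

lemma tail_weight_measurable [measurable]: "tail_weight \<in> leb_borel"
  unfolding tail_weight_def
  by (intro borel_measurable_continuous_lebesgue continuous_intros)
    (metis add_pos_nonneg exp_gt_zero less_irrefl norm_ge_zero power_eq_0_iff)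

text \<open>Where the floor of |x| is j, the weight is at most (j+1)^-(n+2), while the ball of
  radius j+1 has volume of order (j+1)^n. What remains is the sum of 1/(j+1)^2, which explains the
  exponent n + 2; whole balls may replace shells.\<close>

lemma nn_integral_tail_weight_finite: "(\<integral>\<^sup>+x. ennreal (tail_weight (x :: real ^ 'n)) \<partial>lebesgue) < \<infinity>"
proof -
  let ?V = "unit_ball_vol (real CARD('n))"
  let ?c = "\<lambda>j. 1 / real (Suc j) ^ (CARD('n) + 2)"
  have "(\<integral>\<^sup>+x. ennreal (tail_weight (x :: real ^ 'n)) \<partial>lebesgue)
    \<le> (\<integral>\<^sup>+x. (\<Sum>j. ennreal (?c j) * indicator (cball (0 :: real ^ 'n) (real (Suc j))) x) \<partial>lebesgue)"
  proof (rule nn_integral_mono)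
    fix x :: "real ^ 'n"
    define j where "j = nat \<lfloor>norm x\<rfloor>"
    have j: "real j \<le> norm x" "norm x \<le> real (Suc j)"
      unfolding j_def using norm_ge_zero[of x] by linarith+
    have "tail_weight x \<le> ?c j"
      unfolding tail_weight_def
    proof (intro divide_left_mono power_mono)
      show "real (Suc j) \<le> exp 1 + norm x"
        using j(1) exp_ge_add_one_self[of 1] by simp
      show "0 < (exp 1 + norm x) ^ (CARD('n) + 2) * real (Suc j) ^ (CARD('n) + 2)"
        by (intro mult_pos_pos zero_less_power add_pos_nonneg) auto
    qed auto
    then have "ennreal (tail_weight x) \<le> ennreal (?c j) * indicator (cball (0 :: real ^ 'n) (real (Suc j))) x"
      using j(2) by (simp add: ennreal_leI)
    also have "\<dots> \<le> (\<Sum>j. ennreal (?c j) * indicator (cball (0 :: real ^ 'n) (real (Suc j))) x)"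
      by (rule ennreal_le_suminf)
    finally show "ennreal (tail_weight x) \<le> (\<Sum>j. ennreal (?c j) * indicator (cball (0 :: real ^ 'n) (real (Suc j))) x)" .
  qed
  also have "\<dots> = (\<Sum>j. ennreal (?c j) * emeasure lebesgue (cball (0 :: real ^ 'n) (real (Suc j))))"
    by (subst nn_integral_suminf) (auto simp: nn_integral_cmult_indicator)
  also have "\<dots> = (\<Sum>j. ennreal (?V * (1 / real (Suc j) ^ 2)))"
  proof (intro suminf_cong)
    fix j
    have "emeasure lebesgue (cball (0 :: real ^ 'n) (real (Suc j))) = ennreal (?V * real (Suc j) ^ CARD('n))"
      using emeasure_cball[of "real (Suc j)" "0 :: real ^ 'n"] by simp
    then have "ennreal (?c j) * emeasure lebesgue (cball (0 :: real ^ 'n) (real (Suc j)))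
      = ennreal (?c j) * ennreal (?V * real (Suc j) ^ CARD('n))"
      by (rule arg_cong)
    also have "\<dots> = ennreal (?c j * (?V * real (Suc j) ^ CARD('n)))"
      by (intro ennreal_mult[symmetric] mult_nonneg_nonneg) auto
    also have "?c j * (?V * real (Suc j) ^ CARD('n)) = ?V * (1 / real (Suc j) ^ 2)"
      by (simp add: power_add power2_eq_square field_simps del: of_nat_Suc)
    finally show "ennreal (?c j) * emeasure lebesgue (cball (0 :: real ^ 'n) (real (Suc j)))
      = ennreal (?V * (1 / real (Suc j) ^ 2))" .
  qed
  also have "\<dots> < \<infinity>"
  proof -
    have "summable (\<lambda>j. 1 / real (Suc j) ^ 2)"
      using inverse_power_summable[of 2, where 'a = real] by (subst summable_Suc_iff) (simp add: inverse_eq_divide)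
    then have "summable (\<lambda>j. ?V * (1 / real (Suc j) ^ 2))" by (rule summable_mult)
    then have "(\<Sum>j. ennreal (?V * (1 / real (Suc j) ^ 2))) = ennreal (\<Sum>j. ?V * (1 / real (Suc j) ^ 2))"
      by (intro suminf_ennreal2) (auto intro!: mult_nonneg_nonneg)
    then show ?thesis by simp
  qed
  finally show ?thesis .
qed

text \<open>Moving to a point at distance at most 1 replaces e + |x| by at most its square. It thus
  doubles an exponent or a logarithm, whence the exponent 2(n+2) in the estimates for cells.\<close>

lemma exp_1_add_le_square:
  fixes s :: real
  assumes "0 \<le> s" shows "exp 1 + s + 1 \<le> (exp 1 + s) * (exp 1 + s)"
proof -
  have "2 \<le> exp (1 :: real)" using exp_ge_add_one_self[of "1 :: real"] by simp
  then have ge: "2 \<le> exp 1 + s" using assms by simp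
  then have "exp 1 + s + 1 \<le> (exp 1 + s) * 2" by simp
  also have "\<dots> \<le> (exp 1 + s) * (exp 1 + s)" using ge by (intro mult_left_mono) auto
  finally show ?thesis .
qed

text \<open>The quotient t^(p x) / t^(p y) is exp((p x - p y) log t). The lower bound on t gives
  -log t at most n log(1/r) + 2(n+2) log(e + |x|); the local condition absorbs the first term and
  the condition at infinity the second.\<close>

lemma log_Holder_powr_le:
  fixes p :: "real ^ 'n \<Rightarrow> real"
  assumes "p \<in> log_Holder"
  obtains D where "1 \<le> D" "\<And>r t x y. 0 < r \<Longrightarrow> 4 * real CARD('n) * r < 1 \<Longrightarrow> norm (x - y) \<le> 2 * real CARD('n) * r \<Longrightarrow>
      r ^ CARD('n) / (exp 1 + norm x) ^ (2 * (CARD('n) + 2)) \<le> t \<Longrightarrow> t \<le> 1 \<Longrightarrow> t powr p x \<le> D * t powr p y"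
proof -
  obtain C p_inf where C: "0 < C"
    and loc: "\<And>x y. norm (x - y) < 1 / 2 \<Longrightarrow> \<bar>p x - p y\<bar> \<le> C / ln (exp 1 + 1 / norm (x - y))"
    and inf: "\<And>x. \<bar>p x - p_inf\<bar> \<le> C / ln (exp 1 + norm x)"
    using assms unfolding log_Holder_def by blast
  define n where "n = real CARD('n)"
  have n: "1 \<le> n" by (simp add: n_def Suc_leI)
  \<comment> \<open>The two products are the bounds \<open>d1\<close> and \<open>d2\<close> below,
    weighted by the coefficients of the logarithms.\<close>
  define c where "c = n * (C * (1 + ln (2 * n))) + 2 * (n + 2) * (3 * C)"
  have "0 \<le> c" unfolding c_def using n C by (intro add_nonneg_nonneg mult_nonneg_nonneg) auto
  have ln_ge1: "1 \<le> ln (exp 1 + s)" if "0 \<le> s" for s :: real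
    using that ln_le_cancel_iff[of "exp 1" "exp 1 + s"] by (simp add: add_pos_nonneg)
  have "t powr p x \<le> exp c * t powr p y"
    if r: "0 < r" "4 * n * r < 1" and xy: "norm (x - y) \<le> 2 * n * r"
      and t: "r ^ CARD('n) / (exp 1 + norm x) ^ (2 * (CARD('n) + 2)) \<le> t" "t \<le> 1" for r t x y
  proof -
    have pos: "0 < exp 1 + norm z" for z :: "real ^ 'n" by (intro add_pos_nonneg) auto
    have tpos: "0 < t" using t(1) r(1) pos by (intro less_le_trans[OF _ t(1)]) simp
    define d where "d = \<bar>p x - p y\<bar>"
    have ln_le: "ln (r ^ CARD('n) / (exp 1 + norm x) ^ (2 * (CARD('n) + 2))) \<le> ln t"
      using t r pos tpos by (subst ln_le_cancel_iff) auto
    have ln_eq: "ln (r ^ CARD('n) / (exp 1 + norm x) ^ l) = real CARD('n) * ln r - real l * ln (exp 1 + norm x)" for l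
      using r pos[of x] by (simp add: ln_div ln_realpow)
    have ln_t: "- ln t \<le> n * ln (1 / r) + 2 * (n + 2) * ln (exp 1 + norm x)"
      using r ln_le unfolding ln_eq by (simp add: ln_div n_def algebra_simps)
    have xy_half: "norm (x - y) < 1 / 2" using xy r by simp
    \<comment> \<open>As |x - y| is at most 2nr, the local modulus is at most C divided by
      \<open>?l\<close>, and log(1/r) exceeds \<open>?l\<close> by at most log(2n).\<close>
    have d1: "d * ln (1 / r) \<le> C * (1 + ln (2 * n))"
    proof (cases "x = y")
      case True
      then show ?thesis using C n by (simp add: d_def)
    next
      case False
      let ?l = "ln (exp 1 + 1 / (2 * n * r))"
      have "1 \<le> ?l" using n r by (intro ln_ge1) simp
      have "?l \<le> ln (exp 1 + 1 / norm (x - y))"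
        using False xy n r by (subst ln_le_cancel_iff) (auto intro!: add_pos_nonneg divide_left_mono mult_pos_pos)
      then have "d \<le> C / ?l"
        using loc[OF xy_half] \<open>1 \<le> ?l\<close> C unfolding d_def
        by (elim order_trans) (intro divide_left_mono mult_pos_pos; linarith)
      have "ln (1 / r) = ln (2 * n) + ln (1 / (2 * n * r))"
        using n r by (simp add: ln_div ln_mult)
      also have "ln (1 / (2 * n * r)) \<le> ?l"
        using n r by (subst ln_le_cancel_iff) (auto intro!: add_pos_nonneg)
      finally have "ln (1 / r) \<le> ln (2 * n) + ?l" by simp
      also have "\<dots> \<le> (1 + ln (2 * n)) * ?l"
        using \<open>1 \<le> ?l\<close> n mult_left_mono[of 1 ?l "ln (2 * n)"] by (simp add: algebra_simps)
      finally have "d * ln (1 / r) \<le> d * ((1 + ln (2 * n)) * ?l)"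
        by (intro mult_left_mono) (auto simp: d_def)
      also have "\<dots> \<le> C / ?l * ((1 + ln (2 * n)) * ?l)"
        using \<open>d \<le> C / ?l\<close> \<open>1 \<le> ?l\<close> n by (intro mult_right_mono mult_nonneg_nonneg add_nonneg_nonneg) auto
      also have "\<dots> = C * (1 + ln (2 * n))" using \<open>1 \<le> ?l\<close> by simp
      finally show ?thesis .
    qed
    \<comment> \<open>Both values are compared with the limit at infinity, which gives
      C/\<open>?lx\<close> + C/\<open>?ly\<close>. Nearby points satisfy
      \<open>?lx \<le> 2 * ?ly\<close>, hence C + 2C.\<close>
    have d2: "d * ln (exp 1 + norm x) \<le> 3 * C"
    proof -
      let ?lx = "ln (exp 1 + norm x)" and ?ly = "ln (exp 1 + norm y)"
      have l1: "1 \<le> ?lx" "1 \<le> ?ly" by (auto intro: ln_ge1)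
      have "norm x \<le> norm y + 1 / 2"
        using norm_triangle_sub[of x y] xy_half by linarith
      then have "exp 1 + norm x \<le> (exp 1 + norm y) + 1" by simp
      also have "\<dots> \<le> (exp 1 + norm y) * (exp 1 + norm y)"
        by (rule exp_1_add_le_square) simp
      finally have "?lx \<le> ln ((exp 1 + norm y) * (exp 1 + norm y))"
        using pos by (subst ln_le_cancel_iff) (auto intro: mult_pos_pos)
      also have "\<dots> = 2 * ?ly" using pos[of y] by (subst ln_mult) auto
      finally have lxy: "?lx \<le> 2 * ?ly" .
      have "d \<le> C / ?lx + C / ?ly"
        using inf[of x] inf[of y] unfolding d_def by linarith
      then have "d * ?lx \<le> (C / ?lx + C / ?ly) * ?lx"
        using l1 by (intro mult_right_mono) auto
      also have "\<dots> = C + C * (?lx / ?ly)" using l1 by (simp add: field_simps)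
      also have "\<dots> \<le> C + C * 2"
        using lxy l1 C by (intro add_left_mono mult_left_mono) (auto simp: divide_le_eq)
      finally show ?thesis by simp
    qed
    have "(p x - p y) * ln t \<le> d * (- ln t)"
    proof -
      have "ln t \<le> 0" using tpos t(2) by (simp add: ln_le_zero_iff)
      then have "(p x - p y) * ln t \<le> (- d) * ln t"
        unfolding d_def by (intro mult_right_mono_neg) auto
      then show ?thesis by simp
    qed
    also have "\<dots> \<le> d * (n * ln (1 / r) + 2 * (n + 2) * ln (exp 1 + norm x))"
      using ln_t by (intro mult_left_mono) (auto simp: d_def)
    also have "\<dots> = n * (d * ln (1 / r)) + 2 * (n + 2) * (d * ln (exp 1 + norm x))"
      by (simp add: algebra_simps)
    also have "\<dots> \<le> c"
      unfolding c_def using d1 d2 n by (intro add_mono mult_left_mono) auto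
    finally have "(p x - p y) * ln t \<le> c" .
    then have "t powr (p x - p y) \<le> exp c"
      using tpos by (simp add: powr_def)
    then have "t powr (p x - p y) * t powr p y \<le> exp c * t powr p y"
      by (intro mult_right_mono) auto
    then show ?thesis by (simp flip: powr_add)
  qed
  then show ?thesis
    using \<open>0 \<le> c\<close> by (intro that[of "exp c"]) (auto simp: n_def)
qed

section \<open>From bounds on cells to global bounds\<close>

context exponent_function
begin

abbreviation (input) "lux_on u S \<equiv> lux_norm q (\<lambda>x. u x * indicator S x)"
abbreviation (input) "modular_on u S \<equiv> (\<integral>\<^sup>+x. epowr (u x) (q x) * indicator S x \<partial>lebesgue)"

text \<open>Either the local norm \<open>a\<close> of \<open>v\<close> is below twice the mass \<open>e\<close> that an integrable weight gives
  to the cell, and then the local modular of \<open>u\<close> is at most \<open>e\<close>; or it is large enough for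
  log-Hoelder continuity to make \<open>a powr q\<close> essentially constant near the cell.\<close>

lemma modular_cell_le:
  fixes u v :: "real ^ 'n \<Rightarrow> ennreal"
  assumes [measurable]: "u \<in> leb_borel" "v \<in> leb_borel"
    and sets [measurable]: "S \<in> sets lebesgue" "T \<in> sets lebesgue" and "S \<noteq> {}"
    and e: "0 < e" "e \<le> 1" and "1 \<le> D"
    and le: "lux_on u S \<le> lux_on v T"
    and le_1: "lux_on v T \<le> 1"
    and compare: "\<And>t x y. x \<in> S \<Longrightarrow> y \<in> T \<Longrightarrow> e \<le> t \<Longrightarrow> t \<le> 1 \<Longrightarrow> t powr q x \<le> D * t powr q y"
  shows "(\<integral>\<^sup>+x. epowr (u x / 4) (q x) * indicator S x \<partial>lebesgue)
    \<le> ennreal D * modular_on v T + ennreal e"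
proof -
  obtain a where a: "0 \<le> a" "a \<le> 1" "lux_on v T = ennreal a"
    using le_1 by (cases "lux_on v T") (auto simp: top_unique)
  have scale: "epowr (u x / 4) (q x) * indicator S x = ennreal (t powr q x) * epowr (u x * indicator S x / ennreal (4 * t)) (q x)"
    if "0 < t" for t x
  proof -
    have "u x / 4 = ennreal t * (u x / ennreal (4 * t))" 
    proof -
      have "u x / 4 = u x / ennreal 4" by simp
      also have "\<dots> = ennreal (1 / 4) * u x" by (rule ennreal_divide_real) simp
      also have "1 / 4 = t * (1 / (4 * t))" using that by simp
      also have "ennreal (t * (1 / (4 * t))) * u x = ennreal t * (u x / ennreal (4 * t))"
        using that by (subst ennreal_mult) (auto simp: ennreal_divide_real mult.assoc)
      finally show ?thesis .
    qed
    then show ?thesis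
      using that q_pos[of x] epowr_cmult[of t "q x" "u x / ennreal (4 * t)"] by (simp split: split_indicator)
  qed
  \<comment> \<open>The factor 4 lets this one estimate serve both cases, with t = e when a < 2e and
    with t = a/2 otherwise: in either case 4t exceeds a, so the local modular of u/(4t) is at most
    1.\<close>
  have bound: "(\<integral>\<^sup>+x. epowr (u x / 4) (q x) * indicator S x \<partial>lebesgue) \<le> c"
    if t: "0 < t" "a < 4 * t" and c: "\<And>x. x \<in> S \<Longrightarrow> ennreal (t powr q x) \<le> c" for t c
  proof -
    have "(\<integral>\<^sup>+x. epowr (u x / 4) (q x) * indicator S x \<partial>lebesgue)
      \<le> (\<integral>\<^sup>+x. c * epowr (u x * indicator S x / ennreal (4 * t)) (q x) \<partial>lebesgue)"
    proof (rule nn_integral_mono)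
      fix x
      show "epowr (u x / 4) (q x) * indicator S x \<le> c * epowr (u x * indicator S x / ennreal (4 * t)) (q x)"
        unfolding scale[OF t(1)] using c[of x] by (cases "x \<in> S") (auto intro!: mult_right_mono)
    qed
    also have "\<dots> = c * modular q (\<lambda>x. u x * indicator S x / ennreal (4 * t))"
      unfolding modular_def by (rule nn_integral_cmult) measurable
    also have "\<dots> \<le> c * 1"
      using t a le by (intro mult_left_mono modular_le_1_if_lux_norm_less) (auto elim!: le_less_trans simp: ennreal_less_iff)
    finally show ?thesis by simp
  qed
  show ?thesis
  proof (cases "a < 2 * e")
    case True
    have "(\<integral>\<^sup>+x. epowr (u x / 4) (q x) * indicator S x \<partial>lebesgue) \<le> ennreal e"
    proof (rule bound)
      show "ennreal (e powr q x) \<le> ennreal e" for x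
        using powr_mono'[of 1 "q x" e] e one_le_q[of x] by (intro ennreal_leI) simp
    qed (use e True in auto)
    then show ?thesis by (rule add_increasing[rotated]) simp
  next
    case False
    define t where "t = a / 2"
    have t: "0 < t" "e \<le> t" "t \<le> 1" "t < a" "a < 4 * t" using False a e by (auto simp: t_def)
    \<comment> \<open>As t lies strictly below the local norm of v, the modular at scale t exceeds
      1. Multiplying by it turns the number t^(q x) into an integral of v over T.\<close>
    have "1 < modular q (\<lambda>x. v x * indicator T x / ennreal t)"
      using t a by (intro modular_gt_1) (auto simp: ennreal_less_iff)
    then have gt: "1 \<le> (\<integral>\<^sup>+y. epowr (v y * indicator T y / ennreal t) (q y) \<partial>lebesgue)"
      by (simp add: modular_def)
    have "(\<integral>\<^sup>+x. epowr (u x / 4) (q x) * indicator S x \<partial>lebesgue)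
      \<le> ennreal D * modular_on v T"
    proof (rule bound)
      fix x assume x: "x \<in> S"
      have "ennreal (t powr q x) * 1
        \<le> ennreal (t powr q x) * (\<integral>\<^sup>+y. epowr (v y * indicator T y / ennreal t) (q y) \<partial>lebesgue)"
        by (intro mult_left_mono gt) simp
      also have "\<dots> = (\<integral>\<^sup>+y. ennreal (t powr q x) * epowr (v y * indicator T y / ennreal t) (q y) \<partial>lebesgue)"
        by (rule nn_integral_cmult[symmetric]) measurable
      also have "\<dots> \<le> (\<integral>\<^sup>+y. ennreal D * (epowr (v y) (q y) * indicator T y) \<partial>lebesgue)"
      proof (rule nn_integral_mono)
        fix y
        show "ennreal (t powr q x) * epowr (v y * indicator T y / ennreal t) (q y)
          \<le> ennreal D * (epowr (v y) (q y) * indicator T y)"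
        proof (cases "y \<in> T")
          case True
          have "ennreal (t powr q x) * epowr (v y / ennreal t) (q y)
            \<le> ennreal (D * t powr q y) * epowr (v y / ennreal t) (q y)"
            using compare[OF x True t(2,3)] by (intro mult_right_mono ennreal_leI) auto
          also have "\<dots> = ennreal D * (ennreal (t powr q y) * epowr (v y / ennreal t) (q y))"
            using \<open>1 \<le> D\<close> by (simp add: ennreal_mult mult.assoc)
          also have "ennreal (t powr q y) * epowr (v y / ennreal t) (q y) = epowr (ennreal t * (v y / ennreal t)) (q y)"
            using t q_pos[of y] by (intro epowr_cmult[symmetric]) auto
          also have "ennreal t * (v y / ennreal t) = v y"
            using t by (simp add: ennreal_divide_real mult.assoc[symmetric] flip: ennreal_mult)
          finally show ?thesis using True by simp
        qed simp
      qed
      also have "\<dots> = ennreal D * modular_on v T"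
        by (rule nn_integral_cmult) measurable
      finally show "ennreal (t powr q x) \<le> ennreal D * modular_on v T"
        by simp
    qed (use t in auto)
    then show ?thesis by (rule add_increasing2[rotated]) simp
  qed
qed

text \<open>The mass is at least the volume r^n times the least value of the weight on the cell. To
  express that value at an arbitrary x of the cell, the exponent is doubled.\<close>

lemma tail_weight_cell_ge:
  fixes x :: "real ^ 'n"
  assumes x: "x \<in> cell r k" and r: "0 < r" "4 * real CARD('n) * r < 1"
  shows "ennreal (r ^ CARD('n) / (exp 1 + norm x) ^ (2 * (CARD('n) + 2)))
    \<le> (\<integral>\<^sup>+y. ennreal (tail_weight y) * indicator (cell r k) y \<partial>lebesgue)"
proof -
  define l where "l = CARD('n) + 2"
  let ?w = "1 / (exp 1 + norm x) ^ (2 * l)"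
  have "ennreal (r ^ CARD('n) / (exp 1 + norm x) ^ (2 * l)) = ennreal ?w * ennreal (r ^ CARD('n))"
    using r by (subst ennreal_mult[symmetric]) (auto intro!: add_nonneg_nonneg)
  also have "\<dots> \<le> ennreal ?w * emeasure lebesgue (cell r k)"
    by (intro mult_left_mono emeasure_cell_ge r) simp
  also have "\<dots> = (\<integral>\<^sup>+y. ennreal ?w * indicator (cell r k) y \<partial>lebesgue)"
    by (rule nn_integral_cmult_indicator[symmetric]) measurable
  also have "\<dots> \<le> (\<integral>\<^sup>+y. ennreal (tail_weight y) * indicator (cell r k) y \<partial>lebesgue)"
  proof (rule nn_integral_mono)
    fix y
    have "?w \<le> tail_weight y" if "y \<in> cell r k"
    proof -
      have "norm (x - y) \<le> 1"
        using norm_diff_cell_le[OF x subsetD[OF cell_subset_big_cell[OF r(1)] that] r(1)] r by simp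
      then have "norm y \<le> norm x + 1"
        using norm_triangle_sub[of y x] by (simp add: norm_minus_commute)
      then have "exp 1 + norm y \<le> (exp 1 + norm x) + 1" by simp
      also have "\<dots> \<le> (exp 1 + norm x) * (exp 1 + norm x)"
        by (rule exp_1_add_le_square) simp
      finally have "(exp 1 + norm y) ^ l \<le> ((exp 1 + norm x) * (exp 1 + norm x)) ^ l"
        by (intro power_mono) (auto intro!: add_nonneg_nonneg)
      also have "\<dots> = (exp 1 + norm x) ^ (2 * l)"
        by (simp add: power_mult power2_eq_square)
      finally show ?thesis
        unfolding tail_weight_def l_def[symmetric]
        by (intro divide_left_mono) (auto intro!: mult_pos_pos zero_less_power add_pos_nonneg)
    qed
    then show "ennreal ?w * indicator (cell r k) y \<le> ennreal (tail_weight y) * indicator (cell r k) y"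
      by (auto split: split_indicator intro!: ennreal_leI)
  qed
  finally show ?thesis unfolding l_def .
qed

text \<open>After normalizing the norm of v below 1, the modular inequalities of all cells are
  added. The overlap of the tripled cells contributes D 4^n and the weight its total mass E;
  homogeneity then removes the normalization.\<close>

lemma localization:
  assumes "q \<in> log_Holder"
  obtains C where "0 < C" "\<And>r u v. 0 < r \<Longrightarrow> 4 * real CARD('n) * r < 1 \<Longrightarrow>
    u \<in> leb_borel \<Longrightarrow> v \<in> leb_borel \<Longrightarrow>
    (\<And>k. lux_on u (cell r k) \<le> lux_on v (big_cell r k)) \<Longrightarrow>
    lux_norm q u \<le> ennreal C * lux_norm q v"
proof -
  obtain D where D: "1 \<le> D" "\<And>r t x y. 0 < r \<Longrightarrow> 4 * real CARD('n) * r < 1 \<Longrightarrow> norm (x - y) \<le> 2 * real CARD('n) * r \<Longrightarrow>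
      r ^ CARD('n) / (exp 1 + norm x) ^ (2 * (CARD('n) + 2)) \<le> t \<Longrightarrow> t \<le> 1 \<Longrightarrow> t powr q x \<le> D * t powr q y"
    by (rule log_Holder_powr_le[OF assms]) blast
  obtain E where E: "0 \<le> E" "(\<integral>\<^sup>+x. ennreal (tail_weight (x :: real ^ 'n)) \<partial>lebesgue) = ennreal E"
    using nn_integral_tail_weight_finite[where 'n = 'n]
    by (cases "\<integral>\<^sup>+x. ennreal (tail_weight (x :: real ^ 'n)) \<partial>lebesgue") auto
  define L where "L = D * 4 ^ CARD('n) + E"
  have "1 * 1 \<le> D * 4 ^ CARD('n)" using D(1) by (intro mult_mono) auto
  then have L: "1 \<le> L" using E(1) by (simp add: L_def)
  have unit: "lux_norm q u \<le> ennreal (4 * L)"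
    if r: "0 < r" "4 * real CARD('n) * r < 1"
      and [measurable]: "u \<in> leb_borel" "v \<in> leb_borel"
      and le: "\<And>k. lux_on u (cell r k) \<le> lux_on v (big_cell r k)"
      and v: "lux_norm q v < 1" for r u v
  proof (rule lux_norm_le_if_modular_le)
    have cell_le: "(\<integral>\<^sup>+x. epowr (u x / 4) (q x) * indicator (cell r k) x \<partial>lebesgue)
      \<le> ennreal D * modular_on v (big_cell r k)
        + (\<integral>\<^sup>+x. ennreal (tail_weight x) * indicator (cell r k) x \<partial>lebesgue)" for k
    proof -
      define I where "I = (\<integral>\<^sup>+x. ennreal (tail_weight x) * indicator (cell r k) x \<partial>lebesgue)"
      have "I \<le> (\<integral>\<^sup>+x. ennreal (tail_weight (x :: real ^ 'n)) \<partial>lebesgue)"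
        unfolding I_def by (intro nn_integral_mono) (auto split: split_indicator)
      then obtain i where i: "0 \<le> i" "I = ennreal i"
        using E by (cases I) (auto simp: top_unique)
      have ge: "r ^ CARD('n) / (exp 1 + norm x) ^ (2 * (CARD('n) + 2)) \<le> i" if "x \<in> cell r k" for x
        using tail_weight_cell_ge[OF that r] i unfolding I_def[symmetric] by (simp add: ennreal_le_iff)
      have le_1: "r ^ CARD('n) / (exp 1 + norm x) ^ (2 * (CARD('n) + 2)) \<le> 1" for x :: "real ^ 'n"
      proof -
        have "1 \<le> exp 1 + norm x" using exp_ge_add_one_self[of 1] norm_ge_zero[of x] by linarith
        moreover have "1 \<le> CARD('n)" by (simp add: Suc_leI)
        then have "1 \<le> 4 * real CARD('n)" by linarith
        then have "1 * r \<le> 4 * real CARD('n) * r" by (rule mult_right_mono) (use r in simp)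
        then have "r \<le> 1" using r(2) unfolding mult_1_left by (rule order_trans[OF _ less_imp_le])
        ultimately have ge: "1 \<le> (exp 1 + norm x) ^ (2 * (CARD('n) + 2))" and le: "r ^ CARD('n) \<le> 1"
          using r by (blast intro: one_le_power power_le_one less_imp_le)+
        show ?thesis using frac_le[OF zero_le_one le zero_less_one ge] by simp
      qed
      define x0 :: "real ^ 'n" where "x0 = (\<chi> i. r * of_int (k $ i))"
      have x0: "x0 \<in> cell r k" using r by (simp add: x0_def cell_def)
      have "0 < r ^ CARD('n) / (exp 1 + norm x0) ^ (2 * (CARD('n) + 2))"
        using r by (intro divide_pos_pos zero_less_power add_pos_nonneg) auto
      then have "0 < i" using ge[OF x0] by linarith
      \<comment> \<open>The mass is capped at 1 to meet the requirement of the estimate on a cell;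
        the lower bound in terms of r and |x| survives, being itself at most 1.\<close>
      have "(\<integral>\<^sup>+x. epowr (u x / 4) (q x) * indicator (cell r k) x \<partial>lebesgue)
        \<le> ennreal D * modular_on v (big_cell r k) + ennreal (min i 1)"
      proof (rule modular_cell_le)
        show "cell r k \<noteq> {}" using x0 by blast
        have "lux_on v (big_cell r k) \<le> lux_norm q v"
          by (intro lux_norm_mono) (auto split: split_indicator)
        then show "lux_on v (big_cell r k) \<le> 1" using v by simp
        fix t x y assume x: "x \<in> cell r k" and y: "y \<in> big_cell r k" and t: "min i 1 \<le> t" "t \<le> 1"
        have "r ^ CARD('n) / (exp 1 + norm x) ^ (2 * (CARD('n) + 2)) \<le> t"
          using ge[OF x] le_1[of x] t(1) by linarith
        then show "t powr q x \<le> D * t powr q y"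
          using norm_diff_cell_le[OF x y r(1)] t(2) by (intro D(2)[OF r])
      qed (use \<open>0 < i\<close> D(1) le in auto)
      also have "\<dots> \<le> ennreal D * modular_on v (big_cell r k) + I"
        unfolding i(2) by (intro add_left_mono ennreal_leI) simp
      finally show ?thesis unfolding I_def .
    qed
    have "modular q (\<lambda>x. u x / ennreal 4)
      = (\<integral>\<^sup>+k. (\<integral>\<^sup>+x. epowr (u x / 4) (q x) * indicator (cell r k) x \<partial>lebesgue) \<partial>count_space UNIV)"
      unfolding modular_def using r by (subst nn_integral_cells) auto
    also have "\<dots> \<le> (\<integral>\<^sup>+k. ennreal D * modular_on v (big_cell r k)
        + (\<integral>\<^sup>+x. ennreal (tail_weight x) * indicator (cell r k) x \<partial>lebesgue) \<partial>count_space UNIV)"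
      by (intro nn_integral_mono cell_le)
    also have "\<dots> = ennreal D * (\<integral>\<^sup>+k. modular_on v (big_cell r k) \<partial>count_space UNIV)
        + (\<integral>\<^sup>+k. (\<integral>\<^sup>+x. ennreal (tail_weight (x :: real ^ 'n)) * indicator (cell r k) x \<partial>lebesgue) \<partial>count_space UNIV)"
      by (subst nn_integral_add) (auto simp: nn_integral_cmult)
    also have "\<dots> = ennreal D * (\<integral>\<^sup>+k. modular_on v (big_cell r k) \<partial>count_space UNIV)
        + ennreal E"
      unfolding E(2)[symmetric] using r by (subst nn_integral_cells) auto
    also have "\<dots> \<le> ennreal D * (4 ^ CARD('n) * modular q v) + ennreal E"
      unfolding modular_def using r by (intro add_right_mono mult_left_mono nn_integral_big_cells_le) auto
    also have "\<dots> \<le> ennreal D * (4 ^ CARD('n) * 1) + ennreal E"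
      using modular_le_1_if_lux_norm_less[of v 1] v
      by (intro add_right_mono mult_left_mono) (auto simp: divide_ennreal_def)
    also have "\<dots> = ennreal L"
    proof -
      have "(4 :: ennreal) ^ CARD('n) = ennreal (4 ^ CARD('n))" by (simp flip: ennreal_power)
      then show ?thesis
        using D(1) E(1) by (simp add: L_def ennreal_mult)
    qed
    finally show "modular q (\<lambda>x. u x / ennreal 4) \<le> ennreal L" .
  qed (use L in auto)
  have "lux_norm q u \<le> ennreal (4 * L) * lux_norm q v"
    if r: "0 < r" "4 * real CARD('n) * r < 1"
      and [measurable]: "u \<in> leb_borel" "v \<in> leb_borel"
      and le: "\<And>k. lux_on u (cell r k) \<le> lux_on v (big_cell r k)"
    for r u v
  proof (cases "lux_norm q v")
    case (real V)
    have "lux_norm q u \<le> ennreal (4 * L * V) + ennreal e" if e: "0 < e" for e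
    proof -
      \<comment> \<open>The scale is slightly larger than the norm of v, so that the rescaled norm
        is strictly below 1; the resulting excess is exactly e.\<close>
      define s where "s = V + e / (4 * L)"
      have "0 < e / (4 * L)" using e L by simp
      then have s: "0 < s" "V < s" "4 * L * s = 4 * L * V + e"
        using real L by (auto simp: s_def distrib_left)
      have scaled: "lux_norm q (\<lambda>x. ennreal (1 / s) * w x) = ennreal (1 / s) * lux_norm q w" for w
        using s by (intro lux_norm_cmult) simp
      have "lux_norm q (\<lambda>x. ennreal (1 / s) * u x) \<le> ennreal (4 * L)"
      proof (rule unit[OF r])
        show "lux_norm q (\<lambda>x. ennreal (1 / s) * u x * indicator (cell r k) x)
          \<le> lux_norm q (\<lambda>x. ennreal (1 / s) * v x * indicator (big_cell r k) x)" for k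
          unfolding mult.assoc scaled by (intro mult_left_mono le) simp
        have "ennreal (1 / s) * ennreal V < 1"
          using s real by (simp flip: ennreal_mult add: ennreal_less_one_iff)
        then show "lux_norm q (\<lambda>x. ennreal (1 / s) * v x) < 1"
          unfolding scaled real(2) .
      qed auto
      then have "ennreal s * (ennreal (1 / s) * lux_norm q u) \<le> ennreal s * ennreal (4 * L)"
        unfolding scaled by (rule mult_left_mono) simp
      moreover have "ennreal s * (ennreal (1 / s) * lux_norm q u) = lux_norm q u"
        using s by (simp add: mult.assoc[symmetric] flip: ennreal_mult)
      moreover have "ennreal s * ennreal (4 * L) = ennreal (4 * L * V + e)"
        using s L by (simp flip: ennreal_mult add: mult.commute)
      moreover have "ennreal (4 * L * V + e) = ennreal (4 * L * V) + ennreal e"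
        using L real e by (intro ennreal_plus) auto
      ultimately show ?thesis by simp
    qed
    then have "lux_norm q u \<le> ennreal (4 * L * V)" by (rule ennreal_le_epsilon)
    then show ?thesis using real L by (simp add: ennreal_mult)
  next
    case top
    then show ?thesis using L by (simp add: ennreal_mult_top)
  qed
  then show ?thesis using L by (intro that[of "4 * L"]) auto
qed

end

section \<open>Uniform boundedness of mollification\<close>

context Ap_weight
begin

text \<open>On a cell the constants multiply to 2 (from Hoelder's inequality) times M/r^n (the
  height) times A (3r)^n (the matrix condition), in which r cancels. No bound depending on r is left
  for the localization to sum.\<close>

lemma wnorm_convolution_le:
  assumes "p \<in> log_Holder" and "0 \<le> M"
  obtains C where "0 < C" "\<And>r \<psi> f. 0 < r \<Longrightarrow> 4 * real CARD('n) * r < 1 \<Longrightarrow> kernel \<psi> r (M / r ^ CARD('n)) \<Longrightarrow>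
    f \<in> wLp p W \<Longrightarrow> wn (convolution f \<psi>) \<le> ennreal C * wn f"
proof -
  obtain C where C: "0 < C" "\<And>r u v. 0 < r \<Longrightarrow> 4 * real CARD('n) * r < 1 \<Longrightarrow>
    u \<in> leb_borel \<Longrightarrow> v \<in> leb_borel \<Longrightarrow>
    (\<And>k. lux_norm p (\<lambda>x. u x * indicator (cell r k) x) \<le> lux_norm p (\<lambda>x. v x * indicator (big_cell r k) x)) \<Longrightarrow>
    lux_norm p u \<le> ennreal C * lux_norm p v"
    by (rule p.localization[OF assms(1)]) blast
  obtain A where A: "0 \<le> A" "Ap_const p W = ennreal A"
    using Ap_finite by (cases "Ap_const p W") auto
  \<comment> \<open>The constant per cell, increased by 1 so that it can be divided by.\<close>
  define D where "D = 2 * M * 3 ^ CARD('n) * A + 1"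
  have D: "0 < D" using A(1) assms(2) unfolding D_def by (intro add_nonneg_pos mult_nonneg_nonneg) auto
  have "wn (convolution f \<psi>) \<le> ennreal (D * C) * wn f"
    if r: "0 < r" "4 * real CARD('n) * r < 1" and "kernel \<psi> r (M / r ^ CARD('n))" and f: "f \<in> wLp p W" for r \<psi> f
  proof -
    interpret kernel \<psi> r "M / r ^ CARD('n)" by fact
    have f_loc: "loc_integrable f" using f by (rule wLp_loc_integrable)
    have [measurable]: "f \<in> leb_borel" "convolution f \<psi> \<in> leb_borel"
      using loc_integrableD(1)[OF f_loc] convolution_measurable[OF f_loc] by auto
    \<comment> \<open>Dividing by D gives the cell inequality the constant 1 that the localization
      asks for.\<close>
    let ?u = "\<lambda>x. ennreal (1 / D) * ennreal (norm (W x *v convolution f \<psi> x))"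
    let ?v = "\<lambda>x. ennreal (norm (W x *v f x))"
    have "lux_norm p ?u \<le> ennreal C * lux_norm p ?v"
    proof (rule C(2)[OF r])
      fix k :: "int ^ 'n"
      let ?Q = "big_cell r k"
      have Q: "?Q \<in> cubes" using r(1) by (rule big_cell_in_cubes)
      have "lux_norm p (\<lambda>x. ?v x * indicator ?Q x) \<le> wn f"
        unfolding wnorm_def by (intro p.lux_norm_mono) (auto split: split_indicator)
      also have "\<dots> < \<infinity>" using f by (rule wLpD)
      finally obtain a where a: "0 \<le> a" "lux_norm p (\<lambda>x. ?v x * indicator ?Q x) = ennreal a"
        by (cases "lux_norm p (\<lambda>x. ?v x * indicator ?Q x)") auto
      define c where "c = 2 * (M / r ^ CARD('n)) * a / D"
      have c: "0 \<le> c"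
        using a r assms(2) D unfolding c_def by (intro divide_nonneg_pos mult_nonneg_nonneg) auto
      have pointwise: "?u x * indicator (cell r k) x \<le> ennreal c * (h ?Q x * indicator ?Q x)" for x
      proof (cases "x \<in> cell r k")
        case True
        have "ennreal (norm (W x *v convolution f \<psi> x))
          \<le> (\<integral>\<^sup>+y. ennreal (\<psi> (x - y)) * ennreal (norm (W x *v f y)) \<partial>lebesgue)"
          by (rule matrix_convolution_le[OF f_loc])
        also have "\<dots> \<le> (\<integral>\<^sup>+y. ennreal (M / r ^ CARD('n)) * (ennreal (norm (W x *v f y)) * indicator ?Q y) \<partial>lebesgue)"
        proof (rule nn_integral_mono)
          fix y
          show "ennreal (\<psi> (x - y)) * ennreal (norm (W x *v f y))
            \<le> ennreal (M / r ^ CARD('n)) * (ennreal (norm (W x *v f y)) * indicator ?Q y)"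
          proof (cases "norm (x - y) < r")
            case near: True
            then show ?thesis
              using mem_big_cell_if_near[OF True near] le_B[of "x - y"] by (auto intro!: mult_right_mono ennreal_leI)
          next
            case False
            then show ?thesis by (simp add: support)
          qed
        qed
        also have "\<dots> = ennreal (M / r ^ CARD('n)) * (\<integral>\<^sup>+y. ennreal (norm (W x *v f y)) * indicator ?Q y \<partial>lebesgue)"
          by (rule nn_integral_cmult) measurable
        also have "\<dots> \<le> ennreal (M / r ^ CARD('n)) * (2 * ennreal a * h ?Q x)"
          using nn_integral_norm_W_le[OF _ Q, of f x] a by (intro mult_left_mono) auto
        finally have "?u x \<le> ennreal (1 / D) * (ennreal (M / r ^ CARD('n)) * (2 * ennreal a * h ?Q x))"
          by (rule mult_left_mono) simp
        also have "\<dots> = ennreal c * h ?Q x"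
        proof -
          have "ennreal c = ennreal (1 / D * ((M / r ^ CARD('n)) * (2 * a)))"
            by (simp add: c_def mult_ac)
          also have "\<dots> = ennreal (1 / D) * ennreal ((M / r ^ CARD('n)) * (2 * a))"
            using D B_nonneg a(1) by (intro ennreal_mult mult_nonneg_nonneg) auto
          also have "ennreal ((M / r ^ CARD('n)) * (2 * a)) = ennreal (M / r ^ CARD('n)) * ennreal (2 * a)"
            using B_nonneg a(1) by (intro ennreal_mult) auto
          also have "ennreal (2 * a) = 2 * ennreal a"
            using a(1) by (simp add: ennreal_mult)
          finally show ?thesis by (simp add: mult_ac)
        qed
        finally show ?thesis
          using True subsetD[OF cell_subset_big_cell[OF r(1)] True] by simp
      qed simp
      have "lux_norm p (\<lambda>x. ?u x * indicator (cell r k) x) \<le> lux_norm p (\<lambda>x. ennreal c * (h ?Q x * indicator ?Q x))"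
        by (rule p.lux_norm_mono[OF pointwise])
      also have "\<dots> \<le> ennreal a"
      \<comment> \<open>Homogeneity is available for positive factors only; for c = 0 the function
        vanishes.\<close>
      proof (cases "c = 0")
        case False
        then have "lux_norm p (\<lambda>x. ennreal c * (h ?Q x * indicator ?Q x)) = ennreal c * lux_norm p (\<lambda>x. h ?Q x * indicator ?Q x)"
          using c by (intro p.lux_norm_cmult) simp
        also have "\<dots> \<le> ennreal c * (ennreal A * ennreal ((3 * r) ^ CARD('n)))"
          using lux_norm_h_le[OF Q] A(2) emeasure_big_cell[OF r(1), of k] by (intro mult_left_mono) auto
        also have "\<dots> = ennreal (c * (A * (3 * r) ^ CARD('n)))"
          using c A(1) r by (simp add: ennreal_mult)
        also have "c * (A * (3 * r) ^ CARD('n)) = a * ((2 * M * 3 ^ CARD('n) * A) / D)"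
          using r by (simp add: c_def power_mult_distrib)
        also have "\<dots> \<le> a * 1"
          using a(1) D by (intro mult_left_mono) (auto simp: D_def)
        finally show ?thesis by (simp add: ennreal_leI)
      qed simp
      finally show "lux_norm p (\<lambda>x. ?u x * indicator (cell r k) x) \<le> lux_norm p (\<lambda>x. ?v x * indicator ?Q x)"
        using a by simp
    qed measurable
    moreover have "lux_norm p ?u = ennreal (1 / D) * wn (convolution f \<psi>)"
      unfolding wnorm_def using D by (intro p.lux_norm_cmult) simp
    ultimately have "ennreal D * (ennreal (1 / D) * wn (convolution f \<psi>)) \<le> ennreal D * (ennreal C * wn f)"
      unfolding wnorm_def by (intro mult_left_mono) auto
    then show ?thesis
      using D C(1) by (simp add: mult.assoc[symmetric] flip: ennreal_mult)
  qed
  then show ?thesis using C(1) D by (intro that[of "D * C"]) auto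
qed

end

section \<open>Approximate identities\<close>

context Ap_weight
begin

text \<open>Dominated convergence with W f itself as majorant. It serves both for tails and for the
  removal of large values.\<close>

lemma wnorm_truncation:
  assumes f: "f \<in> wLp p W" and [measurable]: "\<And>j. A j \<in> sets lebesgue"
    and lim: "\<And>x. \<forall>\<^sub>F j in sequentially. x \<notin> A j"
  shows "(\<lambda>j. wn (\<lambda>x. indicator (A j) x *\<^sub>R f x)) \<longlonglongrightarrow> 0"
  unfolding wnorm_def
proof (rule p.lux_norm_dominated)
  have [measurable]: "f \<in> leb_borel" using f by (rule wLpD)
  show "(\<lambda>x. norm (W x *v (indicator (A j) x *\<^sub>R f x))) \<in> leb_borel" for j
    by measurable
  show "(\<lambda>x. ennreal (norm (W x *v f x))) \<in> leb_borel" by measurable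
  show "lux_norm p (\<lambda>x. ennreal (norm (W x *v f x))) < \<infinity>"
    using wLpD(2)[OF f] by (simp add: wnorm_def)
  show "AE x in lebesgue. ennreal (norm (W x *v (indicator (A j) x *\<^sub>R f x))) \<le> ennreal (norm (W x *v f x))" for j
    by (auto split: split_indicator)
  show "AE x in lebesgue. (\<lambda>j. norm (W x *v (indicator (A j) x *\<^sub>R f x))) \<longlonglongrightarrow> 0"
  proof (rule AE_I2)
    fix x
    show "(\<lambda>j. norm (W x *v (indicator (A j) x *\<^sub>R f x))) \<longlonglongrightarrow> 0"
      using lim[of x] by (intro tendsto_eventually) (auto elim!: eventually_mono)
  qed
qed auto

lemma wnorm_vanishes_at_infinity:
  assumes f: "f \<in> wLp p W"
  shows "((\<lambda>R. wtail R f) \<longlongrightarrow> 0) at_top"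
proof (rule tendsto_0_if_eventually_le_ennreal)
  fix e :: real assume "0 < e"
  have lim: "\<forall>\<^sub>F j in sequentially. x \<notin> - ball 0 (real j)" for x :: "real ^ 'n"
  proof -
    obtain N where "norm x < real N" using reals_Archimedean2 by blast
    then show ?thesis unfolding eventually_sequentially by (intro exI[of _ N]) auto
  qed
  have "- ball 0 (real j) \<in> sets (lebesgue :: (real ^ 'n) measure)" for j
    using sets.compl_sets[OF ball_sets_lebesgue[of 0 "real j"]] by (simp add: Compl_eq_Diff_UNIV)
  from wnorm_truncation[OF f this lim] \<open>0 < e\<close>
  have "\<forall>\<^sub>F j in sequentially. wtail (real j) f < ennreal e"
    by (intro order_tendstoD) auto
  then obtain N where N: "wtail (real N) f < ennreal e"
    by (auto simp: eventually_sequentially)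
  show "\<forall>\<^sub>F R in at_top. wtail R f \<le> ennreal e"
    using eventually_ge_at_top[of "real N"]
  proof eventually_elim
    case (elim R)
    have "wtail R f \<le> wtail (real N) f"
      using elim by (intro wnorm_mono) (auto split: split_indicator)
    then show ?case using N by simp
  qed
qed

lemma continuous_bounded_support_in_wLp:
  assumes "continuous_on UNIV g" "\<And>x. norm (g x) \<le> c * indicator (cball 0 R) x" "0 < c"
  shows "g \<in> wLp p W"
proof -
  obtain L where "\<And>f c. 0 < c \<Longrightarrow> (\<And>x. norm (f x) \<le> c * indicator (cball 0 R) x) \<Longrightarrow>
    wn f \<le> ennreal (c * L)"
    by (rule W_bound[of R]) blast
  from this[OF assms(3,2)] borel_measurable_continuous_lebesgue[OF assms(1)] show ?thesis
    by (auto simp: wLp_def intro: le_less_trans)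
qed

text \<open>A measurable function is an almost everywhere limit of continuous ones. Projecting their
  values to the ball of radius c and cutting them off in space gives a common majorant of the
  errors, 2c|W| on a cube, whose norm is finite.\<close>

lemma bounded_support_approximation:
  assumes [measurable]: "f \<in> leb_borel"
    and bound: "\<And>x. norm (f x) \<le> c * indicator (cball 0 R) x" and c: "0 < c" and e: "0 < e"
  shows "\<exists>g. continuous_on UNIV g \<and> (\<forall>x. norm (g x) \<le> c * indicator (cball 0 (R + 1)) x) \<and>
    wdist f g < ennreal e"
proof -
  have "f measurable_on UNIV"
    by (simp add: measurable_on_iff_borel_measurable lebesgue_on_UNIV_eq)
  then obtain N G where N: "negligible N" and G: "\<And>n::nat. continuous_on UNIV (G n)"
    and lim: "\<And>x. x \<notin> N \<Longrightarrow> (\<lambda>n. G n x) \<longlonglongrightarrow> f x"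
    unfolding measurable_on_def by auto
  \<comment> \<open>Nearest-point projection is continuous and fixes the values of f, so it bounds
    the approximants without disturbing the limit.\<close>
  define cp where "cp = closest_point (cball (0 :: real ^ 'm) c)"
  have cp_cont: "continuous_on UNIV cp"
    unfolding cp_def using c by (intro continuous_on_closest_point) auto
  have cp_norm: "norm (cp v) \<le> c" for v
    using closest_point_in_set[of "cball (0 :: real ^ 'm) c" v] c by (auto simp: cp_def)
  \<comment> \<open>A continuous cutoff equal to 1 on the ball of radius R and to 0 outside that of
    radius R + 1.\<close>
  define \<eta> where "\<eta> x = max 0 (min 1 (R + 1 - norm x))" for x :: "real ^ 'n"
  have \<eta>: "0 \<le> \<eta> x" "\<eta> x \<le> 1" for x by (auto simp: \<eta>_def)
  define H where "H n x = \<eta> x *\<^sub>R cp (G n x)" for n x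
  have H_cont: "continuous_on UNIV (H n)" for n
    unfolding H_def \<eta>_def
    by (intro continuous_intros continuous_on_compose2[OF cp_cont G]) auto
  have [measurable]: "H n \<in> leb_borel" for n
    by (rule borel_measurable_continuous_lebesgue[OF H_cont])
  have H_le: "norm (H n x) \<le> c * indicator (cball 0 (R + 1)) x" for n x
  proof (cases "x \<in> cball 0 (R + 1)")
    case True
    have "norm (H n x) = \<eta> x * norm (cp (G n x))" using \<eta> by (simp add: H_def)
    also have "\<dots> \<le> 1 * c" using \<eta> cp_norm by (intro mult_mono) auto
    finally show ?thesis using True by simp
  next
    case False
    then have "\<eta> x = 0" by (simp add: \<eta>_def)
    then show ?thesis using c by (simp add: H_def)
  qed
  have H_lim: "(\<lambda>n. H n x) \<longlonglongrightarrow> f x" if "x \<notin> N" for x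
  proof -
    have "(\<lambda>n. cp (G n x)) \<longlonglongrightarrow> cp (f x)"
      using cp_cont lim[OF that] by (intro continuous_on_tendsto_compose[of UNIV cp]) auto
    also have "cp (f x) = f x"
      using bound[of x] c unfolding cp_def
      by (intro closest_point_self) (auto split: split_indicator_asm intro: order_trans)
    finally have "(\<lambda>n. H n x) \<longlonglongrightarrow> \<eta> x *\<^sub>R f x"
      unfolding H_def by (intro tendsto_intros)
    also have "\<eta> x *\<^sub>R f x = f x"
      using bound[of x] by (cases "x \<in> cball 0 R") (auto simp: \<eta>_def)
    finally show ?thesis .
  qed
  have "(\<lambda>n. wn (\<lambda>x. f x - H n x)) \<longlonglongrightarrow> 0"
    unfolding wnorm_def
  proof (rule p.lux_norm_dominated)
    let ?g = "\<lambda>x. ennreal (2 * c) * (ennreal (onorm ((*v) (W x))) * indicator (cube0 (R + 1)) x)"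
    have [measurable]: "cube0 (R + 1) \<in> sets lebesgue" using cube0_in_cubes by (rule cubesE)
    show "?g \<in> leb_borel" by measurable
    have "lux_norm p ?g = ennreal (2 * c) * lux_norm p (\<lambda>x. ennreal (onorm ((*v) (W x))) * indicator (cube0 (R + 1)) x)"
      using c by (intro p.lux_norm_cmult) simp
    also have "\<dots> < \<infinity>"
      using lux_norm_W_finite[OF cube0_in_cubes, of "R + 1"] by (simp add: ennreal_mult_less_top)
    finally show "lux_norm p ?g < \<infinity>" .
    show "AE x in lebesgue. ennreal (norm (W x *v (f x - H n x))) \<le> ?g x" for n
    proof (rule AE_I2)
      fix x
      show "ennreal (norm (W x *v (f x - H n x))) \<le> ?g x"
      proof (cases "x \<in> cball 0 (R + 1)")
        case True
        have "norm (f x - H n x) \<le> norm (f x) + norm (H n x)" by (rule norm_triangle_ineq4)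
        also have "\<dots> \<le> c + c"
          using bound[of x] H_le[of n x] c by (intro add_mono) (auto split: split_indicator_asm)
        finally have "norm (W x *v (f x - H n x)) \<le> onorm ((*v) (W x)) * (2 * c)"
          by (intro order_trans[OF norm_matrix_vector_le] mult_left_mono) auto
        also have "\<dots> = 2 * c * onorm ((*v) (W x))" by simp
        finally have "ennreal (norm (W x *v (f x - H n x))) \<le> ennreal (2 * c * onorm ((*v) (W x)))"
          by (rule ennreal_leI)
        also have "\<dots> = ennreal (2 * c) * ennreal (onorm ((*v) (W x)))"
          using c by (intro ennreal_mult) auto
        finally show ?thesis
          using subsetD[OF cball_subset_cube0 True] by simp
      next
        case False
        then have "x \<notin> cball 0 R" by auto
        then have "f x = 0" "H n x = 0" using bound[of x] H_le[of n x] False by auto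
        then show ?thesis by simp
      qed
    qed
    show "AE x in lebesgue. (\<lambda>n. norm (W x *v (f x - H n x))) \<longlonglongrightarrow> 0"
    proof (rule AE_I')
      show "N \<in> null_sets lebesgue" using N by (simp add: negligible_iff_null_sets)
      have "(\<lambda>n. norm (W x *v (f x - H n x))) \<longlonglongrightarrow> 0" if "x \<notin> N" for x
      proof -
        have "(\<lambda>n. norm (W x *v (f x - H n x))) \<longlonglongrightarrow> norm (W x *v (f x - f x))"
          by (intro tendsto_norm bounded_linear.tendsto[OF matrix_vector_mul_bounded_linear]
              tendsto_diff tendsto_const H_lim that)
        then show ?thesis by simp
      qed
      then show "{x \<in> space lebesgue. \<not> (\<lambda>n. norm (W x *v (f x - H n x))) \<longlonglongrightarrow> 0} \<subseteq> N" by auto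
    qed
  qed auto
  then have "\<forall>\<^sub>F n in sequentially. wn (\<lambda>x. f x - H n x) < ennreal e"
    using e by (intro order_tendstoD) auto
  then obtain n where "wn (\<lambda>x. f x - H n x) < ennreal e"
    by (auto simp: eventually_sequentially)
  then show ?thesis using H_cont[of n] H_le[of n] by blast
qed

lemma continuous_dense:
  assumes f: "f \<in> wLp p W" and e: "0 < e"
  shows "\<exists>g c R. 0 < c \<and> 0 < R \<and> continuous_on UNIV g \<and> (\<forall>x. norm (g x) \<le> c * indicator (cball 0 R) x) \<and>
    wdist f g < ennreal e"
proof -
  have [measurable]: "f \<in> leb_borel" using f by (rule wLpD)
  define A where "A j = {x. real j < norm x \<or> real j < norm (f x)}" for j :: nat
  have [measurable]: "A j \<in> sets lebesgue" for j
  proof -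
    have [measurable]: "(\<lambda>x :: real ^ 'n. norm x) \<in> leb_borel"
      by (intro borel_measurable_continuous_lebesgue continuous_intros)
    have "{x \<in> space lebesgue. real j < norm x \<or> real j < norm (f x)} \<in> sets lebesgue" by measurable
    then show ?thesis by (simp add: A_def)
  qed
  have "\<forall>\<^sub>F j in sequentially. x \<notin> A j" for x
  proof -
    obtain N where "max (norm x) (norm (f x)) < real N" using reals_Archimedean2 by blast
    then show ?thesis unfolding eventually_sequentially by (intro exI[of _ N]) (auto simp: A_def)
  qed
  then have "(\<lambda>j. wn (\<lambda>x. indicator (A j) x *\<^sub>R f x)) \<longlonglongrightarrow> 0"
    by (intro wnorm_truncation[OF f]) auto
  then have "\<forall>\<^sub>F j in sequentially. wn (\<lambda>x. indicator (A j) x *\<^sub>R f x) < ennreal (e / 2)"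
    using e by (intro order_tendstoD) auto
  then obtain j where j: "wn (\<lambda>x. indicator (A j) x *\<^sub>R f x) < ennreal (e / 2)"
    by (auto simp: eventually_sequentially)
  define f' where "f' x = indicator (- A j) x *\<^sub>R f x" for x
  have [measurable]: "f' \<in> leb_borel"
    unfolding f'_def by measurable
  \<comment> \<open>The bound is \<open>Suc j\<close> rather than j so that it is positive even for
    j = 0.\<close>
  have f'_le: "norm (f' x) \<le> real (Suc j) * indicator (cball 0 (real j)) x" for x
    by (auto simp: f'_def A_def split: split_indicator)
  obtain g where g: "continuous_on UNIV g" "\<And>x. norm (g x) \<le> real (Suc j) * indicator (cball 0 (real j + 1)) x"
    and f'g: "wdist f' g < ennreal (e / 2)"
    using bounded_support_approximation[OF _ f'_le, of "e / 2"] e by auto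
  have [measurable]: "g \<in> leb_borel"
    by (rule borel_measurable_continuous_lebesgue[OF g(1)])
  have "(\<lambda>x. f x - f' x) = (\<lambda>x. indicator (A j) x *\<^sub>R f x)"
    by (auto simp: f'_def fun_eq_iff split: split_indicator)
  then have ff': "wdist f f' < ennreal (e / 2)" using j by simp
  have "wdist f g \<le> wdist f f' + wdist f' g"
    by (rule wnorm_diff_triangle) measurable
  also have "\<dots> < ennreal (e / 2 + e / 2)"
    by (rule add_mono_ennreal[OF ff' f'g])
  finally have "wdist f g < ennreal e" by simp
  then show ?thesis
    using g by (intro exI[of _ g] exI[of _ "real (Suc j)"] exI[of _ "real j + 1"]) auto
qed

end

section \<open>Convergence of mollifications\<close>

locale approximate_identity = Ap_weight p W a b
  for p :: "real ^ 'n \<Rightarrow> real" and W :: "real ^ 'n \<Rightarrow> real ^ 'm ^ 'm" and a b :: real +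
  fixes \<psi> :: "real \<Rightarrow> real ^ 'n \<Rightarrow> real" and M :: real
  assumes p_log_Holder: "p \<in> log_Holder"
    and M_nonneg: "0 \<le> M"
    and kernel: "\<And>r. 0 < r \<Longrightarrow> kernel (\<psi> r) r (M / r ^ CARD('n))"
    and mass: "\<And>r x. 0 < r \<Longrightarrow> (LINT y|lebesgue. \<psi> r (x - y)) = 1"
begin

text \<open>A nonintegrable function would have integral 0 by convention, so the value 1 already
  proves integrability.\<close>

lemma shift_kernel_integrable:
  assumes "0 < r" shows "integrable lebesgue (\<lambda>y. \<psi> r (x - y))"
  using mass[OF assms, of x] not_integrable_integral_eq by fastforce

text \<open>Unit mass turns the difference into an average of g(y) - g(x) over the ball of radius r
  about x.\<close>

lemma norm_convolution_diff_le:
  fixes g :: "real ^ 'n \<Rightarrow> real ^ 'm"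
  assumes r: "0 < r" and g: "loc_integrable g" and near: "\<And>y. norm (x - y) < r \<Longrightarrow> norm (g y - g x) \<le> e"
  shows "norm (convolution g (\<psi> r) x - g x) \<le> e"
proof -
  interpret kernel "\<psi> r" r "M / r ^ CARD('n)" using r by (rule kernel)
  note int = shift_integrable[OF g, of x] integrable_scaleR_left[OF shift_kernel_integrable[OF r, of x], of "g x"]
  have "convolution g (\<psi> r) x - g x = (LINT y|lebesgue. \<psi> r (x - y) *\<^sub>R g y) - (LINT y|lebesgue. \<psi> r (x - y) *\<^sub>R g x)"
    using shift_kernel_integrable[OF r, of x] mass[OF r, of x] by (simp add: convolution_eq[OF g])
  also have "\<dots> = (LINT y|lebesgue. \<psi> r (x - y) *\<^sub>R g y - \<psi> r (x - y) *\<^sub>R g x)"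
    by (rule Bochner_Integration.integral_diff[symmetric]) (use int in auto)
  finally have eq: "convolution g (\<psi> r) x - g x = (LINT y|lebesgue. \<psi> r (x - y) *\<^sub>R g y - \<psi> r (x - y) *\<^sub>R g x)" .
  have "norm (convolution g (\<psi> r) x - g x) \<le> (LINT y|lebesgue. \<psi> r (x - y) * e)"
    unfolding eq
  proof (rule Bochner_Integration.integral_norm_bound_integral)
    show "integrable lebesgue (\<lambda>y. \<psi> r (x - y) *\<^sub>R g y - \<psi> r (x - y) *\<^sub>R g x)"
      by (rule Bochner_Integration.integrable_diff) (use int in auto)
    show "integrable lebesgue (\<lambda>y. \<psi> r (x - y) * e)"
      by (rule integrable_mult_left[OF shift_kernel_integrable[OF r]])
    fix y
    show "norm (\<psi> r (x - y) *\<^sub>R g y - \<psi> r (x - y) *\<^sub>R g x) \<le> \<psi> r (x - y) * e"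
    proof (cases "norm (x - y) < r")
      case True
      then show ?thesis
        using near[OF True] nonneg by (simp add: scaleR_diff_right[symmetric] mult_left_mono)
    next
      case False
      then show ?thesis by (simp add: support)
    qed
  qed
  also have "\<dots> = e" using mass[OF r, of x] by simp
  finally show ?thesis .
qed

lemma convolution_tendsto_continuous:
  fixes g :: "real ^ 'n \<Rightarrow> real ^ 'm"
  assumes g: "continuous_on UNIV g" and bound: "\<And>x. norm (g x) \<le> c * indicator (cball 0 R) x" and c: "0 < c"
  shows "((\<lambda>r. wdist (convolution g (\<psi> r)) g) \<longlongrightarrow> 0) (at_right 0)"
proof (rule tendsto_0_if_eventually_le_ennreal)
  fix e :: real assume e: "0 < e"
  obtain L' where L': "0 < L'" "\<And>f c. 0 < c \<Longrightarrow> (\<And>x. norm (f x) \<le> c * indicator (cball 0 (R + 1)) x) \<Longrightarrow>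
    wn f \<le> ennreal (c * L')"
    by (rule W_bound[of "R + 1"]) blast
  have g_loc: "loc_integrable g"
    by (rule wLp_loc_integrable[OF continuous_bounded_support_in_wLp[OF g bound c]])
  have zero: "g x = 0" if "R < norm x" for x
    using bound[of x] that by simp
  have "uniformly_continuous_on UNIV g"
    by (rule uniformly_continuous_on_compact_support[OF g, of "R + 1"]) (auto intro: zero)
  moreover have eL: "0 < e / L'" using e L' by simp
  ultimately obtain d where d: "0 < d" "\<And>x y. dist y x < d \<Longrightarrow> dist (g y) (g x) < e / L'"
    unfolding uniformly_continuous_on_def by (metis UNIV_I)
  have "\<forall>\<^sub>F r in at_right 0. 0 < r \<and> r < min d 1"
    unfolding eventually_at_right_field using d(1) by (intro exI[of _ "min d 1"]) auto
  then show "\<forall>\<^sub>F r in at_right 0. wdist (convolution g (\<psi> r)) g \<le> ennreal e"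
  proof eventually_elim
    case (elim r)
    then have r: "0 < r" "r < d" "r < 1" by auto
    interpret kernel "\<psi> r" r "M / r ^ CARD('n)" using r(1) by (rule kernel)
    have "norm (convolution g (\<psi> r) x - g x) \<le> e / L' * indicator (cball 0 (R + 1)) x" for x
    proof (cases "x \<in> cball 0 (R + 1)")
      case True
      have "norm (convolution g (\<psi> r) x - g x) \<le> e / L'"
      proof (rule norm_convolution_diff_le[OF r(1) g_loc])
        fix y assume "norm (x - y) < r"
        then have "dist y x < d" using r(2) by (simp add: dist_norm norm_minus_commute)
        then have "dist (g y) (g x) < e / L'" by (rule d(2))
        then show "norm (g y - g x) \<le> e / L'" by (simp add: dist_norm)
      qed
      then show ?thesis using True by simp
    next
      case False
      then have x: "R + 1 < norm x" by simp
      \<comment> \<open>Far from the support the same estimate is used with error 0, since g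
        vanishes on the whole ball of radius r about x. The errors thus share one bounded support
        for all r < 1.\<close>
      have "norm (convolution g (\<psi> r) x - g x) \<le> 0"
      proof (rule norm_convolution_diff_le[OF r(1) g_loc])
        fix y assume "norm (x - y) < r"
        then have "R < norm y" using norm_triangle_sub[of x y] x r by simp
        then show "norm (g y - g x) \<le> 0" using zero x by simp
      qed
      then show ?thesis using False by simp
    qed
    then have "wdist (convolution g (\<psi> r)) g \<le> ennreal (e / L' * L')"
      by (rule L'(2)[OF eL])
    then show ?case using L'(1) by simp
  qed
qed

text \<open>The difference splits into the mollification of f - g, the error of g, and g - f; the
  first and the last together give the factor C + 1.\<close>

lemma wnorm_convolution_diff_le:
  assumes r: "0 < r" and f: "f \<in> wLp p W" and g: "g \<in> wLp p W"
    and C: "\<And>f. f \<in> wLp p W \<Longrightarrow> wn (convolution f (\<psi> r)) \<le> ennreal C * wn f" and "0 \<le> C"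
  shows "wdist (convolution f (\<psi> r)) f
    \<le> ennreal (C + 1) * wdist f g + wdist (convolution g (\<psi> r)) g"
proof -
  interpret kernel "\<psi> r" r "M / r ^ CARD('n)" using r by (rule kernel)
  note loc = wLp_loc_integrable[OF f] wLp_loc_integrable[OF g] wLp_loc_integrable[OF wLp_diff[OF f g]]
  have [measurable]: "f \<in> leb_borel" "g \<in> leb_borel"
    "convolution f (\<psi> r) \<in> leb_borel" "convolution g (\<psi> r) \<in> leb_borel"
    using loc by (auto intro: convolution_measurable loc_integrableD)
  have "wdist (convolution f (\<psi> r)) f
    \<le> wdist (convolution f (\<psi> r)) (convolution g (\<psi> r)) + wdist (convolution g (\<psi> r)) f"
    by (rule wnorm_diff_triangle) measurable
  also have "wdist (convolution g (\<psi> r)) f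
    \<le> wdist (convolution g (\<psi> r)) g + wdist g f"
    by (rule wnorm_diff_triangle) measurable
  also have "(\<lambda>x. convolution f (\<psi> r) x - convolution g (\<psi> r) x) = convolution (\<lambda>x. f x - g x) (\<psi> r)"
    using convolution_diff[OF loc] by (simp add: fun_eq_iff)
  also have "wn (convolution (\<lambda>x. f x - g x) (\<psi> r)) \<le> ennreal C * wdist f g"
    by (rule C[OF wLp_diff[OF f g]])
  also have "wdist g f = wdist f g"
    by (rule wnorm_minus_commute)
  finally have "wdist (convolution f (\<psi> r)) f \<le> ennreal C * wdist f g
    + (wdist (convolution g (\<psi> r)) g + wdist f g)"
    by (simp add: add_mono)
  then show ?thesis
    using \<open>0 \<le> C\<close> by (simp add: distrib_right ac_simps)
qed

text \<open>The approximating set need not lie in F. This lets the lemma serve twice: for a single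
  function with continuous approximants, and for a totally bounded family with a net of its own
  members.\<close>

lemma uniform_convolution_tendsto:
  assumes F: "F \<subseteq> wLp p W"
    and net: "\<And>e. 0 < e \<Longrightarrow> \<exists>K. finite K \<and> K \<subseteq> wLp p W \<and>
      (\<forall>k\<in>K. ((\<lambda>r. wdist (convolution k (\<psi> r)) k) \<longlongrightarrow> 0) (at_right 0)) \<and>
      (\<forall>f\<in>F. \<exists>k\<in>K. wdist f k < ennreal e)"
  shows "((\<lambda>r. SUP f\<in>F. wdist (convolution f (\<psi> r)) f) \<longlongrightarrow> 0) (at_right 0)"
proof (rule tendsto_0_if_eventually_le_ennreal)
  fix e :: real assume e: "0 < e"
  obtain C where C: "0 < C" "\<And>r \<psi> f. 0 < r \<Longrightarrow> 4 * real CARD('n) * r < 1 \<Longrightarrow> kernel \<psi> r (M / r ^ CARD('n)) \<Longrightarrow>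
    f \<in> wLp p W \<Longrightarrow> wn (convolution f \<psi>) \<le> ennreal C * wn f"
    by (rule wnorm_convolution_le[OF p_log_Holder M_nonneg]) blast
  \<comment> \<open>Chosen so that the net error, amplified by C + 1, takes half of e.\<close>
  define \<delta> where "\<delta> = e / 2 / (C + 1)"
  have "z * (y / z) = y" if "0 < z" for y z :: real using that by simp
from this[of "C + 1" "e / 2"] have \<delta>: "0 < \<delta>" "(C + 1) * \<delta> = e / 2"
  using e C(1) unfolding \<delta>_def by (simp, linarith)
  obtain K where K: "finite K" "K \<subseteq> wLp p W"
    "\<And>k. k \<in> K \<Longrightarrow> ((\<lambda>r. wdist (convolution k (\<psi> r)) k) \<longlongrightarrow> 0) (at_right 0)"
    "\<And>f. f \<in> F \<Longrightarrow> \<exists>k\<in>K. wdist f k < ennreal \<delta>"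
    using net[OF \<delta>(1)] by blast
  have "\<forall>\<^sub>F r in at_right 0. \<forall>k\<in>K. wdist (convolution k (\<psi> r)) k < ennreal (e / 2)"
    using K(1,3) e by (intro eventually_ball_finite ballI order_tendstoD(2)[of _ 0]) auto
  moreover have "\<forall>\<^sub>F r in at_right 0. 0 < r \<and> 4 * real CARD('n) * r < 1"
    unfolding eventually_at_right_field
    by (intro exI[of _ "1 / (4 * real CARD('n))"]) (auto simp: pos_less_divide_eq mult.commute)
  ultimately show "\<forall>\<^sub>F r in at_right 0. (SUP f\<in>F. wdist (convolution f (\<psi> r)) f) \<le> ennreal e"
  proof eventually_elim
    case (elim r)
    show ?case
    proof (rule SUP_least)
      fix f assume f: "f \<in> F"
      obtain k where k: "k \<in> K" "wdist f k < ennreal \<delta>" using K(4)[OF f] by blast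
      have fk: "f \<in> wLp p W" "k \<in> wLp p W" using f k(1) K(2) F by auto
      have "wdist (convolution f (\<psi> r)) f
        \<le> ennreal (C + 1) * wdist f k + wdist (convolution k (\<psi> r)) k"
        using elim C kernel by (intro wnorm_convolution_diff_le fk) auto
      also have "\<dots> \<le> ennreal (C + 1) * ennreal \<delta> + ennreal (e / 2)"
        using elim k by (intro add_mono mult_left_mono) auto
      also have "ennreal (C + 1) * ennreal \<delta> = ennreal (e / 2)"
        using C(1) \<delta> by (subst ennreal_mult[symmetric]) auto
      also have "ennreal (e / 2) + ennreal (e / 2) = ennreal e"
        using e by (simp flip: ennreal_plus)
      finally show "wdist (convolution f (\<psi> r)) f \<le> ennreal e" .
    qed
  qed
qed

lemma convolution_tendsto:
  assumes f: "f \<in> wLp p W"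
  shows "((\<lambda>r. wdist (convolution f (\<psi> r)) f) \<longlongrightarrow> 0) (at_right 0)"
proof -
  have "((\<lambda>r. SUP f\<in>{f}. wdist (convolution f (\<psi> r)) f) \<longlongrightarrow> 0) (at_right 0)"
  proof (rule uniform_convolution_tendsto)
    fix e :: real assume "0 < e"
    then obtain g c R where c: "0 < c" and g: "continuous_on UNIV g" "\<And>x. norm (g x) \<le> c * indicator (cball 0 R) x"
      and fg: "wdist f g < ennreal e"
      using continuous_dense[OF f] by blast
    show "\<exists>K. finite K \<and> K \<subseteq> wLp p W \<and>
      (\<forall>k\<in>K. ((\<lambda>r. wdist (convolution k (\<psi> r)) k) \<longlongrightarrow> 0) (at_right 0)) \<and>
      (\<forall>f\<in>{f}. \<exists>k\<in>K. wdist f k < ennreal e)"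
      using continuous_bounded_support_in_wLp[OF g c] convolution_tendsto_continuous[OF g c] fg
      by (intro exI[of _ "{g}"]) auto
  qed (use f in simp)
  then show ?thesis by simp
qed

theorem precompact_iff:
  assumes F: "F \<subseteq> wLp p W"
  shows "wLp_precompact p W F \<longleftrightarrow>
      (SUP f\<in>F. wn f) < \<infinity> \<and>
      ((\<lambda>r. SUP f\<in>F. wdist (convolution f (\<psi> r)) f) \<longlongrightarrow> 0) (at_right 0) \<and>
      ((\<lambda>R. SUP f\<in>F. wtail R f) \<longlongrightarrow> 0) at_top"
  unfolding wLp_precompact_iff_totally_bounded[OF F]
proof (intro iffI conjI)
  assume tb: "\<forall>e>0. \<exists>K. finite K \<and> K \<subseteq> F \<and> (\<forall>f\<in>F. \<exists>k\<in>K. wdist f k < ennreal e)"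
  have F_meas: "f \<in> leb_borel" if "f \<in> F" for f using F that wLpD by blast
  show "(SUP f\<in>F. wn f) < \<infinity>"
  proof -
    obtain K where K: "finite K" "K \<subseteq> F" "\<And>f. f \<in> F \<Longrightarrow> \<exists>k\<in>K. wdist f k < ennreal 1"
      using tb[rule_format, of 1] by auto
    \<comment> \<open>A sum over the net replaces the maximum, so an empty net needs no separate
      treatment.\<close>
    have "wn f \<le> 1 + (\<Sum>k\<in>K. wn k)" if f: "f \<in> F" for f
    proof -
      obtain k where k: "k \<in> K" "wdist f k < ennreal 1" using K(3)[OF f] by blast
      have "wn f \<le> wdist f k + wn k"
        using f k K(2) by (intro wnorm_le_diff_add F_meas) auto
      also have "\<dots> \<le> 1 + (\<Sum>k\<in>K. wn k)"
        using k K(1) by (intro add_mono member_le_sum) auto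
      finally show ?thesis .
    qed
    then have "(SUP f\<in>F. wn f) \<le> 1 + (\<Sum>k\<in>K. wn k)" by (rule SUP_least)
    also have "\<dots> < \<infinity>"
      using K(1,2) F wLpD(2) by (auto simp: less_top[symmetric] ennreal_add_eq_top)
    finally show ?thesis .
  qed
  show "((\<lambda>r. SUP f\<in>F. wdist (convolution f (\<psi> r)) f) \<longlongrightarrow> 0) (at_right 0)"
  proof (rule uniform_convolution_tendsto[OF F])
    fix e :: real assume "0 < e"
    then obtain K where K: "finite K" "K \<subseteq> F" "\<forall>f\<in>F. \<exists>k\<in>K. wdist f k < ennreal e"
      using tb by meson
    then show "\<exists>K. finite K \<and> K \<subseteq> wLp p W \<and>
      (\<forall>k\<in>K. ((\<lambda>r. wdist (convolution k (\<psi> r)) k) \<longlongrightarrow> 0) (at_right 0)) \<and>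
      (\<forall>f\<in>F. \<exists>k\<in>K. wdist f k < ennreal e)"
      using F convolution_tendsto by (intro exI[of _ K] conjI) auto
  qed
  show "((\<lambda>R. SUP f\<in>F. wtail R f) \<longlongrightarrow> 0) at_top"
  proof (rule tendsto_0_if_eventually_le_ennreal)
    fix e :: real assume e: "0 < e"
    then obtain K where K: "finite K" "K \<subseteq> F" "\<And>f. f \<in> F \<Longrightarrow> \<exists>k\<in>K. wdist f k < ennreal (e / 2)"
      using tb[rule_format, of "e / 2"] by auto
    have "\<forall>\<^sub>F R in at_top. \<forall>k\<in>K. wtail R k < ennreal (e / 2)"
      using K F e wnorm_vanishes_at_infinity by (intro eventually_ball_finite ballI order_tendstoD(2)[of _ 0]) auto
    then show "\<forall>\<^sub>F R in at_top. (SUP f\<in>F. wtail R f) \<le> ennreal e"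
    proof eventually_elim
      case (elim R)
      show ?case
      proof (rule SUP_least)
        fix f assume f: "f \<in> F"
        obtain k where k: "k \<in> K" "wdist f k < ennreal (e / 2)" using K(3)[OF f] by blast
        let ?\<chi> = "indicator (- ball 0 R) :: real ^ 'n \<Rightarrow> real"
        have [measurable]: "f \<in> leb_borel" "k \<in> leb_borel"
          using f k(1) K(2) by (auto intro: F_meas)
        have [measurable]: "- ball 0 R \<in> sets (lebesgue :: (real ^ 'n) measure)"
          using sets.compl_sets[OF ball_sets_lebesgue[of 0 R]] by (simp add: Compl_eq_Diff_UNIV)
        have "wn (\<lambda>x. ?\<chi> x *\<^sub>R f x) \<le> wn (\<lambda>x. ?\<chi> x *\<^sub>R f x - ?\<chi> x *\<^sub>R k x) + wn (\<lambda>x. ?\<chi> x *\<^sub>R k x)"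
          by (rule wnorm_le_diff_add) measurable
        also have "wn (\<lambda>x. ?\<chi> x *\<^sub>R f x - ?\<chi> x *\<^sub>R k x) \<le> wdist f k"
          by (rule wnorm_mono) (simp split: split_indicator)
        finally have "wn (\<lambda>x. ?\<chi> x *\<^sub>R f x) \<le> wdist f k + wn (\<lambda>x. ?\<chi> x *\<^sub>R k x)"
          by (simp add: add_right_mono)
        also have "\<dots> \<le> ennreal (e / 2) + ennreal (e / 2)"
          using elim k by (intro add_mono) auto
        also have "\<dots> = ennreal e" using e by (simp flip: ennreal_plus)
        finally show "wn (\<lambda>x. ?\<chi> x *\<^sub>R f x) \<le> ennreal e" .
      qed
    qed
  qed
next
  assume *: "(SUP f\<in>F. wn f) < \<infinity> \<and>
      ((\<lambda>r. SUP f\<in>F. wdist (convolution f (\<psi> r)) f) \<longlongrightarrow> 0) (at_right 0) \<and>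
      ((\<lambda>R. SUP f\<in>F. wtail R f) \<longlongrightarrow> 0) at_top"
  show "\<forall>e>0. \<exists>K. finite K \<and> K \<subseteq> F \<and> (\<forall>f\<in>F. \<exists>k\<in>K. wdist f k < ennreal e)"
  proof (intro allI impI)
    fix e :: real assume e: "0 < e"
    have "\<forall>\<^sub>F r in at_right 0. (SUP f\<in>F. wdist (convolution f (\<psi> r)) f) < ennreal (e / 6)"
      using * e by (intro order_tendstoD(2)[of _ 0]) auto
    then have "\<forall>\<^sub>F r in at_right 0. (SUP f\<in>F. wdist (convolution f (\<psi> r)) f) < ennreal (e / 6) \<and> 0 < r"
      by (intro eventually_conj eventually_at_right_less)
    from eventually_happens'[OF _ this] obtain r
      where r: "(SUP f\<in>F. wdist (convolution f (\<psi> r)) f) < ennreal (e / 6)" "0 < r"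
      by (auto simp: trivial_limit_at_right_real)
    have "\<forall>\<^sub>F R in at_top. (SUP f\<in>F. wtail R f) < ennreal (e / 6)"
      using * e by (intro order_tendstoD(2)[of _ 0]) auto
    then have "\<forall>\<^sub>F R in at_top. (SUP f\<in>F. wtail R f) < ennreal (e / 6) \<and> (0 :: real) < R"
      by (intro eventually_conj eventually_gt_at_top)
    from eventually_happens'[OF _ this] obtain R
      where R: "(SUP f\<in>F. wtail R f) < ennreal (e / 6)" "0 < R"
      by auto
    show "\<exists>K. finite K \<and> K \<subseteq> F \<and> (\<forall>f\<in>F. \<exists>k\<in>K. wdist f k < ennreal e)"
    proof (rule totally_bounded_if_approximable[OF F _ e kernel[OF r(2)] R(2)])
      show "(SUP f\<in>F. wn f) < \<infinity>" using * by blast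
      show "wdist (convolution f (\<psi> r)) f \<le> ennreal (e / 6)" if "f \<in> F" for f
        using SUP_upper[OF that, of "\<lambda>f. wdist (convolution f (\<psi> r)) f"] r(1) by simp
      show "wtail R f < ennreal (e / 6)" if "f \<in> F" for f
        using SUP_upper[OF that, of "\<lambda>f. wtail R f"] R(1)
        by (rule le_less_trans)
    qed
  qed
qed

end

section \<open>The compactness criterion\<close>

text \<open>Continuity is what promotes the essential bounds of the exponent to bounds at every
  point.\<close>

lemma log_Holder_continuous:
  fixes p :: "real ^ 'n \<Rightarrow> real"
  assumes "p \<in> log_Holder" shows "continuous_on UNIV p"
proof (rule continuous_onI)
  fix x :: "real ^ 'n" and e :: real assume e: "0 < e"
  obtain C where C: "0 < C" "\<And>x y. norm (x - y) < 1 / 2 \<Longrightarrow> \<bar>p x - p y\<bar> \<le> C / ln (exp 1 + 1 / norm (x - y))"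
    using assms unfolding log_Holder_def by blast
  show "\<exists>d>0. \<forall>y\<in>UNIV. dist y x < d \<longrightarrow> dist (p y) (p x) \<le> e"
  \<comment> \<open>At distance below exp(-C/e) the logarithm in the modulus is at least C/e, so the
    modulus is at most e.\<close>
  proof (intro exI[of _ "min (1 / 2) (exp (- (C / e)))"] conjI ballI impI)
    fix y assume d: "dist y x < min (1 / 2) (exp (- (C / e)))"
    show "dist (p y) (p x) \<le> e"
    proof (cases "y = x")
      case False
      then have pos: "0 < norm (y - x)" by simp
      have "norm (y - x) \<le> exp (- (C / e))" using d by (simp add: dist_norm)
      then have "1 / exp (- (C / e)) \<le> 1 / norm (y - x)"
        using pos by (intro divide_left_mono) auto
      then have "exp (C / e) \<le> 1 / norm (y - x)"
        by (simp add: exp_minus inverse_eq_divide)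
      then have "exp (C / e) \<le> exp 1 + 1 / norm (y - x)"
        by (simp add: add_increasing)
      then have "C / e \<le> ln (exp 1 + 1 / norm (y - x))"
        using pos by (subst ln_ge_iff) (auto intro!: add_pos_pos)
      then have "C / ln (exp 1 + 1 / norm (y - x)) \<le> C / (C / e)"
        using C(1) e by (intro divide_left_mono mult_pos_pos) (auto intro: less_le_trans[of 0 "C / e"])
      also have "\<dots> = e" using C(1) by simp
      finally show ?thesis
        using C(2)[of y x] d by (simp add: dist_norm dist_real_def)
    qed (use e in simp)
  qed simp
qed

lemma matrix_weight_measurable:
  fixes W :: "real ^ 'n \<Rightarrow> real ^ 'm ^ 'm"
  assumes "matrix_weight W"
  shows "W \<in> leb_borel"
proof (intro borel_measurable_vecI)
  fix i j
  have meas: "(\<lambda>x. indicator (cball 0 (real k)) x *\<^sub>R (W x $ i $ j)) \<in> leb_borel" for k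
  proof -
    have "(\<lambda>x. W x $ i $ j) absolutely_integrable_on cball 0 (real k)"
      using assms by (simp add: matrix_weight_def)
    then show ?thesis
      unfolding set_integrable_def by (rule borel_measurable_integrable)
  qed
  have lim: "(\<lambda>k. indicator (cball 0 (real k)) x *\<^sub>R (W x $ i $ j)) \<longlonglongrightarrow> W x $ i $ j" for x
  proof (rule tendsto_eventually)
    obtain N where "norm x < real N" using reals_Archimedean2 by blast
    then show "\<forall>\<^sub>F k in sequentially. indicator (cball 0 (real k)) x *\<^sub>R (W x $ i $ j) = W x $ i $ j"
      unfolding eventually_sequentially by (intro exI[of _ N]) auto
  qed
  show "(\<lambda>x. W x $ i $ j) \<in> leb_borel"
    by (rule borel_measurable_LIMSEQ_real[OF lim meas])
qed

text \<open>By continuity the sets where p respects a bound are closed, and a closed set of full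
  measure is the whole space.\<close>

lemma exponent_bounds:
  fixes p :: "real ^ 'n \<Rightarrow> real"
  assumes "p \<in> exponents \<inter> log_Holder"
  obtains a b where "1 < a" "\<And>x. a \<le> p x" "\<And>x. p x \<le> b"
proof -
  have cont: "continuous_on UNIV p" using assms by (auto intro: log_Holder_continuous)
  have "1 < p_minus p" using assms by (simp add: exponents_def)
  then obtain w where w: "1 < w" "w < p_minus p" using dense by blast
  then have "AE x in lebesgue. w < ereal (p x)"
    unfolding p_minus_def by (intro less_LiminfD)
  moreover obtain a where a: "w = ereal a" "1 < a"
    using w by (cases w) (auto simp: one_ereal_def)
  ultimately have "AE x in lebesgue. x \<in> {x. a \<le> p x}"
    by (auto elim!: eventually_mono)
  moreover have "closed {x. a \<le> p x}" by (intro closed_Collect_le cont continuous_intros)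
  ultimately have a_le: "a \<le> p x" for x using mem_closed_if_AE_lebesgue by blast
  have "p_plus p < \<infinity>" using assms by (simp add: exponents_def)
  then obtain b where b: "p_plus p \<le> ereal b"
    by (cases "p_plus p") auto
  have "AE x in lebesgue. ereal (p x) \<le> p_plus p"
    unfolding p_plus_def by (rule esssup_AE)
  then have "AE x in lebesgue. x \<in> {x. p x \<le> b}"
  proof eventually_elim
    case (elim x)
    then have "ereal (p x) \<le> ereal b" using b by (rule order_trans)
    then show ?case by simp
  qed
  moreover have "closed {x. p x \<le> b}" by (intro closed_Collect_le cont continuous_intros)
  ultimately have le_b: "p x \<le> b" for x using mem_closed_if_AE_lebesgue by blast
  show ?thesis using that[OF a(2) a_le le_b] .
qed

lemma Cc_infinity_ball:
  assumes "\<phi> \<in> Cc_infinity (ball 0 1)"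
  shows "continuous_on UNIV \<phi>" "\<And>x. 1 \<le> norm x \<Longrightarrow> \<phi> x = 0"
proof -
  have "Ck 0 \<phi>" using assms unfolding Cc_infinity_def by blast
  then show "continuous_on UNIV \<phi>" by simp
  fix x :: "real ^ 'a" assume "1 \<le> norm x"
  then have "x \<notin> closure {x. \<phi> x \<noteq> 0}" using assms unfolding Cc_infinity_def by auto
  then show "\<phi> x = 0" using closure_subset[of "{x. \<phi> x \<noteq> 0}"] by blast
qed

lemma integral_dilate:
  assumes cont: "continuous_on UNIV \<phi>" and r: "0 < r"
  shows "(LINT y|lebesgue. dilate \<phi> r (x - y)) = (LINT y|lebesgue. \<phi> (y :: real ^ 'n))"
proof -
  have [measurable]: "\<phi> \<in> leb_borel"
    using cont by (rule borel_measurable_continuous_lebesgue)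
  have "(LINT y|lebesgue. \<phi> y) = \<bar>- (1 / r)\<bar> ^ CARD('n) *\<^sub>R (LINT y|lebesgue. \<phi> ((1 / r) *\<^sub>R x + (- (1 / r)) *\<^sub>R y))"
    using integral_lebesgue_affine[of \<phi> "- (1 / r)" "(1 / r) *\<^sub>R x"] r by simp
  also have "\<dots> = (LINT y|lebesgue. \<bar>- (1 / r)\<bar> ^ CARD('n) *\<^sub>R \<phi> ((1 / r) *\<^sub>R x + (- (1 / r)) *\<^sub>R y))"
    by simp
  also have "\<dots> = (LINT y|lebesgue. dilate \<phi> r (x - y))"
    using r by (intro Bochner_Integration.integral_cong)
      (auto simp: dilate_def scaleR_diff_right inverse_eq_divide power_divide)
  finally show ?thesis by simp
qed

theorem theorem5p1:
  fixes p :: "real ^ 'n \<Rightarrow> real"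
    and W :: "real ^ 'n \<Rightarrow> real ^ 'm ^ 'm"
    and \<phi> :: "real ^ 'n \<Rightarrow> real"
    and F :: "(real ^ 'n \<Rightarrow> real ^ 'm) set"
  assumes "p \<in> exponents \<inter> log_Holder"
    and "matrix_weight W"
    and "W \<in> Ap p"
    and "\<phi> \<in> Cc_infinity (ball 0 1)"
    and "\<And>x. 0 \<le> \<phi> x"
    and "\<And>x y. norm x = norm y \<Longrightarrow> \<phi> x = \<phi> y"
    and "\<And>x y. norm x \<le> norm y \<Longrightarrow> \<phi> y \<le> \<phi> x"
    and "(LINT x|lebesgue. \<phi> x) = 1"
    and "F \<subseteq> wLp p W"
  shows "wLp_precompact p W F \<longleftrightarrow>
      (SUP f\<in>F. wnorm p W f) < \<infinity> \<and>
      ((\<lambda>r. SUP f\<in>F. wnorm p W (\<lambda>x. convolution f (dilate \<phi> r) x - f x)) \<longlongrightarrow> 0) (at_right 0) \<and>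
      ((\<lambda>R. SUP f\<in>F. wnorm p W (\<lambda>x. indicator (- ball 0 R) x *\<^sub>R f x)) \<longlongrightarrow> 0) at_top"
proof -
  obtain a b where ab: "1 < a" "\<And>x. a \<le> p x" "\<And>x. p x \<le> b"
    using assms(1) by (rule exponent_bounds) blast
  note \<phi> = Cc_infinity_ball[OF assms(4)]
  \<comment> \<open>A radially decreasing bump is largest at the origin, so its value there serves
    as the constant M for all dilations.\<close>
  have kernel: "kernel (dilate \<phi> r) r (\<phi> 0 / r ^ CARD('n))" if r: "0 < r" for r
  proof
    show "continuous_on UNIV (dilate \<phi> r)"
      unfolding dilate_def using r by (intro continuous_intros continuous_on_compose2[OF \<phi>(1)]) auto
    show "dilate \<phi> r x = 0" if "r \<le> norm x" for x
      using that r by (auto simp: dilate_def divide_simps intro!: \<phi>(2))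
    show "0 \<le> dilate \<phi> r x" for x using assms(5) r by (simp add: dilate_def)
    show "dilate \<phi> r x \<le> \<phi> 0 / r ^ CARD('n)" for x
      using assms(7)[of 0 "x /\<^sub>R r"] r by (simp add: dilate_def divide_right_mono)
  qed
  have "Ap_weight p W a b"
  proof
    show "p \<in> borel_measurable lebesgue" using assms(1) by (simp add: exponents_def)
    show "W \<in> borel_measurable lebesgue" using assms(2) by (rule matrix_weight_measurable)
    show "AE x in lebesgue. invertible (W x)" using assms(2) by (simp add: matrix_weight_def)
    show "Ap_const p W < \<infinity>" using assms(3) by (simp add: Ap_def)
  qed (rule ab)+
  then interpret approximate_identity p W a b "dilate \<phi>" "\<phi> 0"
  proof (intro approximate_identity.intro approximate_identity_axioms.intro)
    show "p \<in> log_Holder" using assms(1) by simp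
    show "(LINT y|lebesgue. dilate \<phi> r (x - y)) = 1" if "0 < r" for r x
      using integral_dilate[OF \<phi>(1) that] assms(8) by simp
  qed (use assms(5) kernel in auto)
  show ?thesis using assms(9) by (rule precompact_iff)
qed

end
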